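(* Let $A_1,\dots,A_M\in\mathbb{R}^{n\times n}$, $\mathcal{M}=\{1,\dots,M\}$ and $A(w)=\sum_{i\in\mathcal{M}}w_iA_i$ for $w\in\mathcal{W}$. (DT) Let $m=\dim\bigcap_{i\in\mathcal{M}}\ker(A_i-I)$. The difference inclusion $x(k+1)=A(w(k))x(k)$ is strongly convergent if and only if there exist a full row rank matrix $X$ and matrices $$P_i=\begin{bmatrix}P_i^{\mathrm{as}}&0\\P_i^{\mathrm{r}}&I_m\end{bmatrix},\quad i\in\mathcal{M},$$ such that $\|P_i^{\mathrm{as}}\|_1<1$ and $A_iX=XP_i$ for all $i\in\mathcal{M}$. (CT) Let $m=\dim\bigcap_{i\in\mathcal{M}}\ker(A_i)$. The differential inclusion $\dot x(t)=A(w(t))x(t)$ is strongly convergent if and only if there exist a full row rank matrix $X$ and matrices $$P_i=\begin{bmatrix}P_i^{\mathrm{as}}&0\\P_i^{\mathrm{r}}&0_m\end{bmatrix},\quad i\in\mathcal{M},$$ such that $\mu(P_i^{\mathrm{as}})<0$ and $A_iX=XP_i$ for all $i\in\mathcal{M}$.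
   Context: $\mathcal{W}=\{w\in\mathbb{R}^M:\ \sum_{i\in\mathcal{M}}w_i=1,\ w_i\ge0\ \forall i\in\mathcal{M}\}$. Let $\bar{\mathcal{X}}=\bigcap_{i\in\mathcal{M}}\ker(A_i-I)$ in discrete time and $\bar{\mathcal{X}}=\bigcap_{i\in\mathcal{M}}\ker(A_i)$ in continuous time. The inclusion is strongly convergent if for every sequence $w(k)\in\mathcal{W}$, $k\in\mathbb{N}$ (resp. every measurable function $w(t)\in\mathcal{W}$, $t\ge0$) and every $x(0)\in\mathbb{R}^n$ the solution converges, as time tends to infinity, to some $\bar x\in\bar{\mathcal{X}}$. $\|\cdot\|_1$ is the matrix norm induced by the vector $1$-norm and $\mu(P)=\lim_{h\to0^+}\frac{\|I+hP\|_1-1}{h}$ is the associated Lozinski measure. The matrix $X$ has $n$ rows and $r+m$ columns, where $P_i^{\mathrm{as}}\in\mathbb{R}^{r\times r}$ for some $r$ (common to all $i$); blocks may be empty. *)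

theory Defs
  imports
    "HOL-Analysis.Analysis"
    "Jordan_Normal_Form.Matrix_Kernel"
    "Jordan_Normal_Form.DL_Rank"
begin

(* "$" is vector indexing for the type 'a vec with explicit dimension *)
no_notation vec_nth (infixl "$" 90)

(* The index set {1..M} is rendered as {..<M}; matrices and vectors are indexed from 0. *)

definition weights :: "nat \<Rightarrow> real vec set" where
  "weights M = {w \<in> carrier_vec M. (\<Sum>i<M. w $ i) = 1 \<and> (\<forall>i<M. 0 \<le> w $ i)}"

definition convex_mat :: "nat \<Rightarrow> nat \<Rightarrow> (nat \<Rightarrow> real mat) \<Rightarrow> real vec \<Rightarrow> real mat" where
  "convex_mat n M A w = mat n n (\<lambda>(j, k). \<Sum>i<M. w $ i * A i $$ (j, k))"

definition subspace_dim :: "nat \<Rightarrow> real vec set \<Rightarrow> nat" where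
  "subspace_dim n W = vectorspace.dim class_ring ((module_vec TYPE(real) n)\<lparr>carrier := W\<rparr>)"

(* In the two definitions below the intersection is over a nonempty family when 0 < M. *)

definition equilibria_dt :: "nat \<Rightarrow> nat \<Rightarrow> (nat \<Rightarrow> real mat) \<Rightarrow> real vec set" where
  "equilibria_dt n M A = (\<Inter>i<M. mat_kernel (A i - 1\<^sub>m n))"

definition equilibria_ct :: "nat \<Rightarrow> (nat \<Rightarrow> real mat) \<Rightarrow> real vec set" where
  "equilibria_ct M A = (\<Inter>i<M. mat_kernel (A i))"

(* Convergence in R^n, stated by components because the type of vectors with
   explicit dimension carries no topology. *)

definition vec_tendsto :: "nat \<Rightarrow> ('a \<Rightarrow> real vec) \<Rightarrow> real vec \<Rightarrow> 'a filter \<Rightarrow> bool" where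
  "vec_tendsto n f l F \<longleftrightarrow> (\<forall>j<n. ((\<lambda>t. f t $ j) \<longlongrightarrow> l $ j) F)"

definition solution_dt ::
  "nat \<Rightarrow> nat \<Rightarrow> (nat \<Rightarrow> real mat) \<Rightarrow> (nat \<Rightarrow> real vec) \<Rightarrow> (nat \<Rightarrow> real vec) \<Rightarrow> bool" where
  "solution_dt n M A w x \<longleftrightarrow>
     x 0 \<in> carrier_vec n \<and> (\<forall>k. x (Suc k) = convex_mat n M A (w k) *\<^sub>v x k)"

definition strongly_convergent_dt :: "nat \<Rightarrow> nat \<Rightarrow> (nat \<Rightarrow> real mat) \<Rightarrow> bool" where
  "strongly_convergent_dt n M A \<longleftrightarrow>
     (\<forall>w x. (\<forall>k. w k \<in> weights M) \<longrightarrow> solution_dt n M A w x \<longrightarrow>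
        (\<exists>xbar \<in> equilibria_dt n M A. vec_tendsto n x xbar sequentially))"

definition measurable_weights :: "nat \<Rightarrow> (real \<Rightarrow> real vec) \<Rightarrow> bool" where
  "measurable_weights M w \<longleftrightarrow>
     (\<forall>t\<ge>0. w t \<in> weights M) \<and>
     (\<forall>i<M. (\<lambda>t. w t $ i) \<in> borel_measurable (lebesgue_on {0..}))"

(* Since w is merely measurable, x' = A(w) x on [0, \<infinity>) is understood in the sense of
   Caratheodory: x(t) = x(0) + (integral of A(w(s)) x(s) over 0 \<le> s \<le> t), x continuous.
   The integrand is then bounded and measurable on {0..t}, so the gauge integral used here
   is the Lebesgue integral. *)

definition solution_ct ::
  "nat \<Rightarrow> nat \<Rightarrow> (nat \<Rightarrow> real mat) \<Rightarrow> (real \<Rightarrow> real vec) \<Rightarrow> (real \<Rightarrow> real vec) \<Rightarrow> bool" where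
  "solution_ct n M A w x \<longleftrightarrow>
     (\<forall>t\<ge>0. x t \<in> carrier_vec n) \<and>
     (\<forall>j<n. continuous_on {0..} (\<lambda>t. x t $ j)) \<and>
     (\<forall>t\<ge>0. \<forall>j<n.
        ((\<lambda>s. (convex_mat n M A (w s) *\<^sub>v x s) $ j) has_integral (x t $ j - x 0 $ j)) {0..t})"

definition strongly_convergent_ct :: "nat \<Rightarrow> nat \<Rightarrow> (nat \<Rightarrow> real mat) \<Rightarrow> bool" where
  "strongly_convergent_ct n M A \<longleftrightarrow>
     (\<forall>w x. measurable_weights M w \<longrightarrow> solution_ct n M A w x \<longrightarrow>
        (\<exists>xbar \<in> equilibria_ct M A. vec_tendsto n x xbar at_top))"

definition vec_norm1 :: "real vec \<Rightarrow> real" where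
  "vec_norm1 v = (\<Sum>i<dim_vec v. \<bar>v $ i\<bar>)"

(* The supremum over the unit ball (rather than the unit sphere) gives 0 for a matrix
   with no columns. *)

definition mat_norm1 :: "real mat \<Rightarrow> real" where
  "mat_norm1 P = (SUP v \<in> {v \<in> carrier_vec (dim_col P). vec_norm1 v \<le> 1}. vec_norm1 (P *\<^sub>v v))"

(* The limit is taken in the extended reals only to cover the empty matrix, where the
   quotient is -1/h and the measure is -\<infinity>; for r \<times> r matrices with r > 0 the
   limit exists in the reals. *)

definition lozinski1 :: "real mat \<Rightarrow> ereal" where
  "lozinski1 P =
     Lim (at_right 0)
       (\<lambda>h. ereal ((mat_norm1 (1\<^sub>m (dim_row P) + h \<cdot>\<^sub>m P) - 1) / h))"

definition full_row_rank :: "nat \<Rightarrow> real mat \<Rightarrow> bool" where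
  "full_row_rank n X \<longleftrightarrow> vec_space.rank n X = n"

end

theory Submission
  imports Defs "HOL-Complex_Analysis.Great_Picard"
begin

text \<open>
  Both equivalences are statements about Euler steps. Put \<open>G i = A i - I\<close> in discrete time and
  \<open>G i = A i\<close> in continuous time, and let \<open>V\<close> be the common kernel of the
  \<open>G i\<close>, that is, the set of equilibria. Then \<open>A i * X = X * P i\<close> says that
  \<open>G i * X = X * Q i\<close>, where the last \<open>m\<close> columns of \<open>Q i\<close> vanish. The condition on
  the stable block says that for some step size \<open>h\<close> the matrices \<open>I + h * Q i\<close> have an upper
  left block of norm below one: \<open>h\<close> is one in discrete time, and in continuous time some
  \<open>h > 0\<close> is available because a Lozinski measure is negative if and only if such a step size
  exists (\<open>lozinski1_neg_iff\<close>). Hence both certificates are instances of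
  \<open>matrix_certificate\<close>.

  A certificate implies convergence. The first columns of \<open>X\<close> and their negatives span a polytope, which
  together with \<open>V\<close> is the unit ball of a seminorm vanishing on \<open>V\<close>. An Euler step of length
  \<open>\<delta> \<le> h\<close> with arbitrary weights shrinks this seminorm by the factor \<open>1 - \<delta> * rate\<close>
  (\<open>covered_euler_step\<close>). In discrete time it decays geometrically. In continuous time a solution is
  approximated by Euler steps with averaged weights, and the seminorm decays exponentially
  (\<open>covered_decays_along_solution\<close>). As it bounds the speed up to a constant, trajectories have finite length and converge,
  and their limits lie in \<open>V\<close>.

  Convergence implies a certificate. Let the defect of \<open>x\<close> be the sum of the norms of the
  \<open>G i x\<close>. If the defect is not contracted uniformly by the Euler steps of length \<open>h\<close>, there are
  arbitrarily long trajectories from a bounded set along which it stays above one half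
  (\<open>persistent_trajectories_if_not_contracting\<close>). In discrete time a limit of these trajectories does not
  approach \<open>V\<close>. In continuous time, if no step size is contracting, a limit for vanishing step size is a solution
  for measurable weights that does not approach \<open>V\<close>
  (\<open>persistent_solution_if_no_step_contracts\<close>); its weights are densities of the limits of the accumulated
  weights. So some step size contracts, and the images of the unit vectors under all words up to a fixed length, suitably
  scaled, form the columns of a certificate (\<open>certificate_if_contracting\<close>), to which a basis of
  \<open>V\<close> is appended (\<open>matrix_certificate_if_contracting\<close>).
\<close>

no_notation vec_nth (infixl "$" 90)

section \<open>The 1-norm of coordinate functions\<close>

definition norm1 :: "nat \<Rightarrow> (nat \<Rightarrow> real) \<Rightarrow> real" where
  "norm1 n x = (\<Sum>j<n. \<bar>x j\<bar>)"

lemma norm1_nonneg [simp]: "0 \<le> norm1 n x"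
  by (simp add: norm1_def sum_nonneg)

lemma norm1_add_le: "norm1 n (\<lambda>j. x j + y j) \<le> norm1 n x + norm1 n y"
  unfolding norm1_def sum.distrib [symmetric] by (intro sum_mono) auto

lemma norm1_triangle: "norm1 n (\<lambda>j. x j - z j) \<le> norm1 n (\<lambda>j. x j - y j) + norm1 n (\<lambda>j. y j - z j)"
  unfolding norm1_def sum.distrib [symmetric] by (intro sum_mono) auto

lemma norm1_scale: "norm1 n (\<lambda>j. c * x j) = \<bar>c\<bar> * norm1 n x"
  by (simp add: norm1_def abs_mult sum_distrib_left)

lemma norm1_sum_le: "norm1 n (\<lambda>j. \<Sum>i\<in>I. f i j) \<le> (\<Sum>i\<in>I. norm1 n (f i))"
  unfolding norm1_def by (subst sum.swap) (intro sum_mono sum_abs)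

lemma norm1_cong: "(\<And>j. j < n \<Longrightarrow> x j = y j) \<Longrightarrow> norm1 n x = norm1 n y"
  by (simp add: norm1_def)

lemma abs_le_norm1: "j < n \<Longrightarrow> \<bar>x j\<bar> \<le> norm1 n x"
  unfolding norm1_def by (rule member_le_sum) auto

lemma norm1_eq_0_iff: "norm1 n x = 0 \<longleftrightarrow> (\<forall>j<n. x j = 0)"
  by (auto simp: norm1_def sum_nonneg_eq_0_iff)

lemma tendsto_norm1:
  "(\<And>j. j < n \<Longrightarrow> ((\<lambda>t. x t j) \<longlongrightarrow> y j) F) \<Longrightarrow> ((\<lambda>t. norm1 n (x t)) \<longlongrightarrow> norm1 n y) F"
  unfolding norm1_def by (intro tendsto_sum tendsto_rabs) auto

section \<open>Mixtures of finitely many linear generators\<close>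

text \<open>
  A vector is a function on the natural numbers of which only the coordinates below \<open>n\<close>
  matter; dimension and number of generators thus remain ordinary numbers. The difference inclusion
  uses the generators \<open>A i - I\<close>, the differential inclusion the generators \<open>A i\<close>.
\<close>

locale generators =
  fixes n M :: nat and g :: "nat \<Rightarrow> nat \<Rightarrow> nat \<Rightarrow> real"
begin

definition G :: "nat \<Rightarrow> (nat \<Rightarrow> real) \<Rightarrow> nat \<Rightarrow> real" where
  "G i x j = (\<Sum>k<n. g i j k * x k)"

definition mix :: "(nat \<Rightarrow> real) \<Rightarrow> (nat \<Rightarrow> real) \<Rightarrow> nat \<Rightarrow> real" where
  "mix w x j = (\<Sum>i<M. w i * G i x j)"

definition mixtures :: "(nat \<Rightarrow> real) set" where
  "mixtures = {w. (\<forall>i<M. 0 \<le> w i) \<and> (\<Sum>i<M. w i) = 1}"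

text \<open>
  This seminorm vanishes exactly on the common kernel and bounds the speed of every mixture
  (\<open>norm1_mix_le_defect\<close>). It serves as a norm on the quotient by the kernel and makes
  a change of basis unnecessary.
\<close>

definition defect :: "(nat \<Rightarrow> real) \<Rightarrow> real" where
  "defect x = (\<Sum>i<M. norm1 n (G i x))"

definition ker :: "(nat \<Rightarrow> real) set" where
  "ker = {v. \<forall>i<M. \<forall>j<n. G i v j = 0}"

definition Lip :: real where
  "Lip = (\<Sum>i<M. \<Sum>j<n. \<Sum>k<n. \<bar>g i j k\<bar>)"

lemma Lip_nonneg [simp]: "0 \<le> Lip"
  by (simp add: Lip_def sum_nonneg)

lemma G_cong: "(\<And>k. k < n \<Longrightarrow> x k = y k) \<Longrightarrow> G i x j = G i y j"
  by (simp add: G_def)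

lemma G_add: "G i (\<lambda>k. x k + y k) j = G i x j + G i y j"
  by (simp add: G_def sum.distrib distrib_left)

lemma G_diff: "G i (\<lambda>k. x k - y k) j = G i x j - G i y j"
  by (simp add: G_def sum_subtractf right_diff_distrib)

lemma G_scale: "G i (\<lambda>k. c * x k) j = c * G i x j"
  by (simp add: G_def sum_distrib_left algebra_simps)

lemma G_sum: "G i (\<lambda>k. \<Sum>a\<in>I. f a k) j = (\<Sum>a\<in>I. G i (f a) j)"
  unfolding G_def sum_distrib_left by (rule sum.swap)

lemma mix_diff: "mix w (\<lambda>k. x k - y k) j = mix w x j - mix w y j"
  by (simp add: mix_def G_diff right_diff_distrib sum_subtractf)

lemma mix_cong: "(\<And>k. k < n \<Longrightarrow> x k = y k) \<Longrightarrow> mix w x j = mix w y j"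
  unfolding mix_def by (intro sum.cong refl arg_cong2 [where f = "(*)"] G_cong)

lemma mixturesD:
  assumes "w \<in> mixtures"
  shows "\<And>i. i < M \<Longrightarrow> 0 \<le> w i" "\<And>i. i < M \<Longrightarrow> w i \<le> 1" "(\<Sum>i<M. w i) = 1"
proof -
  show nn: "\<And>i. i < M \<Longrightarrow> 0 \<le> w i" and one: "(\<Sum>i<M. w i) = 1"
    using assms by (auto simp: mixtures_def)
  show "w i \<le> 1" if "i < M" for i
    using member_le_sum [of i "{..<M}" w] nn that one by auto
qed

lemma vertex_in_mixtures: "i < M \<Longrightarrow> (\<lambda>l. if l = i then 1 else 0) \<in> mixtures"
  by (simp add: mixtures_def)

lemma mix_vertex: "i < M \<Longrightarrow> mix (\<lambda>l. if l = i then 1 else 0) x j = G i x j"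
  by (simp add: mix_def if_distrib [where f = "\<lambda>c. c * _"] cong: if_cong)

lemma norm1_mix_le_defect:
  assumes "w \<in> mixtures" shows "norm1 n (mix w x) \<le> defect x"
proof -
  have "norm1 n (mix w x) \<le> (\<Sum>i<M. norm1 n (\<lambda>j. w i * G i x j))"
    unfolding mix_def by (rule norm1_sum_le)
  also have "\<dots> \<le> (\<Sum>i<M. 1 * norm1 n (G i x))"
    using mixturesD [OF assms] by (intro sum_mono) (auto simp: norm1_scale intro!: mult_left_le_one_le)
  finally show ?thesis by (simp add: defect_def)
qed

lemma defect_nonneg [simp]: "0 \<le> defect x"
  by (simp add: defect_def sum_nonneg)

lemma defect_le_norm1: "defect x \<le> Lip * norm1 n x"
proof -
  have "defect x \<le> (\<Sum>i<M. \<Sum>j<n. \<Sum>k<n. \<bar>g i j k\<bar> * norm1 n x)"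
    unfolding defect_def norm1_def [of n "G _ x"] G_def
    by (intro sum_mono order.trans [OF sum_abs]) (auto simp: abs_mult intro!: mult_left_mono abs_le_norm1)
  then show ?thesis by (simp add: Lip_def sum_distrib_right)
qed

lemma norm1_mix_le: "w \<in> mixtures \<Longrightarrow> norm1 n (mix w x) \<le> Lip * norm1 n x"
  using norm1_mix_le_defect defect_le_norm1 order.trans by blast

lemma defect_cong: "(\<And>k. k < n \<Longrightarrow> x k = y k) \<Longrightarrow> defect x = defect y"
  unfolding defect_def by (intro sum.cong norm1_cong G_cong refl)

lemma defect_add_le: "defect (\<lambda>k. x k + y k) \<le> defect x + defect y"
  unfolding defect_def sum.distrib [symmetric] G_add [abs_def] by (intro sum_mono norm1_add_le)

lemma defect_scale: "defect (\<lambda>k. c * x k) = \<bar>c\<bar> * defect x"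
  by (simp add: defect_def G_scale [abs_def] norm1_scale sum_distrib_left)

lemma defect_diff_ker: "v \<in> ker \<Longrightarrow> defect (\<lambda>k. x k - v k) = defect x"
  unfolding defect_def by (intro sum.cong refl norm1_cong) (auto simp: G_diff ker_def)

lemma defect_eq_0_iff: "defect x = 0 \<longleftrightarrow> x \<in> ker"
  by (auto simp: defect_def ker_def sum_nonneg_eq_0_iff norm1_eq_0_iff)

lemma tendsto_G:
  assumes "\<And>k. k < n \<Longrightarrow> ((\<lambda>t. x t k) \<longlongrightarrow> y k) F"
  shows "((\<lambda>t. G i (x t) j) \<longlongrightarrow> G i y j) F"
  unfolding G_def using assms by (intro tendsto_intros) auto

lemma tendsto_mix:
  assumes "\<And>k. k < n \<Longrightarrow> ((\<lambda>t. x t k) \<longlongrightarrow> y k) F"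
    and "\<And>i. i < M \<Longrightarrow> ((\<lambda>t. w t i) \<longlongrightarrow> v i) F"
  shows "((\<lambda>t. mix (w t) (x t) j) \<longlongrightarrow> mix v y j) F"
  unfolding mix_def using assms by (intro tendsto_intros tendsto_G) auto

lemma tendsto_defect:
  assumes "\<And>k. k < n \<Longrightarrow> ((\<lambda>t. x t k) \<longlongrightarrow> y k) F"
  shows "((\<lambda>t. defect (x t)) \<longlongrightarrow> defect y) F"
  unfolding defect_def using assms by (intro tendsto_sum tendsto_norm1 tendsto_G) auto

end

section \<open>The distance to the common kernel\<close>

text \<open>
  Elimination, one functional at a time. If the new functional vanishes on the common kernel of
  the previous ones, the point found for them still works; otherwise that point is corrected along a
  direction of this kernel on which the new functional equals one.
\<close>

lemma distance_to_common_kernel: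
  fixes a :: "'p \<Rightarrow> nat \<Rightarrow> real"
  assumes "finite P"
  shows "\<exists>K\<ge>0. \<forall>x. \<exists>v. (\<forall>p\<in>P. (\<Sum>k<n. a p k * v k) = 0) \<and>
           norm1 n (\<lambda>k. x k - v k) \<le> K * (\<Sum>p\<in>P. \<bar>\<Sum>k<n. a p k * x k\<bar>)"
  using assms
proof (induction P)
  case empty
  show ?case
  proof (intro exI [of _ 0] conjI allI)
    show "\<exists>v. (\<forall>p\<in>{}. (\<Sum>k<n. a p k * v k) = 0) \<and>
        norm1 n (\<lambda>k. x k - v k) \<le> 0 * (\<Sum>p\<in>{}. \<bar>\<Sum>k<n. a p k * x k\<bar>)" for x
      by (rule exI [of _ x]) (simp add: norm1_def)
  qed simp
next
  case (insert N P)
  define f where "f p x = (\<Sum>k<n. a p k * x k)" for p x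
  define s where "s x = (\<Sum>p\<in>P. \<bar>f p x\<bar>)" for x
  obtain K where K: "K \<ge> 0"
    and v: "\<And>x. \<exists>v. (\<forall>p\<in>P. f p v = 0) \<and> norm1 n (\<lambda>k. x k - v k) \<le> K * s x"
    using insert.IH unfolding f_def s_def by blast
  have f_diff: "f p (\<lambda>k. x k - y k) = f p x - f p y"
    and f_scale: "f p (\<lambda>k. c * x k) = c * f p x" for p x y c
    by (simp_all add: f_def right_diff_distrib sum_subtractf sum_distrib_left mult.left_commute)
  have s_nonneg: "0 \<le> s x" for x
    by (simp add: s_def sum_nonneg)
  have goal: "\<exists>K\<ge>0. \<forall>x. \<exists>v. (\<forall>p\<in>insert N P. f p v = 0) \<and>
           norm1 n (\<lambda>k. x k - v k) \<le> K * (s x + \<bar>f N x\<bar>)"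
  proof (cases "\<forall>v. (\<forall>p\<in>P. f p v = 0) \<longrightarrow> f N v = 0")
    case True
    have "\<exists>v. (\<forall>p\<in>insert N P. f p v = 0) \<and> norm1 n (\<lambda>k. x k - v k) \<le> K * (s x + \<bar>f N x\<bar>)" for x
    proof -
      obtain v where v: "\<forall>p\<in>P. f p v = 0" "norm1 n (\<lambda>k. x k - v k) \<le> K * s x" using v by blast
      have "K * s x \<le> K * (s x + \<bar>f N x\<bar>)" using K by (intro mult_left_mono) auto
      then show ?thesis using v True by (intro exI [of _ v]) auto
    qed
    then show ?thesis using K by blast
  next
    case False
    then obtain u0 where u0: "\<forall>p\<in>P. f p u0 = 0" "f N u0 \<noteq> 0" by blast
    \<comment> \<open>a direction invisible to the earlier functionals on which the new one is 1\<close>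
    define u where "u = (\<lambda>k. inverse (f N u0) * u0 k)"
    have u: "\<forall>p\<in>P. f p u = 0" "f N u = 1" using u0 by (auto simp: u_def f_scale)
    define B where "B = (\<Sum>k<n. \<bar>a N k\<bar>)"
    have B: "\<bar>f N y\<bar> \<le> B * norm1 n y" for y
      unfolding f_def B_def sum_distrib_right
      by (intro order.trans [OF sum_abs] sum_mono) (auto simp: abs_mult intro!: mult_left_mono abs_le_norm1)
    have "0 \<le> B" by (simp add: B_def sum_nonneg)
    define K' where "K' = K + (1 + B * K) * norm1 n u"
    have "\<exists>v. (\<forall>p\<in>insert N P. f p v = 0) \<and> norm1 n (\<lambda>k. x k - v k) \<le> K' * (s x + \<bar>f N x\<bar>)" for x
    proof -
      obtain v where v: "\<forall>p\<in>P. f p v = 0" "norm1 n (\<lambda>k. x k - v k) \<le> K * s x" using v by blast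
      define v' where "v' = (\<lambda>k. v k - f N v * u k)"
      have "f p v' = 0" if "p \<in> insert N P" for p
        using that u v by (auto simp: v'_def f_diff f_scale)
      moreover have "norm1 n (\<lambda>k. x k - v' k) \<le> K' * (s x + \<bar>f N x\<bar>)"
      proof -
        have "norm1 n (\<lambda>k. x k - v' k) = norm1 n (\<lambda>k. (x k - v k) + f N v * u k)"
          by (intro norm1_cong) (simp add: v'_def)
        also have "\<dots> \<le> norm1 n (\<lambda>k. x k - v k) + \<bar>f N v\<bar> * norm1 n u"
          using norm1_add_le norm1_scale by metis
        also have "\<bar>f N v\<bar> \<le> \<bar>f N x\<bar> + B * (K * s x)"
        proof -
          have "f N v = f N x - f N (\<lambda>k. x k - v k)" by (simp add: f_diff)
          moreover have "B * norm1 n (\<lambda>k. x k - v k) \<le> B * (K * s x)"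
            using v \<open>0 \<le> B\<close> by (intro mult_left_mono) auto
          ultimately show ?thesis using B [of "\<lambda>k. x k - v k"] by linarith
        qed
        also have "\<dots> \<le> (1 + B * K) * (s x + \<bar>f N x\<bar>)"
        proof -
          have "0 \<le> s x" "0 \<le> B * K * \<bar>f N x\<bar>" using s_nonneg K \<open>0 \<le> B\<close> by auto
          then show ?thesis by (simp add: algebra_simps)
        qed
        also have "norm1 n (\<lambda>k. x k - v k) \<le> K * (s x + \<bar>f N x\<bar>)"
          using v K by (smt (verit) mult_left_mono)
        finally show ?thesis by (simp add: K'_def algebra_simps mult_right_mono)
      qed
      ultimately show ?thesis by blast
    qed
    moreover have "0 \<le> K'" using K \<open>0 \<le> B\<close> by (simp add: K'_def)
    ultimately show ?thesis by blast
  qed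
  then show ?case using insert.hyps by (simp add: f_def s_def add.commute)
qed

context generators begin

lemma distance_to_ker:
  obtains K where "0 \<le> K" "\<And>x. \<exists>v\<in>ker. norm1 n (\<lambda>k. x k - v k) \<le> K * defect x"
proof -
  define f where "f p x = (\<Sum>k<n. g (fst p) (snd p) k * x k)" for p x
  let ?P = "{..<M} \<times> {..<n}"
  obtain K where K: "0 \<le> K" and v: "\<And>x. \<exists>v. (\<forall>p\<in>?P. f p v = 0) \<and>
      norm1 n (\<lambda>k. x k - v k) \<le> K * (\<Sum>p\<in>?P. \<bar>f p x\<bar>)"
    unfolding f_def using distance_to_common_kernel [of ?P "\<lambda>p. g (fst p) (snd p)" n] by blast
  have f_eq: "(\<Sum>p\<in>?P. \<bar>f p x\<bar>) = defect x" for x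
    unfolding f_def defect_def norm1_def G_def sum.cartesian_product by (simp add: case_prod_unfold)
  have f_ker: "v \<in> ker" if "\<forall>p\<in>?P. f p v = 0" for v
    using that by (auto simp: ker_def G_def f_def)
  show thesis
    by (rule that [OF K]) (use v [unfolded f_eq] f_ker in blast)
qed

section \<open>Euler trajectories: contraction or persistence\<close>

text \<open>
  The weights range over all mixtures, a compact set, so that limits of weight sequences are admissible.
\<close>

primrec euler :: "real \<Rightarrow> (nat \<Rightarrow> nat \<Rightarrow> real) \<Rightarrow> (nat \<Rightarrow> real) \<Rightarrow> nat \<Rightarrow> nat \<Rightarrow> real" where
  "euler h w x 0 = x"
| "euler h w x (Suc l) = (\<lambda>j. euler h w x l j + h * mix (w l) (euler h w x l) j)"

lemma euler_shift: "euler h w x (l + p) = euler h (\<lambda>i. w (l + i)) (euler h w x l) p"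
  by (induction p) auto

lemma euler_cong: "(\<And>p. p < l \<Longrightarrow> w p = w' p) \<Longrightarrow> euler h w x l = euler h w' x l"
  by (induction l) auto

text \<open>
  Removing an equilibrium and rescaling commute with the dynamics. This is what allows persistent
  trajectories to be normalized.
\<close>

lemma euler_affine:
  assumes v: "v \<in> ker" and w: "\<And>l. w l \<in> mixtures" and "j < n"
  shows "euler h w (\<lambda>j. c * (x j - v j)) l j = c * (euler h w x l j - v j)"
  using \<open>j < n\<close>
proof (induction l arbitrary: j)
  case (Suc l)
  have "mix (w l) (euler h w (\<lambda>j. c * (x j - v j)) l) j = mix (w l) (\<lambda>j. c * (euler h w x l j - v j)) j"
    using Suc.IH by (intro mix_cong)
  also have "\<dots> = c * mix (w l) (euler h w x l) j"
    using v Suc.prems by (simp add: mix_def G_scale G_diff ker_def sum_distrib_left algebra_simps)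
  finally show ?case using Suc by (simp add: algebra_simps)
qed simp

lemma defect_step_le:
  assumes "w \<in> mixtures" "0 \<le> h"
  shows "defect (\<lambda>j. x j + h * mix w x j) \<le> (1 + h * Lip) * defect x"
proof -
  have "defect (\<lambda>j. x j + h * mix w x j) \<le> defect x + h * defect (mix w x)"
    using defect_add_le [of x "\<lambda>j. h * mix w x j"] defect_scale [of h "mix w x"] assms by auto
  also have "defect (mix w x) \<le> Lip * defect x"
    by (rule order.trans [OF defect_le_norm1]) (intro mult_left_mono norm1_mix_le_defect assms Lip_nonneg)
  finally show ?thesis using assms(2) by (simp add: distrib_right mult.assoc mult_left_mono)
qed

lemma norm1_step_le:
  assumes "w \<in> mixtures" "0 \<le> h"
  shows "norm1 n (\<lambda>j. x j + h * mix w x j) \<le> (1 + h * Lip) * norm1 n x"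
proof -
  have "norm1 n (\<lambda>j. x j + h * mix w x j) \<le> norm1 n x + h * norm1 n (mix w x)"
    using norm1_add_le [of n x "\<lambda>j. h * mix w x j"] norm1_scale [of n h "mix w x"] assms by auto
  also have "norm1 n (mix w x) \<le> Lip * norm1 n x"
    by (rule norm1_mix_le [OF assms(1)])
  finally show ?thesis using assms(2) by (simp add: distrib_right mult.assoc mult_left_mono)
qed

lemma geometric_growth:
  fixes f :: "nat \<Rightarrow> real"
  assumes "\<And>l. f (Suc l) \<le> c * f l" "0 \<le> c"
  shows "f l \<le> c ^ l * f 0"
proof (induction l)
  case (Suc l)
  show ?case using assms(1) [of l] mult_left_mono [OF Suc assms(2)] by simp
qed simp

lemma euler_growth:
  assumes w: "\<And>l. w l \<in> mixtures" and h: "0 \<le> h"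
  shows "defect (euler h w x l) \<le> (1 + h * Lip) ^ l * defect x"
    and "norm1 n (euler h w x l) \<le> (1 + h * Lip) ^ l * norm1 n x"
proof -
  have p: "0 \<le> 1 + h * Lip" using h by simp
  show "defect (euler h w x l) \<le> (1 + h * Lip) ^ l * defect x"
    using geometric_growth [of "\<lambda>l. defect (euler h w x l)", OF _ p] defect_step_le [OF w h] by simp
  show "norm1 n (euler h w x l) \<le> (1 + h * Lip) ^ l * norm1 n x"
    using geometric_growth [of "\<lambda>l. norm1 n (euler h w x l)", OF _ p] norm1_step_le [OF w h] by simp
qed

text \<open>
  Restart the trajectory whenever the defect has been halved. Each restart costs at most \<open>L\<close>
  steps, so at least \<open>N div L\<close> halvings occur before fewer than \<open>L\<close> steps
  remain, and these enlarge the defect at most by the growth factor of \<open>L\<close> steps.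
\<close>

lemma geometric_decay_if_halving:
  assumes h: "0 \<le> h" and L: "0 < L"
    and halving: "\<And>w x. (\<And>l. w l \<in> mixtures) \<Longrightarrow> 0 < defect x \<Longrightarrow> \<exists>l\<le>L. defect (euler h w x l) \<le> defect x / 2"
    and w: "\<And>l. w l \<in> mixtures"
  shows "defect (euler h w x N) \<le> (1 + h * Lip) ^ L * (1/2) ^ (N div L) * defect x"
  using w
proof (induction N arbitrary: w x rule: less_induct)
  case (less N)
  have p: "1 \<le> 1 + h * Lip" using h by simp
  have gr: "defect (euler h w x N) \<le> (1 + h * Lip) ^ N * defect x"
    using euler_growth(1) [OF less.prems h] .
  consider "defect x = 0" | "N < L" | "0 < defect x" "L \<le> N"
    using defect_nonneg [of x] by linarith
  then show ?case
  proof cases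
    case 1
    then show ?thesis using gr by simp
  next
    case 2
    have "(1 + h * Lip) ^ N * defect x \<le> (1 + h * Lip) ^ L * defect x"
      using 2 p by (intro mult_right_mono power_increasing) auto
    then show ?thesis using gr 2 by simp
  next
    case 3
    obtain l where l: "l \<le> L" "defect (euler h w x l) \<le> defect x / 2"
      using halving [of w x] less.prems 3(1) by blast
    have "l \<noteq> 0"
    proof
      assume "l = 0"
      then show False using l(2) 3(1) by simp
    qed
    have "defect (euler h w x N) = defect (euler h (\<lambda>i. w (l + i)) (euler h w x l) (N - l))"
    proof -
      have "l + (N - l) = N" using l(1) 3(2) by linarith
      then show ?thesis using euler_shift [of h w x l "N - l"] by (simp only:)
    qed
    also have "\<dots> \<le> (1 + h * Lip) ^ L * (1/2) ^ ((N - l) div L) * defect (euler h w x l)"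
    proof (rule less.IH)
      show "N - l < N" using \<open>l \<noteq> 0\<close> 3(2) L by linarith
      show "w (l + i) \<in> mixtures" for i by (rule less.prems)
    qed
    also have "\<dots> \<le> (1 + h * Lip) ^ L * (1/2) ^ ((N - l) div L) * (defect x / 2)"
      using p by (intro mult_left_mono l) auto
    also have "\<dots> = (1 + h * Lip) ^ L * defect x * (1/2) ^ (Suc ((N - l) div L))"
      by simp
    also have "\<dots> \<le> (1 + h * Lip) ^ L * defect x * (1/2) ^ (N div L)"
    proof (intro mult_left_mono power_decreasing)
      have "N div L = Suc ((N - L) div L)" using L 3(2) by (rule le_div_geq)
      then show "N div L \<le> Suc ((N - l) div L)" using l by (simp add: div_le_mono)
    qed (use p in auto)
    finally show ?thesis by (simp add: mult_ac)
  qed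
qed

text \<open>
  All \<open>\<epsilon>\<close> are required, so that later the constant that compares the defect with the
  distance to the kernel can be absorbed.
\<close>

definition contracting :: "real \<Rightarrow> bool" where
  "contracting h \<longleftrightarrow> (\<forall>\<epsilon>>0. \<exists>N>0. \<forall>w x. (\<forall>l. w l \<in> mixtures) \<longrightarrow> defect (euler h w x N) \<le> \<epsilon> * defect x)"

text \<open>
  If every trajectory halved its defect within \<open>Suc L\<close> steps, the defect would decay
  geometrically. A trajectory that does not, scaled to initial defect one and shifted by an
  equilibrium, starts in a bounded set and keeps a defect of at least one half for \<open>L\<close> steps.
\<close>

lemma persistent_trajectories_if_not_contracting:
  assumes h: "0 \<le> h" and nc: "\<not> contracting h"
    and K: "\<And>x. \<exists>v\<in>ker. norm1 n (\<lambda>k. x k - v k) \<le> K * defect x"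
  shows "\<exists>w x. (\<forall>l. w l \<in> mixtures) \<and> norm1 n x \<le> K \<and> (\<forall>l\<le>L. 1/2 \<le> defect (euler h w x l))"
proof -
  have "\<exists>w x. (\<forall>l. w l \<in> mixtures) \<and> 0 < defect x \<and> (\<forall>l\<le>Suc L. defect x / 2 < defect (euler h w x l))"
  proof (rule ccontr)
    assume neg: "\<not> ?thesis"
    have halv: "\<exists>l\<le>Suc L. defect (euler h w x l) \<le> defect x / 2" if "\<And>l. w l \<in> mixtures" "0 < defect x" for w x
      using neg that by (force simp: not_less)
    have "contracting h"
      unfolding contracting_def
    proof (intro allI impI)
      fix \<epsilon> :: real assume "0 < \<epsilon>"
      define C where "C = (1 + h * Lip) ^ Suc L"
      have "0 < C" using h unfolding C_def by (intro zero_less_power add_pos_nonneg) auto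
      then obtain m where m: "(1/2::real) ^ m < \<epsilon> / C"
        using real_arch_pow_inv [of "\<epsilon> / C" "1/2"] \<open>0 < \<epsilon>\<close> by auto
      have "defect (euler h w x (Suc m * Suc L)) \<le> \<epsilon> * defect x" if "\<forall>l. w l \<in> mixtures" for w x
      proof -
        have "defect (euler h w x (Suc m * Suc L)) \<le> C * (1/2) ^ (Suc m * Suc L div Suc L) * defect x"
          unfolding C_def by (rule geometric_decay_if_halving [OF h]) (use halv that in auto)
        also have "Suc m * Suc L div Suc L = Suc m"
          by (rule nonzero_mult_div_cancel_right) simp
        also have "C * (1/2) ^ (Suc m) \<le> C * (1/2) ^ m"
          using \<open>0 < C\<close> by (intro mult_left_mono power_decreasing) auto
        also have "C * (1/2) ^ m \<le> \<epsilon>"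
          using m \<open>0 < C\<close> by (simp add: field_simps)
        finally show ?thesis by (simp add: mult_right_mono)
      qed
      then show "\<exists>N>0. \<forall>w x. (\<forall>l. w l \<in> mixtures) \<longrightarrow> defect (euler h w x N) \<le> \<epsilon> * defect x"
        by (intro exI [of _ "Suc m * Suc L"]) auto
    qed
    then show False using nc by simp
  qed
  then obtain w x where "\<forall>l. w l \<in> mixtures" and x: "0 < defect x"
    and "\<forall>l\<le>Suc L. defect x / 2 < defect (euler h w x l)"
    by blast
  then have w: "\<And>l. w l \<in> mixtures" and pers: "\<And>l. l \<le> L \<Longrightarrow> defect x / 2 < defect (euler h w x l)"
    by auto
  obtain v where v: "v \<in> ker" "norm1 n (\<lambda>k. x k - v k) \<le> K * defect x" using K by blast
  define y where "y = (\<lambda>j. inverse (defect x) * (x j - v j))"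
  have "norm1 n y \<le> K"
  proof -
    have "norm1 n y = inverse (defect x) * norm1 n (\<lambda>k. x k - v k)"
      unfolding y_def norm1_scale using x by simp
    also have "\<dots> \<le> inverse (defect x) * (K * defect x)"
      using v x by (intro mult_left_mono) auto
    also have "\<dots> = K" using x by simp
    finally show ?thesis .
  qed
  moreover have "1/2 \<le> defect (euler h w y l)" if "l \<le> L" for l
  proof -
    have "defect (euler h w y l) = defect (\<lambda>j. inverse (defect x) * (euler h w x l j - v j))"
      unfolding y_def by (intro defect_cong euler_affine v w)
    also have "\<dots> = defect (euler h w x l) / defect x"
      using x by (simp add: defect_scale defect_diff_ker v divide_inverse)
    finally have "defect (euler h w y l) = defect (euler h w x l) / defect x" .
    moreover have "1/2 \<le> defect (euler h w x l) / defect x"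
      using pers [OF that] x by (simp add: field_simps)
    ultimately show ?thesis by simp
  qed
  ultimately show ?thesis using w by blast
qed

text \<open>
  Persistent trajectories of growing length have bounded initial states, and their weights lie in a
  compact set. A diagonal subsequence converges to an infinite trajectory whose defect stays above
  one half.
\<close>

theorem contracting_if_all_trajectories_converge:
  assumes conv: "\<And>w x. (\<And>l. w l \<in> mixtures) \<Longrightarrow> (\<lambda>l. defect (euler h w x l)) \<longlonglongrightarrow> 0"
    and h: "0 \<le> h"
  shows "contracting h"
proof (rule ccontr)
  assume nc: "\<not> contracting h"
  obtain K where K: "0 \<le> K" "\<And>x. \<exists>v\<in>ker. norm1 n (\<lambda>k. x k - v k) \<le> K * defect x"
    using distance_to_ker by blast
  have "\<forall>L. \<exists>w x. (\<forall>l. w l \<in> mixtures) \<and> norm1 n x \<le> K \<and> (\<forall>l\<le>L. 1/2 \<le> defect (euler h w x l))"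
    by (intro allI persistent_trajectories_if_not_contracting h nc K)
  then obtain w x where "\<forall>L. (\<forall>l. w L l \<in> mixtures) \<and> norm1 n (x L) \<le> K \<and>
      (\<forall>l\<le>L. 1/2 \<le> defect (euler h (w L) (x L) l))"
    unfolding choice_iff by (elim exE)
  then have w: "\<And>L l. w L l \<in> mixtures" and x: "\<And>L. norm1 n (x L) \<le> K"
    and pers: "\<And>L l. l \<le> L \<Longrightarrow> 1/2 \<le> defect (euler h (w L) (x L) l)"
    by auto
  define f :: "nat \<Rightarrow> nat + nat \<times> nat \<Rightarrow> real" where
    "f L a = (case a of Inl j \<Rightarrow> x L j | Inr (l, i) \<Rightarrow> w L l i)" for L a
  define S where "S = Inl ` {..<n} \<union> Inr ` ((UNIV :: nat set) \<times> {..<M})"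
  have "norm (f L a) \<le> max K 1" if "a \<in> S" for L a
  proof -
    have "\<bar>x L j\<bar> \<le> K" if "j < n" for j
      using abs_le_norm1 [OF that] x order.trans by blast
    then show ?thesis
      using that mixturesD [OF w] by (auto simp: S_def f_def le_max_iff_disj)
  qed
  then obtain r where r: "strict_mono (r :: nat \<Rightarrow> nat)" and "\<And>a. a \<in> S \<Longrightarrow> \<exists>l. (\<lambda>L. f (r L) a) \<longlonglongrightarrow> l"
    using function_convergent_subsequence [of S f "max K 1"] by blast
  then obtain F where F: "\<And>a. a \<in> S \<Longrightarrow> (\<lambda>L. f (r L) a) \<longlonglongrightarrow> F a" by metis
  define x0 where "x0 j = F (Inl j)" for j
  define v where "v l i = F (Inr (l, i))" for l i
  have x0: "(\<lambda>L. x (r L) j) \<longlonglongrightarrow> x0 j" if "j < n" for j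
    using F [of "Inl j"] that by (simp add: S_def f_def x0_def)
  have v: "(\<lambda>L. w (r L) l i) \<longlonglongrightarrow> v l i" if "i < M" for l i
    using F [of "Inr (l, i)"] that by (simp add: S_def f_def v_def)
  have vw: "v l \<in> mixtures" for l
  proof -
    have "0 \<le> v l i" if "i < M" for i
      by (rule LIMSEQ_le_const [OF v [OF that]]) (simp add: mixturesD(1) [OF w that])
    moreover have "(\<lambda>L. \<Sum>i<M. w (r L) l i) \<longlonglongrightarrow> (\<Sum>i<M. v l i)"
      by (rule tendsto_sum) (simp add: v)
    then have "(\<Sum>i<M. v l i) = 1"
      unfolding mixturesD(3) [OF w] by (simp add: LIMSEQ_const_iff)
    ultimately show ?thesis by (simp add: mixtures_def)
  qed
  have lim: "(\<lambda>L. euler h (w (r L)) (x (r L)) l j) \<longlonglongrightarrow> euler h v x0 l j" if "j < n" for l j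
    using that
  proof (induction l arbitrary: j)
    case (Suc l)
    have "(\<lambda>L. mix (w (r L) l) (euler h (w (r L)) (x (r L)) l) j) \<longlonglongrightarrow> mix (v l) (euler h v x0 l) j"
      by (rule tendsto_mix) (fact Suc.IH, rule v)
    then show ?case
      using Suc.IH [OF Suc.prems] by (auto intro!: tendsto_add tendsto_mult_left)
  qed (simp add: x0)
  have "1/2 \<le> defect (euler h v x0 l)" for l
  proof (rule LIMSEQ_le_const)
    show "(\<lambda>L. defect (euler h (w (r L)) (x (r L)) l)) \<longlonglongrightarrow> defect (euler h v x0 l)"
      by (rule tendsto_defect) (rule lim)
    show "\<exists>N. \<forall>L\<ge>N. 1/2 \<le> defect (euler h (w (r L)) (x (r L)) l)"
      by (rule exI [of _ l]) (meson pers seq_suble [OF r] order.trans)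
  qed
  moreover have "(\<lambda>l. defect (euler h v x0 l)) \<longlonglongrightarrow> 0"
    by (rule conv) (rule vw)
  ultimately have "1/2 \<le> (0::real)"
    by (intro LIMSEQ_le_const [where X = "\<lambda>l. defect (euler h v x0 l)"]) auto
  then show False by simp
qed

end

section \<open>Compactness tools for weights and trajectories in continuous time\<close>

text \<open>
  The increments of the \<open>W i\<close> are nonnegative and add up to the elapsed time, so each
  \<open>W i\<close> is Lipschitz and defines a Stieltjes measure. These measures add up to Lebesgue
  measure, hence have densities by the theorem of Radon and Nikodym, and the densities add up to one
  almost everywhere.
\<close>

lemma densities_of_time_partition:
  fixes W :: "nat \<Rightarrow> real \<Rightarrow> real"
  assumes M: "0 < M"
    and mono: "\<And>i s t. i < M \<Longrightarrow> 0 \<le> s \<Longrightarrow> s \<le> t \<Longrightarrow> W i s \<le> W i t"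
    and sum: "\<And>t. 0 \<le> t \<Longrightarrow> (\<Sum>i<M. W i t) = t"
    and zero: "\<And>i. i < M \<Longrightarrow> W i 0 = 0"
  obtains \<omega> :: "real \<Rightarrow> nat \<Rightarrow> real"
  where "\<And>i. i < M \<Longrightarrow> (\<lambda>t. \<omega> t i) \<in> borel_measurable borel"
    and "\<And>t i. i < M \<Longrightarrow> 0 \<le> \<omega> t i" and "\<And>t. (\<Sum>i<M. \<omega> t i) = 1"
    and "\<And>i s t. i < M \<Longrightarrow> 0 \<le> s \<Longrightarrow> s \<le> t \<Longrightarrow>
           ((\<lambda>\<tau>. \<omega> \<tau> i) has_integral (W i t - W i s)) {s..t}"
proof -
  \<comment> \<open>negative times are split equally, so that the identity F_sum holds on the whole line\<close>
  define F where "F i t = (if 0 \<le> t then W i t else t / real M)" for i t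
  have F_sum: "(\<Sum>i<M. F i t) = t" for t
    using M sum by (cases "0 \<le> t") (simp_all add: F_def)
  have F_mono: "F i s \<le> F i t" if "i < M" "s \<le> t" for i s t
  proof -
    have "0 \<le> W i t" if "0 \<le> t" using mono [of i 0 t] zero that \<open>i < M\<close> by simp
    moreover have "s / real M \<le> 0" if "s < 0" using that M by (simp add: field_simps)
    ultimately show ?thesis
      using mono [OF that(1) _ that(2)] that M by (auto simp: F_def divide_right_mono)
  qed
  have F_lip: "F i t - F i s \<le> t - s" if "i < M" "s \<le> t" for i s t
  proof -
    have "F i t - F i s \<le> (\<Sum>l<M. F l t - F l s)"
      using that F_mono by (intro member_le_sum) auto
    then show ?thesis by (simp add: sum_subtractf F_sum)
  qed
  have F_cont: "continuous_on UNIV (F i)" if "i < M" for i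
  proof (rule lipschitz_on_continuous_on [of 1], rule lipschitz_onI)
    show "dist (F i s) (F i t) \<le> 1 * dist s t" for s t
      using F_lip [OF that, of s t] F_lip [OF that, of t s] F_mono [OF that, of s t] F_mono [OF that, of t s]
      by (cases "s \<le> t") (auto simp: dist_real_def)
  qed auto
  define \<mu> where "\<mu> i = interval_measure (F i)" for i
  have \<mu>_sets [simp]: "sets (\<mu> i) = sets borel" "space (\<mu> i) = UNIV" for i by (simp_all add: \<mu>_def)
  have \<mu>_Icc: "emeasure (\<mu> i) {a..b} = ennreal (F i b - F i a)" if "i < M" "a \<le> b" for i a b
    unfolding \<mu>_def using that F_mono F_cont
    by (intro emeasure_interval_measure_Icc) auto
  have \<mu>_Ioo: "emeasure (\<mu> i) {a<..<b} = ennreal (F i b - F i a)" if "i < M" "a \<le> b" for i a b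
  proof (cases "a = b")
    case False
    have "{a<..<b} = {a..b} - ({a..a} \<union> {b..b})" using \<open>a \<le> b\<close> by auto
    moreover have "emeasure (\<mu> i) ({a..a} \<union> {b..b}) = 0"
      using \<mu>_Icc [of i a a] \<mu>_Icc [of i b b] that
      by (intro emeasure_Un_null_set [THEN trans]) (auto simp: null_sets_def)
    ultimately show ?thesis
      using \<mu>_Icc [OF that] by (simp add: emeasure_Diff_null_set null_sets_def)
  qed simp
  define N where "N = measure_of UNIV (sets borel) (\<lambda>B. \<Sum>i<M. emeasure (\<mu> i) B)"
  have N_sets: "sets N = sets borel"
    using sets.sigma_sets_eq [of borel] by (simp add: N_def)
  have N: "emeasure N B = (\<Sum>i<M. emeasure (\<mu> i) B)" if "B \<in> sets borel" for B
    using that unfolding N_def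
  proof (intro emeasure_measure_of_sigma)
    show "countably_additive (sets borel) (\<lambda>B. \<Sum>i<M. emeasure (\<mu> i) B)"
      unfolding countably_additive_def
      by (auto simp: suminf_sum suminf_emeasure)
  qed (auto simp: positive_def sets.sigma_algebra_axioms [of borel, simplified])
  have "lborel = N"
  proof (rule lborel_eqI)
    show "emeasure N (box l u) = (\<Prod>b\<in>Basis. (u - l) \<bullet> b)" if "\<And>b. b \<in> Basis \<Longrightarrow> l \<bullet> b \<le> u \<bullet> b" for l u :: real
    proof -
      have "l \<le> u" using that by simp
      have "emeasure N (box l u) = (\<Sum>i<M. ennreal (F i u - F i l))"
        using \<open>l \<le> u\<close> by (simp add: N box_real \<mu>_Ioo)
      also have "\<dots> = ennreal (\<Sum>i<M. F i u - F i l)"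
        using F_mono \<open>l \<le> u\<close> by (intro sum_ennreal) auto
      finally show ?thesis by (simp add: sum_subtractf F_sum)
    qed
  qed (fact N_sets)
  then have le: "emeasure (\<mu> i) B \<le> emeasure lborel B" if "i < M" "B \<in> sets borel" for i B
    unfolding \<open>lborel = N\<close> N [OF that(2)]
    using that by (intro member_le_sum) auto
  have "\<exists>f\<in>borel_measurable lborel. density lborel f = \<mu> i" if "i < M" for i
  proof (rule sigma_finite_measure.Radon_Nikodym [OF sigma_finite_lborel])
    show "absolutely_continuous lborel (\<mu> i)"
      using le [OF that] by (auto simp: absolutely_continuous_def null_sets_def) (metis le_zero_eq)
  qed simp
  then have "\<forall>i. \<exists>f. i < M \<longrightarrow> f \<in> borel_measurable borel \<and> density lborel f = \<mu> i"
    by auto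
  then obtain f where "\<forall>i. i < M \<longrightarrow> f i \<in> borel_measurable borel \<and> density lborel (f i) = \<mu> i"
    by (rule choice [THEN exE])
  then have f: "\<And>i. i < M \<Longrightarrow> f i \<in> borel_measurable borel"
    and f_dens: "\<And>i. i < M \<Longrightarrow> density lborel (f i) = \<mu> i"
    by auto
  have f_sum: "AE t in lborel. (\<Sum>i<M. f i t) = 1"
  proof (rule sigma_finite_measure.density_unique [OF sigma_finite_lborel])
    show "density lborel (\<lambda>t. \<Sum>i<M. f i t) = density lborel (\<lambda>t. 1)"
    proof (rule measure_eqI)
      fix B assume "B \<in> sets (density lborel (\<lambda>t. \<Sum>i<M. f i t))"
      then have B: "B \<in> sets borel" by simp
      have "emeasure (density lborel (\<lambda>t. \<Sum>i<M. f i t)) B = (\<Sum>i<M. emeasure (density lborel (f i)) B)"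
      proof -
        have "emeasure (density lborel (\<lambda>t. \<Sum>i<M. f i t)) B = (\<integral>\<^sup>+ t. (\<Sum>i<M. f i t * indicator B t) \<partial>lborel)"
          unfolding sum_distrib_right [symmetric] using B f by (intro emeasure_density) auto
        also have "\<dots> = (\<Sum>i<M. \<integral>\<^sup>+ t. f i t * indicator B t \<partial>lborel)"
          using B f by (intro nn_integral_sum) auto
        also have "\<dots> = (\<Sum>i<M. emeasure (density lborel (f i)) B)"
          using B f by (intro sum.cong refl emeasure_density [symmetric]) auto
        finally show ?thesis .
      qed
      also have "\<dots> = emeasure N B" using B by (simp add: N f_dens)
      also have "N = density lborel (\<lambda>t. 1)" using \<open>lborel = N\<close> by (simp add: density_1)
      finally show "emeasure (density lborel (\<lambda>t. \<Sum>i<M. f i t)) B = emeasure (density lborel (\<lambda>t. 1)) B" .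
    qed simp
  qed (use f in auto)
  \<comment> \<open>on the exceptional null set all the weight goes to generator 0\<close>
  define \<omega> where "\<omega> t i = (if (\<Sum>i<M. f i t) = 1 then enn2real (f i t) else if i = 0 then 1 else 0)" for t i
  have fin: "f i t \<noteq> \<infinity>" if "(\<Sum>i<M. f i t) = 1" "i < M" for i t
    using member_le_sum [of i "{..<M}" "\<lambda>i. f i t"] that by (auto simp: top_unique)
  show thesis
  proof
    show meas: "(\<lambda>t. \<omega> t i) \<in> borel_measurable borel" if "i < M" for i
      unfolding \<omega>_def using f that by measurable
    show nonneg: "0 \<le> \<omega> t i" if "i < M" for t i
      by (simp add: \<omega>_def)
    show "(\<Sum>i<M. \<omega> t i) = 1" for t
    proof (cases "(\<Sum>i<M. f i t) = 1")
      case True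
      have "(\<Sum>i<M. enn2real (f i t)) = enn2real (\<Sum>i<M. f i t)"
        using fin [OF True] by (subst enn2real_sum) (auto simp: less_top)
      then show ?thesis using True by (simp add: \<omega>_def)
    next
      case False
      then show ?thesis using M by (simp add: \<omega>_def)
    qed
    show "((\<lambda>\<tau>. \<omega> \<tau> i) has_integral (W i t - W i s)) {s..t}" if "i < M" "0 \<le> s" "s \<le> t" for i s t
    proof -
      have "(\<integral>\<^sup>+ \<tau>. ennreal (\<omega> \<tau> i * indicator {s..t} \<tau>) \<partial>lborel) = (\<integral>\<^sup>+ \<tau>. f i \<tau> * indicator {s..t} \<tau> \<partial>lborel)"
      proof (intro nn_integral_cong_AE)
        show "AE \<tau> in lborel. ennreal (\<omega> \<tau> i * indicator {s..t} \<tau>) = f i \<tau> * indicator {s..t} \<tau>"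
          using f_sum
        proof eventually_elim
          case (elim \<tau>)
          then show ?case using fin [OF elim \<open>i < M\<close>]
            by (simp add: \<omega>_def ennreal_mult' less_top indicator_def)
        qed
      qed
      also have "\<dots> = emeasure (\<mu> i) {s..t}"
        using f that by (simp add: emeasure_density f_dens [symmetric])
      also have "\<dots> = ennreal (W i t - W i s)"
        using that by (simp add: \<mu>_Icc F_def)
      finally have "((\<lambda>\<tau>. \<omega> \<tau> i * indicator {s..t} \<tau>) has_integral (W i t - W i s)) UNIV"
        using meas [OF that(1)] nonneg [OF that(1)] mono [OF that]
        by (intro nn_integral_has_integral) auto
      then have "((\<lambda>\<tau>. if \<tau> \<in> {s..t} then \<omega> \<tau> i else 0) has_integral (W i t - W i s)) UNIV"
        by (rule has_integral_eq [rotated]) (simp add: indicator_def)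
      then show ?thesis unfolding has_integral_restrict_UNIV .
    qed
  qed
qed

text \<open>
  In \<open>N\<close> steps of length \<open>T / N\<close> the function moves by at most
  \<open>N * C * (T / N)\<^sup>2\<close>, which tends to zero.
\<close>

lemma constant_if_quadratic_modulus:
  fixes z :: "real \<Rightarrow> real"
  assumes T: "0 \<le> T" and z: "\<And>s t. 0 \<le> s \<Longrightarrow> s \<le> t \<Longrightarrow> t \<le> T \<Longrightarrow> \<bar>z t - z s\<bar> \<le> C * (t - s)\<^sup>2"
  shows "z T = z 0"
proof -
  have "\<bar>z T - z 0\<bar> \<le> C * T\<^sup>2 * inverse (real (Suc N))" for N
  proof -
    define d where "d = T / real (Suc N)"
    have d: "0 \<le> d" "real (Suc N) * d = T" using T by (simp_all add: d_def)
    have "\<bar>z (real p * d) - z 0\<bar> \<le> real p * (C * d\<^sup>2)" if "p \<le> Suc N" for p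
      using that
    proof (induction p)
      case (Suc p)
      have "real (Suc p) * d \<le> real (Suc N) * d"
        using Suc.prems d by (intro mult_right_mono) auto
      then have "\<bar>z (real (Suc p) * d) - z (real p * d)\<bar> \<le> C * (real (Suc p) * d - real p * d)\<^sup>2"
        using d by (intro z) (auto intro!: mult_right_mono)
      also have "real (Suc p) * d - real p * d = d" by (simp add: algebra_simps)
      finally have "\<bar>z (real (Suc p) * d) - z 0\<bar> \<le> C * d\<^sup>2 + real p * (C * d\<^sup>2)"
        using Suc.IH Suc.prems by linarith
      then show ?case by (simp add: algebra_simps)
    qed simp
    from this [of "Suc N"] have "\<bar>z T - z 0\<bar> \<le> real (Suc N) * (C * d\<^sup>2)"
      using d by simp
    also have "\<dots> = C * T\<^sup>2 * inverse (real (Suc N))"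
    proof -
      have "m * (C * (T / m)\<^sup>2) = C * T\<^sup>2 * inverse m" if "m \<noteq> 0" for m :: real
        using that by (simp add: power2_eq_square field_simps)
      then show ?thesis unfolding d_def by simp
    qed
    finally show ?thesis .
  qed
  moreover have "(\<lambda>N. C * T\<^sup>2 * inverse (real (Suc N))) \<longlonglongrightarrow> C * T\<^sup>2 * 0"
    by (intro tendsto_intros LIMSEQ_inverse_real_of_nat)
  ultimately have "\<bar>z T - z 0\<bar> \<le> C * T\<^sup>2 * 0"
    by (intro LIMSEQ_le_const [where X = "\<lambda>N. C * T\<^sup>2 * inverse (real (Suc N))"]) auto
  then show ?thesis by simp
qed

text \<open>
  The argument of Arzela and Ascoli for functions with jumps of order \<open>1 / k\<close>: a diagonal
  subsequence converges at the nonnegative rational times, and the modulus carries the Cauchy property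
  over to all other times.
\<close>

lemma almost_equicontinuous_subsequence:
  fixes f :: "nat \<Rightarrow> real \<Rightarrow> 'i::countable \<Rightarrow> real"
  assumes modulus: "\<And>T k s t c. 0 \<le> s \<Longrightarrow> s \<le> t \<Longrightarrow> t \<le> T \<Longrightarrow> c \<in> I \<Longrightarrow>
      \<bar>f k t c - f k s c\<bar> \<le> C T * (t - s + 1 / real (Suc k))"
    and C: "\<And>T. 0 \<le> C T"
    and init: "\<And>k c. c \<in> I \<Longrightarrow> \<bar>f k 0 c\<bar> \<le> C0"
  obtains r F where "strict_mono (r :: nat \<Rightarrow> nat)"
    "\<And>t c. 0 \<le> t \<Longrightarrow> c \<in> I \<Longrightarrow> (\<lambda>k. f (r k) t c) \<longlonglongrightarrow> F t c"
proof -
  \<comment> \<open>dividing by b t makes the functions uniformly bounded, although their bound grows with time\<close>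
  define b where "b t = 1 + \<bar>C0\<bar> + C t * (t + 1)" for t
  have b: "0 < b t" if "0 \<le> t" for t
    using C [of t] that by (auto simp: b_def intro!: add_pos_nonneg mult_nonneg_nonneg)
  define g where "g k p = (case p of (t, c) \<Rightarrow> f k t c / b t)" for k p
  define S where "S = ({0..} \<inter> \<rat> :: real set) \<times> I"
  have "countable S" unfolding S_def by (intro countable_SIGMA countable_Int2 countable_rat) auto
  have "norm (g k p) \<le> 1" if pS: "p \<in> S" for k p
  proof -
    obtain t c where p: "p = (t, c)" and t: "0 \<le> t" "c \<in> I" using pS unfolding S_def by (cases p) auto
    have "\<bar>f k t c - f k 0 c\<bar> \<le> C t * (t - 0 + 1 / real (Suc k))"
      using t by (intro modulus) auto
    also have "\<dots> \<le> C t * (t + 1)"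
      using C by (intro mult_left_mono) auto
    finally have "\<bar>f k t c\<bar> \<le> b t"
      using init [OF t(2), of k] by (simp add: b_def)
    then show ?thesis using b [OF t(1)] by (simp add: p g_def abs_divide)
  qed
  then obtain r where r: "strict_mono (r :: nat \<Rightarrow> nat)"
    and conv: "\<And>p. p \<in> S \<Longrightarrow> \<exists>l. (\<lambda>k. g (r k) p) \<longlonglongrightarrow> l"
    using function_convergent_subsequence [OF \<open>countable S\<close>, of g 1] by blast
  have rat: "convergent (\<lambda>k. f (r k) s c)" if s: "s \<in> \<rat>" "0 \<le> s" "c \<in> I" for s c
  proof -
    obtain l where "(\<lambda>k. g (r k) (s, c)) \<longlonglongrightarrow> l" using conv [of "(s, c)"] s by (auto simp: S_def)
    then have "(\<lambda>k. b s * g (r k) (s, c)) \<longlonglongrightarrow> b s * l" by (rule tendsto_mult_left)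
    moreover have "(\<lambda>k. b s * g (r k) (s, c)) = (\<lambda>k. f (r k) s c)"
      using b [OF s(2)] by (simp add: g_def)
    ultimately show ?thesis by (auto simp: convergent_def)
  qed
  have all: "convergent (\<lambda>k. f (r k) t c)" if t: "0 \<le> t" "c \<in> I" for t c
  proof (cases "t = 0")
    case True
    then show ?thesis using rat [of 0 c] t by simp
  next
    case False
    have "Cauchy (\<lambda>k. f (r k) t c)"
    proof (rule metric_CauchyI)
      fix e :: real assume e: "0 < e"
      define d where "d = e / 3 / (C t + 1) / 2"
      have d: "0 < d" "C t * (d + d) \<le> e / 3"
      proof -
        show "0 < d" using e C [of t] by (simp add: d_def add_nonneg_pos)
        have "d + d = e / 3 / (C t + 1)" unfolding d_def by (rule field_sum_of_halves)
        then have "C t * (d + d) = e / 3 * (C t / (C t + 1))" by simp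
        also have "\<dots> \<le> e / 3 * 1" using e C [of t] by (intro mult_left_mono) auto
        finally show "C t * (d + d) \<le> e / 3" by simp
      qed
      obtain s where s: "s \<in> \<rat>" "max 0 (t - d) < s" "s < t"
        using Rats_dense_in_real [of "max 0 (t - d)" t] False t d by auto
      have "Cauchy (\<lambda>k. f (r k) s c)"
        using rat [of s c] s t by (simp add: Cauchy_convergent_iff)
      then obtain N1 where N1: "\<And>k l. N1 \<le> k \<Longrightarrow> N1 \<le> l \<Longrightarrow> dist (f (r k) s c) (f (r l) s c) < e / 3"
        using e metric_CauchyD [of "\<lambda>k. f (r k) s c" "e/3"] by auto
      obtain N2 where N2: "1 / real (Suc N2) < d"
        using d(1) nat_approx_posE by blast
      have close: "\<bar>f (r k) t c - f (r k) s c\<bar> \<le> e / 3" if "N2 \<le> k" for k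
      proof -
        have "1 / real (Suc (r k)) \<le> 1 / real (Suc N2)"
          using seq_suble [OF r, of k] that by (intro divide_left_mono) auto
        then have "C t * (t - s + 1 / real (Suc (r k))) \<le> C t * (d + d)"
          using N2 s C by (intro mult_left_mono add_mono) auto
        moreover have "\<bar>f (r k) t c - f (r k) s c\<bar> \<le> C t * (t - s + 1 / real (Suc (r k)))"
          using s t by (intro modulus) auto
        ultimately show ?thesis using d(2) by linarith
      qed
      show "\<exists>N. \<forall>k\<ge>N. \<forall>l\<ge>N. dist (f (r k) t c) (f (r l) t c) < e"
      proof (intro exI allI impI)
        fix k l assume "max N1 N2 \<le> k" "max N1 N2 \<le> l"
        then have "\<bar>f (r k) s c - f (r l) s c\<bar> < e / 3" "\<bar>f (r k) t c - f (r k) s c\<bar> \<le> e / 3"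
          "\<bar>f (r l) t c - f (r l) s c\<bar> \<le> e / 3"
          using N1 [of k l] close [of k] close [of l] unfolding dist_real_def by auto
        then show "dist (f (r k) t c) (f (r l) t c) < e"
          unfolding dist_real_def by linarith
      qed
    qed
    then show ?thesis by (simp add: Cauchy_convergent_iff)
  qed
  show thesis
  proof (rule that [OF r])
    show "(\<lambda>k. f (r k) t c) \<longlonglongrightarrow> lim (\<lambda>k. f (r k) t c)" if "0 \<le> t" "c \<in> I" for t c
      using all [OF that] by (simp add: convergent_LIMSEQ_iff)
  qed
qed

context generators begin

text \<open>
  With the state frozen the integrand is linear in the weights, so only the integrals of the weights
  enter. In both directions of the equivalence this links solutions with measurable weights to Euler
  steps.
\<close>

lemma integral_of_mix_near_frozen_state:
  assumes "s \<le> t" and w: "\<And>\<tau>. \<tau> \<in> {s..t} \<Longrightarrow> w \<tau> \<in> mixtures"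
    and I: "\<And>i. i < M \<Longrightarrow> ((\<lambda>\<tau>. w \<tau> i) has_integral I i) {s..t}"
    and J: "((\<lambda>\<tau>. mix (w \<tau>) (x \<tau>) j) has_integral J) {s..t}"
    and x: "\<And>\<tau>. \<tau> \<in> {s..t} \<Longrightarrow> norm1 n (\<lambda>k. x \<tau> k - x s k) \<le> C" and "j < n"
  shows "\<bar>J - mix I (x s) j\<bar> \<le> Lip * C * (t - s)"
proof -
  have "((\<lambda>\<tau>. mix (w \<tau>) (x s) j) has_integral mix I (x s) j) {s..t}"
    unfolding mix_def using I by (intro has_integral_sum has_integral_mult_left) auto
  with J have d: "((\<lambda>\<tau>. mix (w \<tau>) (x \<tau>) j - mix (w \<tau>) (x s) j) has_integral (J - mix I (x s) j)) {s..t}"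
    by (rule has_integral_diff)
  have C: "0 \<le> C" using x [of s] \<open>s \<le> t\<close> by (simp add: norm1_def)
  have "norm (mix (w \<tau>) (x \<tau>) j - mix (w \<tau>) (x s) j) \<le> Lip * C" if "\<tau> \<in> {s..t}" for \<tau>
  proof -
    have "\<bar>mix (w \<tau>) (x \<tau>) j - mix (w \<tau>) (x s) j\<bar> \<le> norm1 n (mix (w \<tau>) (\<lambda>k. x \<tau> k - x s k))"
      unfolding mix_diff [symmetric] by (rule abs_le_norm1) fact
    also have "\<dots> \<le> Lip * norm1 n (\<lambda>k. x \<tau> k - x s k)"
      using w [OF that] by (rule norm1_mix_le)
    also have "\<dots> \<le> Lip * C" using x [OF that] by (intro mult_left_mono) auto
    finally show ?thesis by simp
  qed
  then have "norm (J - mix I (x s) j) \<le> Lip * C * measure lborel {s..t}"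
    using d C by (intro has_integral_bound_real) auto
  then show ?thesis using \<open>s \<le> t\<close> by simp
qed

section \<open>Persistent Euler trajectories of vanishing step size\<close>

lemma mix_weights_add: "mix (\<lambda>i. a i + h * b i) x j = mix a x j + h * mix b x j"
  by (simp add: mix_def distrib_right sum.distrib sum_distrib_left mult.assoc)

text \<open>
  The discrete counterpart of the integral of the weight of generator \<open>i\<close>.
\<close>

definition time_share :: "real \<Rightarrow> (nat \<Rightarrow> nat \<Rightarrow> real) \<Rightarrow> nat \<Rightarrow> nat \<Rightarrow> real" where
  "time_share h w l i = (\<Sum>p<l. h * w p i)"

lemma euler_increment_le:
  assumes w: "\<And>l. w l \<in> mixtures" and h: "0 \<le> h" and B: "\<And>p. p < l' \<Longrightarrow> norm1 n (euler h w x p) \<le> B"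
    and "l \<le> l'"
  shows "norm1 n (\<lambda>j. euler h w x l' j - euler h w x l j) \<le> real (l' - l) * h * (Lip * B)"
  using \<open>l \<le> l'\<close> B
proof (induction l' rule: dec_induct)
  case base
  then show ?case by (simp add: norm1_def)
next
  case (step m)
  let ?X = "euler h w x"
  have "norm1 n (\<lambda>j. ?X (Suc m) j - ?X l j)
      \<le> norm1 n (\<lambda>j. ?X (Suc m) j - ?X m j) + norm1 n (\<lambda>j. ?X m j - ?X l j)"
    by (rule norm1_triangle)
  moreover have "norm1 n (\<lambda>j. ?X (Suc m) j - ?X m j) = h * norm1 n (mix (w m) (?X m))"
    using h by (simp add: norm1_scale)
  moreover have "norm1 n (mix (w m) (?X m)) \<le> Lip * norm1 n (?X m)"
    by (rule norm1_mix_le [OF w])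
  moreover have "Lip * norm1 n (?X m) \<le> Lip * B"
    using step.prems by (intro mult_left_mono) auto
  ultimately have "norm1 n (\<lambda>j. ?X (Suc m) j - ?X l j) \<le> h * (Lip * B) + norm1 n (\<lambda>j. ?X m j - ?X l j)"
    using mult_left_mono [of "norm1 n (mix (w m) (?X m))" "Lip * B" h] h by linarith
  moreover have "norm1 n (\<lambda>j. ?X m j - ?X l j) \<le> real (m - l) * h * (Lip * B)"
    using step by auto
  moreover have "h * (Lip * B) + real (m - l) * h * (Lip * B) = real (Suc m - l) * h * (Lip * B)"
    using step.hyps by (simp add: Suc_diff_le distrib_right)
  ultimately show ?case by linarith
qed

text \<open>
  The weights may vary arbitrarily from step to step; only their accumulated time shares enter to first
  order. The error is quadratic in the elapsed time and does not depend on the step size, so the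
  estimate survives the limit of vanishing step size.
\<close>

lemma euler_first_order:
  assumes w: "\<And>l. w l \<in> mixtures" and h: "0 \<le> h" and B: "\<And>p. p < l' \<Longrightarrow> norm1 n (euler h w x p) \<le> B"
    and "l \<le> l'"
  shows "norm1 n (\<lambda>j. euler h w x l' j - euler h w x l j
            - mix (\<lambda>i. time_share h w l' i - time_share h w l i) (euler h w x l) j)
         \<le> (real (l' - l) * h)\<^sup>2 * (Lip * (Lip * B))"
  using \<open>l \<le> l'\<close> B
proof (induction l' rule: dec_induct)
  case base
  then show ?case by (simp add: norm1_def mix_def)
next
  case (step m)
  let ?X = "euler h w x"
  let ?R = "\<lambda>m j. ?X m j - ?X l j - mix (\<lambda>i. time_share h w m i - time_share h w l i) (?X l) j"
  have "0 \<le> norm1 n (?X m)" by simp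
  also have "\<dots> \<le> B" using step.prems by auto
  finally have B0: "0 \<le> B" .
  have "mix (\<lambda>i. time_share h w (Suc m) i - time_share h w l i) (?X l) j
      = mix (\<lambda>i. time_share h w m i - time_share h w l i) (?X l) j + h * mix (w m) (?X l) j" for j
    using mix_weights_add [of "\<lambda>i. time_share h w m i - time_share h w l i" h "w m" "?X l" j]
    by (simp add: time_share_def algebra_simps)
  then have R: "?R (Suc m) = (\<lambda>j. ?R m j + h * mix (w m) (\<lambda>k. ?X m k - ?X l k) j)"
    by (intro ext) (simp add: mix_diff algebra_simps)
  have "norm1 n (?R (Suc m)) \<le> norm1 n (?R m) + h * norm1 n (mix (w m) (\<lambda>k. ?X m k - ?X l k))"
    unfolding R using norm1_add_le [of n "?R m" "\<lambda>j. h * mix (w m) (\<lambda>k. ?X m k - ?X l k) j"] h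
    by (simp only: norm1_scale abs_of_nonneg)
  also have "\<dots> \<le> (real (m - l) * h)\<^sup>2 * (Lip * (Lip * B)) + h * (Lip * (real (m - l) * h * (Lip * B)))"
  proof (intro add_mono mult_left_mono)
    show "norm1 n (?R m) \<le> (real (m - l) * h)\<^sup>2 * (Lip * (Lip * B))"
      using step by auto
    have "norm1 n (mix (w m) (\<lambda>k. ?X m k - ?X l k)) \<le> Lip * norm1 n (\<lambda>k. ?X m k - ?X l k)"
      by (rule norm1_mix_le [OF w])
    also have "\<dots> \<le> Lip * (real (m - l) * h * (Lip * B))"
      using step by (intro mult_left_mono euler_increment_le w h) auto
    finally show "norm1 n (mix (w m) (\<lambda>k. ?X m k - ?X l k)) \<le> Lip * (real (m - l) * h * (Lip * B))" .
  qed (fact h)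
  also have "(real (m - l) * h)\<^sup>2 * (Lip * (Lip * B)) + h * (Lip * (real (m - l) * h * (Lip * B)))
      = ((real (m - l))\<^sup>2 + real (m - l)) * (h\<^sup>2 * (Lip * (Lip * B)))"
    by (simp add: power2_eq_square algebra_simps)
  also have "\<dots> \<le> (real (Suc m - l))\<^sup>2 * (h\<^sup>2 * (Lip * (Lip * B)))"
    using h B0 step.hyps by (intro mult_right_mono) (auto simp: Suc_diff_le power2_eq_square algebra_simps)
  finally show ?case by (simp only: power_mult_distrib mult.assoc)
qed

lemma time_share_increment:
  assumes w: "\<And>l. w l \<in> mixtures" and h: "0 \<le> h" and "l \<le> l'" "i < M"
  shows "time_share h w l i \<le> time_share h w l' i" "time_share h w l' i - time_share h w l i \<le> real (l' - l) * h"
proof -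
  have eq: "time_share h w l' i - time_share h w l i = (\<Sum>p=l..<l'. h * w p i)"
    using sum_diff_nat_ivl [of 0 l l' "\<lambda>p. h * w p i"] \<open>l \<le> l'\<close> by (simp add: time_share_def atLeast0LessThan)
  have "0 \<le> (\<Sum>p=l..<l'. h * w p i)"
    using h mixturesD(1) [OF w \<open>i < M\<close>] by (intro sum_nonneg) auto
  then show "time_share h w l i \<le> time_share h w l' i" using eq by linarith
  have "(\<Sum>p=l..<l'. h * w p i) \<le> (\<Sum>p=l..<l'. h * 1)"
    using h mixturesD(2) [OF w \<open>i < M\<close>] by (intro sum_mono mult_left_mono) auto
  then show "time_share h w l' i - time_share h w l i \<le> real (l' - l) * h" using eq by simp
qed

lemma sum_time_share:
  assumes w: "\<And>l. w l \<in> mixtures"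
  shows "(\<Sum>i<M. time_share h w l i) = real l * h"
  unfolding time_share_def by (subst sum.swap) (simp add: sum_distrib_left [symmetric] mixturesD(3) [OF w])

lemma euler_bounded_on_time_interval:
  assumes w: "\<And>l. w l \<in> mixtures" and h: "0 \<le> h" and "real l * h \<le> T" and x: "norm1 n x \<le> K"
  shows "norm1 n (euler h w x l) \<le> K * exp (Lip * T)"
proof -
  have "norm1 n (euler h w x l) \<le> (1 + h * Lip) ^ l * norm1 n x"
    by (rule euler_growth(2)) fact+
  also have "\<dots> \<le> exp (h * Lip) ^ l * K"
    using h x by (intro mult_mono power_mono) auto
  also have "exp (h * Lip) ^ l = exp (Lip * (real l * h))"
    by (simp add: exp_of_nat_mult [symmetric] mult_ac)
  finally have "norm1 n (euler h w x l) \<le> exp (Lip * (real l * h)) * K" .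
  moreover have "0 \<le> K" using x norm1_nonneg [of n x] by linarith
  moreover have "exp (Lip * (real l * h)) \<le> exp (Lip * T)"
    using assms(3) by (simp add: mult_left_mono)
  ultimately show ?thesis
    using mult_right_mono [of "exp (Lip * (real l * h))" "exp (Lip * T)" K] by (simp add: mult.commute)
qed

end

lemma continuous_on_half_line:
  fixes f :: "real \<Rightarrow> 'a::topological_space"
  assumes "\<And>T. continuous_on {0..T} f"
  shows "continuous_on {0..} f"
  unfolding continuous_on_eq_continuous_within
proof
  fix t :: real assume "t \<in> {0..}"
  then have "continuous (at t within {0..t + 1}) f"
    using assms [of "t + 1"] by (auto simp: continuous_on_eq_continuous_within)
  moreover have "at t within {0..} = at t within {0..t + 1}"
    by (rule at_within_nhd [of _ "{..<t + 1}"]) auto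
  ultimately show "continuous (at t within {0..}) f" by simp
qed

context generators begin

lemma mix_integrable:
  fixes s t :: real
  assumes w: "\<And>i. i < M \<Longrightarrow> (\<lambda>t. w t i) \<in> borel_measurable borel" "\<And>t. w t \<in> mixtures"
    and x: "\<And>k. k < n \<Longrightarrow> continuous_on {s..t} (\<lambda>\<tau>. x \<tau> k)"
  shows "(\<lambda>\<tau>. mix (w \<tau>) (x \<tau>) j) integrable_on {s..t}"
  unfolding mix_def
proof (intro integrable_sum)
  fix i assume i: "i \<in> {..<M}"
  have cont: "continuous_on {s..t} (\<lambda>\<tau>. G i (x \<tau>) j)"
    unfolding G_def using x by (intro continuous_intros) auto
  have leb: "{s..t} \<in> sets lebesgue"
    by simp
  have m1: "(\<lambda>\<tau>. w \<tau> i) \<in> borel_measurable (lebesgue_on {s..t})"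
    using w(1) i by (intro measurable_restrict_space1 measurable_completion) auto
  have m2: "(\<lambda>\<tau>. G i (x \<tau>) j) \<in> borel_measurable (lebesgue_on {s..t})"
    using cont leb by (rule continuous_imp_measurable_on_sets_lebesgue)
  show "(\<lambda>\<tau>. w \<tau> i * G i (x \<tau>) j) integrable_on {s..t}"
  proof (rule measurable_bounded_by_integrable_imp_integrable)
    show "(\<lambda>\<tau>. w \<tau> i * G i (x \<tau>) j) \<in> borel_measurable (lebesgue_on {s..t})"
      using m1 m2 by measurable
    show "(\<lambda>\<tau>. \<bar>G i (x \<tau>) j\<bar>) integrable_on {s..t}"
      by (intro integrable_continuous_interval continuous_on_rabs cont)
    show "norm (w \<tau> i * G i (x \<tau>) j) \<le> \<bar>G i (x \<tau>) j\<bar>" for \<tau>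
      using mixturesD(1,2) [OF w(2) [of \<tau>], of i] i by (auto simp: abs_mult intro!: mult_left_le_one_le)
  qed (fact leb)
qed auto

text \<open>
  Persistent trajectories with vanishing step size are regarded as step functions of time, together
  with the accumulated time shares of the generators. Along a subsequence both converge at every time,
  to \<open>x\<close> and \<open>W\<close>. The limit satisfies
  \<open>x t - x s = mix (W t - W s) (x s)\<close> up to an error quadratic in \<open>t - s\<close>. If
  \<open>w\<close> is the density of \<open>W\<close>, then \<open>x\<close> minus the integral of its
  velocity therefore has a quadratic modulus and is constant, which is the integral equation.
\<close>

theorem persistent_solution_if_no_step_contracts:
  assumes M: "0 < M" and nc: "\<And>h. 0 < h \<Longrightarrow> \<not> contracting h"
  obtains w x :: "real \<Rightarrow> nat \<Rightarrow> real" where "\<And>i. i < M \<Longrightarrow> (\<lambda>t. w t i) \<in> borel_measurable borel" "\<And>t. w t \<in> mixtures"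
    "\<And>j. j < n \<Longrightarrow> continuous_on {0..} (\<lambda>t. x t j)"
    "\<And>t j. 0 \<le> t \<Longrightarrow> j < n \<Longrightarrow> ((\<lambda>s. mix (w s) (x s) j) has_integral (x t j - x 0 j)) {0..t}"
    "\<And>t. 0 \<le> t \<Longrightarrow> 1/2 \<le> defect (x t)"
proof -
  define h where "h k = 1 / real (Suc k)" for k
  have h: "0 < h k" "real (Suc k) * h k = 1" for k by (simp_all add: h_def)
  obtain K where K: "0 \<le> K" "\<And>x. \<exists>v\<in>ker. norm1 n (\<lambda>k. x k - v k) \<le> K * defect x"
    using distance_to_ker by blast
  \<comment> \<open>(k + 1) squared steps of length h k reach time k + 1\<close>
  have "\<forall>k. \<exists>w x. (\<forall>l. w l \<in> mixtures) \<and> norm1 n x \<le> K \<and> (\<forall>l\<le>(Suc k)\<^sup>2. 1/2 \<le> defect (euler (h k) w x l))"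
    by (intro allI persistent_trajectories_if_not_contracting K nc less_imp_le h)
  then obtain u y where "\<forall>k. (\<forall>l. u k l \<in> mixtures) \<and> norm1 n (y k) \<le> K \<and>
      (\<forall>l\<le>(Suc k)\<^sup>2. 1/2 \<le> defect (euler (h k) (u k) (y k) l))"
    unfolding choice_iff by (elim exE)
  then have u: "\<And>k l. u k l \<in> mixtures" and y: "\<And>k. norm1 n (y k) \<le> K"
    and pers: "\<And>k l. l \<le> (Suc k)\<^sup>2 \<Longrightarrow> 1/2 \<le> defect (euler (h k) (u k) (y k) l)"
    by auto
  \<comment> \<open>the index of the last grid point up to time t\<close>
  define step where "step k t = nat \<lfloor>t * real (Suc k)\<rfloor>" for k :: nat and t :: real
  have step_le: "real (step k t) * h k \<le> t" and step_gt: "t < (real (step k t) + 1) * h k"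
    if "0 \<le> t" for k t
  proof -
    have "real (step k t) = of_int \<lfloor>t * real (Suc k)\<rfloor>" using that by (simp add: step_def)
    then have "real (step k t) \<le> t * real (Suc k)" "t * real (Suc k) < real (step k t) + 1"
      by linarith+
    then show "real (step k t) * h k \<le> t" "t < (real (step k t) + 1) * h k"
      by (simp_all add: h_def field_simps)
  qed
  have step_mono: "step k s \<le> step k t" if "s \<le> t" for k s t
    using that unfolding step_def by (intro nat_mono floor_mono mult_right_mono) auto
  have step_diff: "real (step k t - step k s) * h k \<le> t - s + h k" if "0 \<le> s" "s \<le> t" for k s t
  proof -
    have "real (step k t - step k s) = real (step k t) - real (step k s)"
      using step_mono [OF that(2)] by (simp add: of_nat_diff)
    then show ?thesis using step_le [of t k] step_gt [of s k] that by (simp add: algebra_simps)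
  qed
  define X where "X k t = euler (h k) (u k) (y k) (step k t)" for k t
  define U where "U k t = time_share (h k) (u k) (step k t)" for k t
  define D where "D T = Lip * (K * exp (Lip * T))" for T
  have D: "0 \<le> D T" for T using K(1) by (simp add: D_def)
  have bound: "norm1 n (euler (h k) (u k) (y k) p) \<le> K * exp (Lip * T)" if "p < step k t" "0 \<le> t" "t \<le> T" for k p t T
  proof (rule euler_bounded_on_time_interval [OF u _ _ y])
    have "real p * h k \<le> real (step k t) * h k"
      using that h [of k] by (intro mult_right_mono) auto
    then show "real p * h k \<le> T" using step_le [OF that(2), of k] that by linarith
  qed (use h in \<open>auto simp: less_imp_le\<close>)
  have X_inc: "norm1 n (\<lambda>j. X k t j - X k s j) \<le> (t - s + h k) * D T" if "0 \<le> s" "s \<le> t" "t \<le> T" for k s t T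
  proof -
    have "norm1 n (\<lambda>j. X k t j - X k s j) \<le> real (step k t - step k s) * h k * (Lip * (K * exp (Lip * T)))"
      unfolding X_def using that h [of k]
      by (intro euler_increment_le u bound [of _ k t] step_mono) auto
    also have "\<dots> \<le> (t - s + h k) * D T"
      unfolding D_def [symmetric] using D step_diff that by (intro mult_right_mono) auto
    finally show ?thesis .
  qed
  have X_expansion: "norm1 n (\<lambda>j. X k t j - X k s j - mix (\<lambda>i. U k t i - U k s i) (X k s) j)
      \<le> (t - s + h k)\<^sup>2 * (Lip * D T)" if "0 \<le> s" "s \<le> t" "t \<le> T" for k s t T
  proof -
    have "norm1 n (\<lambda>j. X k t j - X k s j - mix (\<lambda>i. U k t i - U k s i) (X k s) j)
        \<le> (real (step k t - step k s) * h k)\<^sup>2 * (Lip * (Lip * (K * exp (Lip * T))))"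
      unfolding X_def U_def using that h [of k]
      by (intro euler_first_order u bound [of _ k t] step_mono) auto
    also have "\<dots> \<le> (t - s + h k)\<^sup>2 * (Lip * D T)"
      unfolding D_def [symmetric] using D step_diff [OF that(1,2), of k] that h [of k]
      by (intro mult_right_mono power_mono) auto
    finally show ?thesis .
  qed
  have U_mono: "U k s i \<le> U k t i" and U_inc: "U k t i - U k s i \<le> t - s + h k"
    if "0 \<le> s" "s \<le> t" "i < M" for k s t i
  proof -
    show "U k s i \<le> U k t i" unfolding U_def
      using that h [of k] by (intro time_share_increment u step_mono) auto
    have "U k t i - U k s i \<le> real (step k t - step k s) * h k"
      unfolding U_def using that h [of k] by (intro time_share_increment u step_mono) auto
    then show "U k t i - U k s i \<le> t - s + h k" using step_diff [OF that(1,2), of k] by linarith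
  qed
  define f where "f k t c = (case c of Inl j \<Rightarrow> X k t j | Inr i \<Rightarrow> U k t i)" for k t and c :: "nat + nat"
  define I where "I = (Inl ` {..<n} \<union> Inr ` {..<M} :: (nat + nat) set)"
  have f_modulus: "\<bar>f k t c - f k s c\<bar> \<le> (D T + 1) * (t - s + 1 / real (Suc k))"
    if st: "0 \<le> s" "s \<le> t" "t \<le> T" "c \<in> I" for T k s t c
    using st(4) unfolding I_def
  proof (elim UnE imageE)
    fix j assume c: "c = Inl j" "j \<in> {..<n}"
    have "\<bar>X k t j - X k s j\<bar> \<le> (t - s + h k) * D T"
      using abs_le_norm1 [of j n "\<lambda>j. X k t j - X k s j"] X_inc [OF st(1-3), of k] c by simp
    also have "\<dots> \<le> (t - s + h k) * (D T + 1)"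
      using st h [of k] by (intro mult_left_mono) auto
    finally show ?thesis using c by (simp add: f_def h_def mult.commute)
  next
    fix i assume c: "c = Inr i" "i \<in> {..<M}"
    have "\<bar>U k t i - U k s i\<bar> \<le> 1 * (t - s + h k)"
      using U_mono [OF st(1,2), of i k] U_inc [OF st(1,2), of i k] c by simp
    also have "\<dots> \<le> (D T + 1) * (t - s + h k)"
      using st h [of k] D by (intro mult_right_mono) auto
    finally show ?thesis using c by (simp add: f_def h_def)
  qed
  have f_init: "\<bar>f k 0 c\<bar> \<le> K" if "c \<in> I" for k c
    using that abs_le_norm1 [of _ n "y k"] y [of k] K(1)
    by (fastforce simp: I_def f_def X_def U_def step_def time_share_def)
  obtain r F where r: "strict_mono (r :: nat \<Rightarrow> nat)"
    and F: "\<And>t c. 0 \<le> t \<Longrightarrow> c \<in> I \<Longrightarrow> (\<lambda>k. f (r k) t c) \<longlonglongrightarrow> F t c"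
    using almost_equicontinuous_subsequence [of I f "\<lambda>T. D T + 1" K] f_modulus f_init D
    by (metis add_nonneg_nonneg zero_le_one)
  have hr: "(\<lambda>k. h (r k)) \<longlonglongrightarrow> 0"
    using LIMSEQ_subseq_LIMSEQ [OF LIMSEQ_inverse_real_of_nat r]
    by (simp add: h_def o_def inverse_eq_divide)
  define x where "x t j = F t (Inl j)" for t j
  define W where "W i t = F t (Inr i)" for i t
  have x: "(\<lambda>k. X (r k) t j) \<longlonglongrightarrow> x t j" if "0 \<le> t" "j < n" for t j
    using F [of t "Inl j"] that by (simp add: f_def x_def I_def)
  have W: "(\<lambda>k. U (r k) t i) \<longlonglongrightarrow> W i t" if "0 \<le> t" "i < M" for t i
    using F [of t "Inr i"] that by (simp add: f_def W_def I_def)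
  have W_mono: "W i s \<le> W i t" if "i < M" "0 \<le> s" "s \<le> t" for i s t
    using that U_mono by (intro LIMSEQ_le [OF W W]) auto
  have W_zero: "W i 0 = 0" if "i < M" for i
    using W [of 0 i] that by (simp add: U_def step_def time_share_def LIMSEQ_const_iff)
  have W_sum: "(\<Sum>i<M. W i t) = t" if t: "0 \<le> t" for t
  proof (rule LIMSEQ_unique)
    show "(\<lambda>k. \<Sum>i<M. U (r k) t i) \<longlonglongrightarrow> (\<Sum>i<M. W i t)"
      by (rule tendsto_sum) (simp add: W t)
    have eq: "(\<lambda>k. \<Sum>i<M. U (r k) t i) = (\<lambda>k. real (step (r k) t) * h (r k))"
      unfolding U_def by (intro ext sum_time_share u)
    show "(\<lambda>k. \<Sum>i<M. U (r k) t i) \<longlonglongrightarrow> t"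
      unfolding eq
    proof (rule tendsto_sandwich [of "\<lambda>k. t - h (r k)" _ _ "\<lambda>_. t"])
      have "t - h (r k) \<le> real (step (r k) t) * h (r k)" for k
        using step_gt [OF t, of "r k"] by (simp add: distrib_right)
      then show "\<forall>\<^sub>F k in sequentially. t - h (r k) \<le> real (step (r k) t) * h (r k)"
        by simp
      show "\<forall>\<^sub>F k in sequentially. real (step (r k) t) * h (r k) \<le> t"
        using step_le [OF t] by simp
      show "(\<lambda>k. t - h (r k)) \<longlonglongrightarrow> t"
        using tendsto_diff [OF tendsto_const hr, of t] by simp
    qed simp
  qed
  have x_inc: "norm1 n (\<lambda>j. x t j - x s j) \<le> D T * (t - s)" if "0 \<le> s" "s \<le> t" "t \<le> T" for s t T
  proof (rule LIMSEQ_le)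
    show "(\<lambda>k. norm1 n (\<lambda>j. X (r k) t j - X (r k) s j)) \<longlonglongrightarrow> norm1 n (\<lambda>j. x t j - x s j)"
      using that by (intro tendsto_norm1 tendsto_diff x) auto
    have "(\<lambda>k. (t - s + h (r k)) * D T) \<longlonglongrightarrow> (t - s + 0) * D T"
      by (intro tendsto_intros hr)
    then show "(\<lambda>k. (t - s + h (r k)) * D T) \<longlonglongrightarrow> D T * (t - s)"
      by (simp add: mult.commute)
    show "\<exists>N. \<forall>k\<ge>N. norm1 n (\<lambda>j. X (r k) t j - X (r k) s j) \<le> (t - s + h (r k)) * D T"
      using X_inc [OF that] by blast
  qed
  have x_expansion: "\<bar>x t j - x s j - mix (\<lambda>i. W i t - W i s) (x s) j\<bar> \<le> (t - s)\<^sup>2 * (Lip * D T)"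
    if "0 \<le> s" "s \<le> t" "t \<le> T" "j < n" for s t T j
  proof (rule LIMSEQ_le)
    let ?R = "\<lambda>k j. X (r k) t j - X (r k) s j - mix (\<lambda>i. U (r k) t i - U (r k) s i) (X (r k) s) j"
    show "(\<lambda>k. \<bar>?R k j\<bar>) \<longlonglongrightarrow> \<bar>x t j - x s j - mix (\<lambda>i. W i t - W i s) (x s) j\<bar>"
      using that by (intro tendsto_rabs tendsto_diff tendsto_mix x W) auto
    have "(\<lambda>k. (t - s + h (r k))\<^sup>2 * (Lip * D T)) \<longlonglongrightarrow> (t - s + 0)\<^sup>2 * (Lip * D T)"
      by (intro tendsto_intros hr)
    then show "(\<lambda>k. (t - s + h (r k))\<^sup>2 * (Lip * D T)) \<longlonglongrightarrow> (t - s)\<^sup>2 * (Lip * D T)"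
      by simp
    have "\<bar>?R k j\<bar> \<le> (t - s + h (r k))\<^sup>2 * (Lip * D T)" for k
      using abs_le_norm1 [of j n "?R k"] X_expansion [OF that(1-3), of "r k"] that(4) by linarith
    then show "\<exists>N. \<forall>k\<ge>N. \<bar>?R k j\<bar> \<le> (t - s + h (r k))\<^sup>2 * (Lip * D T)"
      by blast
  qed
  have x_q: "1/2 \<le> defect (x t)" if t: "0 \<le> t" for t
  proof (rule LIMSEQ_le_const)
    show "(\<lambda>k. defect (X (r k) t)) \<longlonglongrightarrow> defect (x t)"
      using t by (intro tendsto_defect x) auto
    have "1/2 \<le> defect (X (r k) t)" if k: "nat \<lceil>t\<rceil> \<le> k" for k
    proof -
      have "real k \<ge> t" using k by linarith
      then have "t \<le> real (Suc (r k))" using seq_suble [OF r, of k] by simp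
      then have "t * real (Suc (r k)) \<le> real (Suc (r k)) * real (Suc (r k))"
        by (intro mult_right_mono) auto
      then have "real (step (r k) t) \<le> real (Suc (r k)) * real (Suc (r k))"
        using step_le [OF t, of "r k"] by (simp add: h_def field_simps)
      then have "step (r k) t \<le> (Suc (r k))\<^sup>2"
        unfolding power2_eq_square of_nat_mult [symmetric] of_nat_le_iff .
      then show ?thesis unfolding X_def by (rule pers)
    qed
    then show "\<exists>N. \<forall>k\<ge>N. 1/2 \<le> defect (X (r k) t)" by blast
  qed
  have x_cont: "continuous_on {0..} (\<lambda>t. x t j)" if "j < n" for j
  proof (rule continuous_on_half_line, rule lipschitz_on_continuous_on, rule lipschitz_onI)
    fix T s t :: real assume "s \<in> {0..T}" "t \<in> {0..T}"
    then have st: "0 \<le> s" "s \<le> T" "0 \<le> t" "t \<le> T" by auto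
    have inc: "\<bar>x b j - x a j\<bar> \<le> D T * (b - a)" if "0 \<le> a" "a \<le> b" "b \<le> T" for a b
      using abs_le_norm1 [OF \<open>j < n\<close>, of "\<lambda>j. x b j - x a j"] x_inc [OF that] by linarith
    show "dist (x s j) (x t j) \<le> D T * dist s t"
    proof (cases "s \<le> t")
      case True
      then show ?thesis using inc [of s t] st by (simp add: dist_real_def abs_minus_commute)
    next
      case False
      then show ?thesis using inc [of t s] st by (simp add: dist_real_def)
    qed
  qed (fact D)
  obtain w where w_meas: "\<And>i. i < M \<Longrightarrow> (\<lambda>t. w t i) \<in> borel_measurable borel"
    and w_nonneg: "\<And>t i. i < M \<Longrightarrow> 0 \<le> w t i" and w_sum: "\<And>t. (\<Sum>i<M. w t i) = (1::real)"
    and w_int: "\<And>i s t. i < M \<Longrightarrow> 0 \<le> s \<Longrightarrow> s \<le> t \<Longrightarrow> ((\<lambda>\<tau>. w \<tau> i) has_integral (W i t - W i s)) {s..t}"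
    using densities_of_time_partition [OF M W_mono W_sum W_zero] by blast
  have w: "w t \<in> mixtures" for t using w_nonneg w_sum by (simp add: mixtures_def)
  have x_sol: "((\<lambda>s. mix (w s) (x s) j) has_integral (x T j - x 0 j)) {0..T}" if "0 \<le> T" "j < n" for T j
  proof -
    let ?g = "\<lambda>s. mix (w s) (x s) j"
    have int: "?g integrable_on {s..t}" if "0 \<le> s" for s t
      using that by (intro mix_integrable w_meas w continuous_on_subset [OF x_cont]) auto
    define z where "z t = x t j - integral {0..t} ?g" for t
    have "z T = z 0"
    proof (rule constant_if_quadratic_modulus [OF \<open>0 \<le> T\<close>])
      fix s t assume st: "0 \<le> s" "s \<le> t" "t \<le> T"
      have J: "\<bar>integral {s..t} ?g - mix (\<lambda>i. W i t - W i s) (x s) j\<bar> \<le> Lip * (D T * (t - s)) * (t - s)"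
      proof (rule integral_of_mix_near_frozen_state [of s t w _ x])
        show "(?g has_integral integral {s..t} ?g) {s..t}"
          using int [OF st(1)] by (rule integrable_integral)
        show "norm1 n (\<lambda>k. x \<tau> k - x s k) \<le> D T * (t - s)" if "\<tau> \<in> {s..t}" for \<tau>
        proof -
          have "norm1 n (\<lambda>k. x \<tau> k - x s k) \<le> D T * (\<tau> - s)"
            using that st by (intro x_inc) auto
          also have "\<dots> \<le> D T * (t - s)" using that D by (intro mult_left_mono) auto
          finally show ?thesis .
        qed
      qed (use st w w_int \<open>j < n\<close> in auto)
      have "integral {0..s} ?g + integral {s..t} ?g = integral {0..t} ?g"
        using st int by (intro Henstock_Kurzweil_Integration.integral_combine) auto
      then have "z t - z s = (x t j - x s j - mix (\<lambda>i. W i t - W i s) (x s) j)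
          - (integral {s..t} ?g - mix (\<lambda>i. W i t - W i s) (x s) j)"
        by (simp add: z_def)
      moreover have "(t - s)\<^sup>2 * (Lip * D T) + Lip * (D T * (t - s)) * (t - s) = 2 * Lip * D T * (t - s)\<^sup>2"
        by (simp add: power2_eq_square)
      ultimately show "\<bar>z t - z s\<bar> \<le> 2 * Lip * D T * (t - s)\<^sup>2"
        using J x_expansion [OF st \<open>j < n\<close>] by linarith
    qed
    then have "integral {0..T} ?g = x T j - x 0 j" by (simp add: z_def)
    then show ?thesis using integrable_integral [OF int [of 0 T]] by simp
  qed
  show thesis
    using that [of w x] w_meas w x_cont x_sol x_q by blast
qed

end

context generators begin

lemma ker_cong: "(\<And>k. k < n \<Longrightarrow> x k = y k) \<Longrightarrow> x \<in> ker \<longleftrightarrow> y \<in> ker"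
  using defect_cong [of x y] defect_eq_0_iff [of x] defect_eq_0_iff [of y] by simp

lemma ker_add: "x \<in> ker \<Longrightarrow> y \<in> ker \<Longrightarrow> (\<lambda>j. x j + y j) \<in> ker"
  by (simp add: ker_def G_add)

lemma ker_scale: "x \<in> ker \<Longrightarrow> (\<lambda>j. c * x j) \<in> ker"
  by (simp add: ker_def G_scale)

lemma ker_sum: "(\<And>a. a \<in> I \<Longrightarrow> f a \<in> ker) \<Longrightarrow> (\<lambda>j. \<Sum>a\<in>I. f a j) \<in> ker"
  by (simp add: ker_def G_sum)

end

section \<open>Polyhedral certificates force convergence\<close>

text \<open>
  The content of a matrix certificate modulo the kernel: \<open>c\<close> lists the columns outside the
  kernel block, \<open>p i\<close> is the matrix of generator \<open>i\<close> on them, and the last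
  assumption bounds the induced 1-norm of \<open>I + h * p i\<close>.
\<close>

locale polyhedral_certificate = generators +
  fixes h \<rho> :: real and r :: nat and c :: "nat \<Rightarrow> nat \<Rightarrow> real" and p :: "nat \<Rightarrow> nat \<Rightarrow> nat \<Rightarrow> real"
  assumes h_pos: "0 < h" and \<rho>: "0 \<le> \<rho>" "\<rho> < 1"
    and spans: "\<And>x. \<exists>u. (\<lambda>j. x j - (\<Sum>a<r. u a * c a j)) \<in> ker"
    and invariant: "\<And>i a. i < M \<Longrightarrow> a < r \<Longrightarrow> (\<lambda>j. G i (c a) j - (\<Sum>b<r. p i b a * c b j)) \<in> ker"
    and contraction: "\<And>i u. i < M \<Longrightarrow> norm1 r (\<lambda>b. u b + h * (\<Sum>a<r. p i b a * u a)) \<le> \<rho> * norm1 r u"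
begin

text \<open>
  Sublevel sets of a polyhedral seminorm, the least absolute coefficient sum that represents
  \<open>x\<close> modulo the kernel. A relation makes it unnecessary to handle this infimum.
\<close>

definition covered :: "real \<Rightarrow> (nat \<Rightarrow> real) \<Rightarrow> bool" where
  "covered a x \<longleftrightarrow> (\<exists>u. (\<lambda>j. x j - (\<Sum>b<r. u b * c b j)) \<in> ker \<and> norm1 r u \<le> a)"

definition rate :: real where "rate = (1 - \<rho>) / h"

definition gain :: real where "gain = (\<Sum>b<r. defect (c b))"

lemma rate_pos: "0 < rate"
  using h_pos \<rho> by (simp add: rate_def)

lemma gain_nonneg: "0 \<le> gain"
  by (simp add: gain_def sum_nonneg)

lemma covered_cong: "(\<And>k. k < n \<Longrightarrow> x k = y k) \<Longrightarrow> covered a x \<longleftrightarrow> covered a y"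
  unfolding covered_def by (intro ex_cong1 conj_cong refl ker_cong) auto

lemma covered_mono: "covered a x \<Longrightarrow> a \<le> b \<Longrightarrow> covered b x"
  unfolding covered_def using order.trans by blast

lemma covered_add:
  assumes "covered a x" "covered b y" shows "covered (a + b) (\<lambda>j. x j + y j)"
proof -
  obtain u v where u: "(\<lambda>j. x j - (\<Sum>b<r. u b * c b j)) \<in> ker" "norm1 r u \<le> a"
    and v: "(\<lambda>j. y j - (\<Sum>b<r. v b * c b j)) \<in> ker" "norm1 r v \<le> b"
    using assms unfolding covered_def by blast
  have "(\<lambda>j. x j + y j - (\<Sum>b<r. (u b + v b) * c b j)) \<in> ker"
    using ker_add [OF u(1) v(1)] by (simp add: distrib_right sum.distrib algebra_simps)
  moreover have "norm1 r (\<lambda>b. u b + v b) \<le> a + b"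
    using norm1_add_le [of r u v] u(2) v(2) by linarith
  ultimately show ?thesis
    unfolding covered_def by (intro exI [of _ "\<lambda>b. u b + v b"] conjI)
qed

lemma covered_by_norm:
  obtains \<kappa> where "0 \<le> \<kappa>" "\<And>x. covered (\<kappa> * norm1 n x) x"
proof -
  have "\<forall>k. \<exists>u. (\<lambda>j. (if j = k then 1 else 0) - (\<Sum>b<r. u b * c b j)) \<in> ker"
    by (intro allI spans)
  then obtain U where "\<forall>k. (\<lambda>j. (if j = k then 1 else 0) - (\<Sum>b<r. U k b * c b j)) \<in> ker"
    by (rule choice [THEN exE])
  then have U: "\<And>k. (\<lambda>j. (if j = k then 1 else 0) - (\<Sum>b<r. U k b * c b j)) \<in> ker"
    by blast
  define \<kappa> where "\<kappa> = (\<Sum>k<n. norm1 r (U k))"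
  show thesis
  proof
    show "0 \<le> \<kappa>" by (simp add: \<kappa>_def sum_nonneg)
    fix x
    define u where "u b = (\<Sum>k<n. x k * U k b)" for b
    have "(\<lambda>j. \<Sum>k<n. x k * ((if j = k then 1 else 0) - (\<Sum>b<r. U k b * c b j))) \<in> ker"
      by (intro ker_sum ker_scale U)
    moreover have "(\<Sum>k<n. x k * ((if j = k then 1 else 0) - (\<Sum>b<r. U k b * c b j)))
        = x j - (\<Sum>b<r. u b * c b j)" if "j < n" for j
    proof -
      have "(\<Sum>k<n. x k * (if j = k then 1 else 0)) = x j"
        using that by (simp add: if_distrib [where f = "\<lambda>a. _ * a"] cong: if_cong)
      moreover have "(\<Sum>k<n. x k * (\<Sum>b<r. U k b * c b j)) = (\<Sum>b<r. u b * c b j)"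
        unfolding u_def sum_distrib_left sum_distrib_right by (subst sum.swap) (simp add: mult.assoc)
      ultimately show ?thesis by (simp add: right_diff_distrib sum_subtractf)
    qed
    ultimately have "(\<lambda>j. x j - (\<Sum>b<r. u b * c b j)) \<in> ker"
      by (rule ker_cong [THEN iffD1, rotated])
    moreover have "norm1 r u \<le> \<kappa> * norm1 n x"
    proof -
      have "norm1 r u \<le> (\<Sum>k<n. norm1 r (\<lambda>b. x k * U k b))"
        unfolding u_def by (rule norm1_sum_le)
      also have "\<dots> \<le> (\<Sum>k<n. norm1 n x * norm1 r (U k))"
        unfolding norm1_scale by (intro sum_mono mult_right_mono abs_le_norm1) auto
      finally show ?thesis by (simp add: \<kappa>_def sum_distrib_left mult.commute)
    qed
    ultimately show "covered (\<kappa> * norm1 n x) x" unfolding covered_def by blast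
  qed
qed

lemma defect_le_if_covered:
  assumes "covered a x" shows "defect x \<le> gain * a"
proof -
  obtain u where u: "(\<lambda>j. x j - (\<Sum>b<r. u b * c b j)) \<in> ker" "norm1 r u \<le> a"
    using assms unfolding covered_def by blast
  have "defect x = defect (\<lambda>j. x j - (x j - (\<Sum>b<r. u b * c b j)))"
    using defect_diff_ker [OF u(1), of x] by simp
  also have "\<dots> = defect (\<lambda>j. \<Sum>b<r. u b * c b j)" by simp
  also have "\<dots> \<le> (\<Sum>b<r. defect (\<lambda>j. u b * c b j))"
  proof -
    have "defect (\<lambda>j. \<Sum>b\<in>I. u b * c b j) \<le> (\<Sum>b\<in>I. defect (\<lambda>j. u b * c b j))" if "finite I" for I
      using that
    proof induction
      case empty
      then show ?case by (simp add: defect_def G_def norm1_def)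
    next
      case (insert b I)
      then show ?case using defect_add_le [of "\<lambda>j. u b * c b j" "\<lambda>j. \<Sum>b\<in>I. u b * c b j"] by simp
    qed
    then show ?thesis by simp
  qed
  also have "\<dots> \<le> (\<Sum>b<r. norm1 r u * defect (c b))"
    unfolding defect_scale by (intro sum_mono mult_right_mono abs_le_norm1) auto
  also have "\<dots> = gain * norm1 r u" by (simp add: gain_def sum_distrib_left mult.commute)
  also have "\<dots> \<le> gain * a" using u(2) gain_nonneg by (rule mult_left_mono)
  finally show ?thesis .
qed

text \<open>
  For \<open>\<delta> \<le> h\<close> the matrix \<open>I + \<delta> * p i\<close> is the convex combination
  of \<open>I\<close> and \<open>I + h * p i\<close> with weight \<open>\<delta> / h\<close> on the second,
  so its norm is at most \<open>1 - \<delta> * rate\<close>. Mixing the generators preserves this bound.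
\<close>

lemma covered_euler_step:
  assumes "covered a x" and w: "w \<in> mixtures" and \<delta>: "0 \<le> \<delta>" "\<delta> \<le> h"
  shows "covered ((1 - \<delta> * rate) * a) (\<lambda>j. x j + \<delta> * mix w x j)"
proof -
  obtain u where u: "(\<lambda>j. x j - (\<Sum>b<r. u b * c b j)) \<in> ker" "norm1 r u \<le> a"
    using assms unfolding covered_def by blast
  define Pu where "Pu i b = (\<Sum>a<r. p i b a * u a)" for i b
  define u' where "u' b = u b + \<delta> * (\<Sum>i<M. w i * Pu i b)" for b
  define Z where "Z j = (\<Sum>i<M. w i * (\<Sum>a<r. u a * (G i (c a) j - (\<Sum>b<r. p i b a * c b j))))" for j
  have "(\<lambda>j. (x j - (\<Sum>b<r. u b * c b j)) + \<delta> * Z j) \<in> ker"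
    unfolding Z_def by (intro ker_add ker_scale ker_sum u invariant) auto
  moreover have "(x j - (\<Sum>b<r. u b * c b j)) + \<delta> * Z j
      = (x j + \<delta> * mix w x j) - (\<Sum>b<r. u' b * c b j)" if "j < n" for j
  proof -
    have "(\<Sum>a<r. u a * (G i (c a) j - (\<Sum>b<r. p i b a * c b j))) = G i x j - (\<Sum>b<r. Pu i b * c b j)" if "i < M" for i
    proof -
      have "G i x j = G i (\<lambda>j. \<Sum>b<r. u b * c b j) j"
        using u(1) \<open>i < M\<close> \<open>j < n\<close> by (simp add: ker_def G_diff)
      also have "\<dots> = (\<Sum>a<r. u a * G i (c a) j)"
        by (simp add: G_sum G_scale)
      finally have "G i x j = (\<Sum>a<r. u a * G i (c a) j)" .
      moreover have "(\<Sum>a<r. u a * (\<Sum>b<r. p i b a * c b j)) = (\<Sum>b<r. Pu i b * c b j)"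
        unfolding Pu_def sum_distrib_left sum_distrib_right by (subst sum.swap) (simp add: mult_ac)
      ultimately show ?thesis by (simp add: right_diff_distrib sum_subtractf)
    qed
    then have "Z j = (\<Sum>i<M. w i * (G i x j - (\<Sum>b<r. Pu i b * c b j)))"
      unfolding Z_def by (intro sum.cong refl) auto
    also have "\<dots> = mix w x j - (\<Sum>i<M. w i * (\<Sum>b<r. Pu i b * c b j))"
      by (simp add: mix_def right_diff_distrib sum_subtractf)
    also have "(\<Sum>i<M. w i * (\<Sum>b<r. Pu i b * c b j)) = (\<Sum>b<r. (\<Sum>i<M. w i * Pu i b) * c b j)"
      unfolding sum_distrib_left sum_distrib_right by (subst sum.swap) (simp add: mult_ac)
    finally have S: "Z j = mix w x j - (\<Sum>b<r. (\<Sum>i<M. w i * Pu i b) * c b j)" .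
    have "(\<Sum>b<r. u' b * c b j) = (\<Sum>b<r. u b * c b j) + \<delta> * (\<Sum>b<r. (\<Sum>i<M. w i * Pu i b) * c b j)"
      by (simp add: u'_def distrib_right sum.distrib mult.assoc sum_distrib_left [symmetric])
    then show ?thesis unfolding S by (simp add: right_diff_distrib)
  qed
  ultimately have "(\<lambda>j. (x j + \<delta> * mix w x j) - (\<Sum>b<r. u' b * c b j)) \<in> ker"
    by (rule ker_cong [THEN iffD1, rotated])
  moreover have "norm1 r u' \<le> (1 - \<delta> * rate) * a"
  proof -
    have s: "0 \<le> \<delta> / h" "0 \<le> 1 - \<delta> / h" using \<delta> h_pos by auto
    have "u' b = (1 - \<delta> / h) * u b + \<delta> / h * (\<Sum>i<M. w i * (u b + h * Pu i b))" for b
    proof -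
      have "(\<Sum>i<M. w i * (u b + h * Pu i b)) = u b + h * (\<Sum>i<M. w i * Pu i b)"
      proof -
        have "(\<Sum>i<M. w i * (u b + h * Pu i b)) = (\<Sum>i<M. w i) * u b + h * (\<Sum>i<M. w i * Pu i b)"
          by (simp add: distrib_left sum.distrib sum_distrib_right sum_distrib_left mult_ac)
        then show ?thesis using mixturesD(3) [OF w] by simp
      qed
      then show ?thesis using h_pos by (simp add: u'_def field_simps)
    qed
    then have u'_eq: "u' = (\<lambda>b. (1 - \<delta> / h) * u b + \<delta> / h * (\<Sum>i<M. w i * (u b + h * Pu i b)))" by auto
    have "norm1 r u' \<le> (1 - \<delta> / h) * norm1 r u + \<delta> / h * norm1 r (\<lambda>b. \<Sum>i<M. w i * (u b + h * Pu i b))"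
      unfolding u'_eq
      by (rule order.trans [OF norm1_add_le]) (use s in \<open>simp only: norm1_scale abs_of_nonneg order.refl\<close>)
    moreover have W: "norm1 r (\<lambda>b. \<Sum>i<M. w i * (u b + h * Pu i b)) \<le> \<rho> * norm1 r u"
    proof -
      have "norm1 r (\<lambda>b. \<Sum>i<M. w i * (u b + h * Pu i b)) \<le> (\<Sum>i<M. norm1 r (\<lambda>b. w i * (u b + h * Pu i b)))"
        by (rule norm1_sum_le)
      also have "\<dots> \<le> (\<Sum>i<M. w i * (\<rho> * norm1 r u))"
        using mixturesD(1) [OF w] contraction unfolding norm1_scale Pu_def
        by (intro sum_mono) (auto intro!: mult_left_mono)
      also have "\<dots> = \<rho> * norm1 r u"
        using mixturesD(3) [OF w] by (simp add: sum_distrib_right [symmetric])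
      finally show ?thesis .
    qed
    ultimately have "norm1 r u' \<le> (1 - \<delta> / h) * norm1 r u + \<delta> / h * (\<rho> * norm1 r u)"
      using mult_left_mono [OF W s(1)] by linarith
    also have "\<dots> = (1 - \<delta> * rate) * norm1 r u"
      using h_pos by (simp add: rate_def field_simps)
    also have "\<dots> \<le> (1 - \<delta> * rate) * a"
    proof (intro mult_left_mono u)
      have "\<delta> * rate \<le> h * rate" using \<delta> rate_pos by (intro mult_right_mono) auto
      also have "h * rate \<le> 1" using h_pos \<rho> by (simp add: rate_def)
      finally show "0 \<le> 1 - \<delta> * rate" by simp
    qed
    finally show ?thesis .
  qed
  ultimately show ?thesis unfolding covered_def by blast
qed

text \<open>
  The increments are bounded by the defect, which decays geometrically. The trajectory therefore has
  finite length and converges, and the defect of its limit is zero.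
\<close>

theorem discrete_trajectories_converge:
  assumes h1: "h = 1" and w: "\<And>k. w k \<in> mixtures"
    and x: "\<And>k j. j < n \<Longrightarrow> x (Suc k) j = x k j + mix (w k) (x k) j"
  shows "\<exists>y\<in>ker. \<forall>j<n. (\<lambda>k. x k j) \<longlonglongrightarrow> y j"
proof -
  obtain a where a: "covered a (x 0)" by (rule covered_by_norm) (rule that)
  have cov: "covered (\<rho> ^ k * a) (x k)" for k
  proof (induction k)
    case (Suc k)
    have "covered ((1 - 1 * rate) * (\<rho> ^ k * a)) (\<lambda>j. x k j + 1 * mix (w k) (x k) j)"
      using Suc w h1 by (intro covered_euler_step) auto
    moreover have "1 - 1 * rate = \<rho>" unfolding rate_def by (simp add: h1)
    ultimately have "covered (\<rho> ^ Suc k * a) (\<lambda>j. x k j + mix (w k) (x k) j)" by (simp add: mult.assoc)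
    then show ?case by (rule covered_cong [THEN iffD2, rotated]) (rule x)
  qed (simp add: a)
  have q_le: "defect (x k) \<le> gain * a * \<rho> ^ k" for k
    using defect_le_if_covered [OF cov [of k]] by (simp add: mult_ac)
  have "convergent (\<lambda>k. x k j)" if j: "j < n" for j
  proof -
    have diff: "norm (x (Suc k) j - x k j) \<le> gain * a * \<rho> ^ k" for k
    proof -
      have "x (Suc k) j - x k j = mix (w k) (x k) j" using x [OF j, of k] by linarith
      moreover have "\<bar>mix (w k) (x k) j\<bar> \<le> gain * a * \<rho> ^ k"
        using abs_le_norm1 [OF j, of "mix (w k) (x k)"] norm1_mix_le_defect [OF w, of k "x k"] q_le [of k]
        by linarith
      ultimately show ?thesis by (simp only: real_norm_def)
    qed
    have "summable (\<lambda>k. gain * a * \<rho> ^ k)"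
      using \<rho> by (intro summable_mult summable_geometric) auto
    then have "summable (\<lambda>k. x (Suc k) j - x k j)"
      by (rule summable_comparison_test' [where N = 0]) (rule diff)
    then have "convergent (\<lambda>N. \<Sum>k<N. x (Suc k) j - x k j)"
      by (simp add: summable_iff_convergent)
    moreover have "(\<lambda>N. \<Sum>k<N. x (Suc k) j - x k j) = (\<lambda>N. x N j - x 0 j)"
      by (intro ext) (rule sum_lessThan_telescope [of "\<lambda>k. x k j"])
    ultimately have "convergent (\<lambda>N. x N j - x 0 j)" by (simp only:)
    then show ?thesis by (simp only: convergent_diff_const_right_iff)
  qed
  then have lim: "(\<lambda>k. x k j) \<longlonglongrightarrow> lim (\<lambda>k. x k j)" if "j < n" for j
    using that by (simp add: convergent_LIMSEQ_iff)
  define y where "y j = lim (\<lambda>k. x k j)" for j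
  have "(\<lambda>k. defect (x k)) \<longlonglongrightarrow> defect y"
    by (rule tendsto_defect) (simp add: y_def lim)
  moreover have "(\<lambda>k. defect (x k)) \<longlonglongrightarrow> 0"
  proof (rule tendsto_sandwich [of "\<lambda>_. 0"])
    show "(\<lambda>k. gain * a * \<rho> ^ k) \<longlonglongrightarrow> 0"
      using \<rho> by (intro tendsto_mult_right_zero LIMSEQ_power_zero) auto
  qed (use q_le in auto)
  ultimately have "defect y = 0" by (rule LIMSEQ_unique)
  then have "y \<in> ker" by (simp add: defect_eq_0_iff)
  moreover have "\<forall>j<n. (\<lambda>k. x k j) \<longlonglongrightarrow> y j"
    unfolding y_def using lim by blast
  ultimately show ?thesis by (intro bexI [of _ y])
qed

end

lemma has_integral_increment:
  fixes f F :: "real \<Rightarrow> real"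
  assumes f: "\<And>t. 0 \<le> t \<Longrightarrow> (f has_integral (F t - F 0)) {0..t}" and st: "0 \<le> s" "s \<le> t"
  shows "(f has_integral (F t - F s)) {s..t}"
proof -
  have i: "f integrable_on {0..t}" using f [of t] st by (auto simp: has_integral_integrable)
  then have i2: "f integrable_on {s..t}"
    by (rule integrable_subinterval_real) (use st in auto)
  have "integral {0..s} f + integral {s..t} f = integral {0..t} f"
    using st i by (intro Henstock_Kurzweil_Integration.integral_combine) auto
  moreover have "integral {0..s} f = F s - F 0" "integral {0..t} f = F t - F 0"
    using f [of s] f [of t] st by (auto simp: integral_unique)
  ultimately have "integral {s..t} f = F t - F s" by linarith
  then show ?thesis using integrable_integral [OF i2] by simp
qed

context polyhedral_certificate begin

text \<open>
  Divide the time interval into \<open>N\<close> equal pieces. Over each of them the solution moves like one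
  Euler step with averaged weights, up to an error of order \<open>1 / N\<^sup>2\<close>. The contraction
  factors multiply to at most \<open>exp (- rate * T)\<close>, and the errors add up to order
  \<open>1 / N\<close>.
\<close>

lemma covered_decays_along_solution:
  fixes w x :: "real \<Rightarrow> nat \<Rightarrow> real"
  assumes T: "0 \<le> T" and w: "\<And>t. 0 \<le> t \<Longrightarrow> w t \<in> mixtures"
    and meas: "\<And>i. i < M \<Longrightarrow> (\<lambda>t. w t i) \<in> borel_measurable (lebesgue_on {0..})"
    and cont: "\<And>j. j < n \<Longrightarrow> continuous_on {0..} (\<lambda>t. x t j)"
    and sol: "\<And>t j. 0 \<le> t \<Longrightarrow> j < n \<Longrightarrow> ((\<lambda>s. mix (w s) (x s) j) has_integral (x t j - x 0 j)) {0..t}"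
    and a: "covered a (x 0)"
  shows "defect (x T) \<le> gain * a * exp (- (rate * T))"
proof -
  have inc: "((\<lambda>\<tau>. mix (w \<tau>) (x \<tau>) j) has_integral (x t j - x s j)) {s..t}"
    if "0 \<le> s" "s \<le> t" "j < n" for s t j
    by (rule has_integral_increment [where F = "\<lambda>t. x t j"])
      (rule sol, assumption, rule that, rule that, rule that)
  have w_int: "(\<lambda>\<tau>. w \<tau> i) integrable_on {s..t}" if "i < M" "0 \<le> s" for s t i
  proof (rule measurable_bounded_by_integrable_imp_integrable [where g = "\<lambda>_. 1"])
    show "(\<lambda>\<tau>. w \<tau> i) \<in> borel_measurable (lebesgue_on {s..t})"
      using meas [OF that(1)] by (rule measurable_restrict_mono) (use that in auto)
    show "norm (w \<tau> i) \<le> 1" if "\<tau> \<in> {s..t}" for \<tau>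
      using mixturesD(1,2) [OF w, of \<tau> i] that \<open>i < M\<close> \<open>0 \<le> s\<close> by auto
  qed auto
  have "continuous_on {0..T} (\<lambda>t. norm1 n (x t))"
    unfolding norm1_def by (intro continuous_intros continuous_on_subset [OF cont]) auto
  then have "bounded ((\<lambda>t. norm1 n (x t)) ` {0..T})"
    by (intro compact_imp_bounded compact_continuous_image) auto
  then obtain B where "0 < B" and "\<forall>y\<in>(\<lambda>t. norm1 n (x t)) ` {0..T}. norm y \<le> B"
    unfolding bounded_pos by blast
  then have B: "\<And>t. t \<in> {0..T} \<Longrightarrow> norm1 n (x t) \<le> B"
    by simp
  define E where "E = real n * (Lip * B)"
  have lip: "norm1 n (\<lambda>j. x t j - x s j) \<le> E * (t - s)" if st: "0 \<le> s" "s \<le> t" "t \<le> T" for s t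
  proof -
    have "\<bar>x t j - x s j\<bar> \<le> Lip * B * (t - s)" if j: "j < n" for j
    proof -
      have "norm (x t j - x s j) \<le> Lip * B * measure lborel {s..t}"
      proof (rule has_integral_bound_real [where S = "{}"])
        show "((\<lambda>\<tau>. mix (w \<tau>) (x \<tau>) j) has_integral (x t j - x s j)) {s..t}"
          by (rule inc [OF st(1,2) j])
        show "norm (mix (w \<tau>) (x \<tau>) j) \<le> Lip * B" if "\<tau> \<in> {s..t} - {}" for \<tau>
        proof -
          have "\<bar>mix (w \<tau>) (x \<tau>) j\<bar> \<le> norm1 n (mix (w \<tau>) (x \<tau>))" by (rule abs_le_norm1) fact
          also have "\<dots> \<le> Lip * norm1 n (x \<tau>)" using that st by (intro norm1_mix_le w) auto
          also have "\<dots> \<le> Lip * B" using that st by (intro mult_left_mono B) auto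
          finally show ?thesis by simp
        qed
      qed (use \<open>0 < B\<close> in auto)
      then show ?thesis using st by simp
    qed
    then have "norm1 n (\<lambda>j. x t j - x s j) \<le> (\<Sum>j<n. Lip * B * (t - s))"
      unfolding norm1_def by (intro sum_mono) auto
    then show ?thesis by (simp add: E_def mult.assoc)
  qed
  obtain \<kappa> where \<kappa>: "0 \<le> \<kappa>" "\<And>x. covered (\<kappa> * norm1 n x) x"
    by (rule covered_by_norm) (rule that)
  define \<kappa>' where "\<kappa>' = \<kappa> * (real n * (Lip * E))"
  have step: "covered ((1 - d * rate) * b + \<kappa>' * d\<^sup>2) (x (s + d))"
    if s: "0 \<le> s" "s + d \<le> T" and d: "0 < d" "d \<le> h" and b: "covered b (x s)" for s d b
  proof -
    define I where "I i = integral {s..s + d} (\<lambda>\<tau>. w \<tau> i)" for i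
    define v where "v i = I i / d" for i
    have I: "((\<lambda>\<tau>. w \<tau> i) has_integral I i) {s..s + d}" if "i < M" for i
      unfolding I_def using w_int [OF that s(1)] by (rule integrable_integral)
    \<comment> \<open>averages of mixtures are mixtures, so the certificate applies to them\<close>
    have v: "v \<in> mixtures"
    proof -
      have "0 \<le> v i" if "i < M" for i
        unfolding v_def using d mixturesD(1) [OF w that] s
        by (intro divide_nonneg_nonneg has_integral_nonneg [OF I [OF that]]) auto
      moreover have "((\<lambda>\<tau>. \<Sum>i<M. w \<tau> i) has_integral (\<Sum>i<M. I i)) {s..s + d}"
        by (rule has_integral_sum) (auto intro: I)
      then have "((\<lambda>\<tau>. 1::real) has_integral (\<Sum>i<M. I i)) {s..s + d}"
        by (rule has_integral_eq [rotated]) (use mixturesD(3) [OF w] s in auto)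
      then have "(\<Sum>i<M. I i) = d"
        using has_integral_const_real [of 1 s "s + d"] d by (auto dest: has_integral_unique)
      then have "(\<Sum>i<M. v i) = 1"
        using d by (simp add: v_def sum_divide_distrib [symmetric])
      ultimately show ?thesis by (simp add: mixtures_def)
    qed
    have mix_I: "mix I y j = d * mix v y j" for y j
      using d by (simp add: mix_def v_def sum_distrib_left)
    have "\<bar>(x (s + d) j - x s j) - mix I (x s) j\<bar> \<le> Lip * (E * d) * d" if j: "j < n" for j
    proof -
      have "\<bar>(x (s + d) j - x s j) - mix I (x s) j\<bar> \<le> Lip * (E * d) * (s + d - s)"
      proof (rule integral_of_mix_near_frozen_state [where w = w and x = x])
        show "norm1 n (\<lambda>k. x \<tau> k - x s k) \<le> E * d" if "\<tau> \<in> {s..s + d}" for \<tau>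
        proof -
          have "0 \<le> E" using \<open>0 < B\<close> by (simp add: E_def)
          then have "E * (\<tau> - s) \<le> E * d" using that by (intro mult_left_mono) auto
          then show ?thesis using lip [of s \<tau>] s that by fastforce
        qed
      qed (use s d j w I inc in auto)
      then show ?thesis by simp
    qed
    then have "norm1 n (\<lambda>j. (x (s + d) j - x s j) - d * mix v (x s) j) \<le> (\<Sum>j<n. Lip * (E * d) * d)"
      unfolding norm1_def mix_I by (intro sum_mono) auto
    then have "\<kappa> * norm1 n (\<lambda>j. (x (s + d) j - x s j) - d * mix v (x s) j) \<le> \<kappa> * (\<Sum>j<n. Lip * (E * d) * d)"
      using \<kappa>(1) by (rule mult_left_mono)
    also have "\<dots> = \<kappa>' * d\<^sup>2" by (simp add: \<kappa>'_def power2_eq_square)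
    finally have "covered (\<kappa>' * d\<^sup>2) (\<lambda>j. (x (s + d) j - x s j) - d * mix v (x s) j)"
      using \<kappa>(2) covered_mono by blast
    moreover have "covered ((1 - d * rate) * b) (\<lambda>j. x s j + d * mix v (x s) j)"
      using d by (intro covered_euler_step b v) auto
    ultimately show ?thesis
      using covered_add [of "(1 - d * rate) * b" "\<lambda>j. x s j + d * mix v (x s) j" "\<kappa>' * d\<^sup>2"
          "\<lambda>j. (x (s + d) j - x s j) - d * mix v (x s) j"] by simp
  qed
  have a0: "0 \<le> a" using a norm1_nonneg order.trans unfolding covered_def by blast
  have "defect (x T) \<le> gain * (exp (- (rate * T)) * a + \<kappa>' * T\<^sup>2 / real (Suc N))"
    if N: "T / h \<le> real (Suc N)" for N
  proof (cases "T = 0")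
    case True
    then show ?thesis using defect_le_if_covered [OF a] by simp
  next
    case False
    define d where "d = T / real (Suc N)"
    have d: "0 < d" "d \<le> h" "real (Suc N) * d = T"
      using False T N h_pos by (simp_all add: d_def field_simps)
    have "d * rate \<le> h * rate" using d rate_pos by (intro mult_right_mono) auto
    also have "h * rate \<le> 1" using h_pos \<rho> by (simp add: rate_def)
    finally have dr: "0 \<le> 1 - d * rate" "1 - d * rate \<le> 1" using d rate_pos by auto
    have k2: "0 \<le> \<kappa>' * d\<^sup>2" using \<kappa>(1) \<open>0 < B\<close> by (simp add: \<kappa>'_def E_def)
    have "covered ((1 - d * rate) ^ k * a + real k * (\<kappa>' * d\<^sup>2)) (x (real k * d))" if "k \<le> Suc N" for k
      using that
    proof (induction k)
      case (Suc k)
      have eq: "real (Suc k) * d = real k * d + d" by (simp add: distrib_right)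
      have "real (Suc k) * d \<le> real (Suc N) * d"
        using Suc.prems d by (intro mult_right_mono) auto
      then have "covered ((1 - d * rate) * ((1 - d * rate) ^ k * a + real k * (\<kappa>' * d\<^sup>2)) + \<kappa>' * d\<^sup>2) (x (real (Suc k) * d))"
        unfolding eq using Suc d by (intro step) (auto simp: eq)
      moreover have "(1 - d * rate) * (real k * (\<kappa>' * d\<^sup>2)) \<le> 1 * (real k * (\<kappa>' * d\<^sup>2))"
        using dr k2 by (intro mult_right_mono) auto
      ultimately show ?case by (elim covered_mono) (simp add: algebra_simps)
    qed (simp add: a)
    from this [of "Suc N"] have "covered ((1 - d * rate) ^ Suc N * a + real (Suc N) * (\<kappa>' * d\<^sup>2)) (x T)"
      by (simp only: d(3) order.refl)
    moreover have "(1 - d * rate) ^ Suc N * a \<le> exp (- (rate * T)) * a"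
    proof (intro mult_right_mono a0)
      have "(1 - d * rate) ^ Suc N \<le> exp (- (d * rate)) ^ Suc N"
        using dr exp_ge_add_one_self [of "- (d * rate)"] by (intro power_mono) auto
      also have "\<dots> = exp (real (Suc N) * - (d * rate))" by (rule exp_of_nat_mult [symmetric])
      also have "real (Suc N) * - (d * rate) = - (rate * T)"
        unfolding d(3) [symmetric] by (simp add: mult_ac)
      finally show "(1 - d * rate) ^ Suc N \<le> exp (- (rate * T))" .
    qed
    moreover have "real (Suc N) * (\<kappa>' * d\<^sup>2) = \<kappa>' * T\<^sup>2 / real (Suc N)"
    proof -
      have "m * (\<kappa>' * (T / m)\<^sup>2) = \<kappa>' * T\<^sup>2 / m" if "m \<noteq> 0" for m :: real
        using that by (simp add: power2_eq_square field_simps)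
      then show ?thesis unfolding d_def by simp
    qed
    ultimately have "covered (exp (- (rate * T)) * a + \<kappa>' * T\<^sup>2 / real (Suc N)) (x T)"
      by (elim covered_mono) linarith
    then show ?thesis by (rule defect_le_if_covered)
  qed
  moreover obtain N0 :: nat where "T / h \<le> real N0" using real_arch_simple by blast
  ultimately have "\<exists>N0. \<forall>N\<ge>N0. defect (x T) \<le> gain * (exp (- (rate * T)) * a + \<kappa>' * T\<^sup>2 * inverse (real (Suc N)))"
    by (intro exI [of _ N0]) (auto simp: divide_inverse)
  moreover have "(\<lambda>N. gain * (exp (- (rate * T)) * a + \<kappa>' * T\<^sup>2 * inverse (real (Suc N))))
      \<longlonglongrightarrow> gain * (exp (- (rate * T)) * a + \<kappa>' * T\<^sup>2 * 0)"
    by (intro tendsto_intros LIMSEQ_inverse_real_of_nat)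
  ultimately have "defect (x T) \<le> gain * (exp (- (rate * T)) * a + \<kappa>' * T\<^sup>2 * 0)"
    by (intro LIMSEQ_le_const)
  then show ?thesis by (simp add: mult_ac)
qed

text \<open>
  As in discrete time, the speed is bounded by the exponentially decaying defect, so the solution has
  finite length.
\<close>

theorem continuous_solutions_converge:
  fixes w x :: "real \<Rightarrow> nat \<Rightarrow> real"
  assumes w: "\<And>t. 0 \<le> t \<Longrightarrow> w t \<in> mixtures"
    and meas: "\<And>i. i < M \<Longrightarrow> (\<lambda>t. w t i) \<in> borel_measurable (lebesgue_on {0..})"
    and cont: "\<And>j. j < n \<Longrightarrow> continuous_on {0..} (\<lambda>t. x t j)"
    and sol: "\<And>t j. 0 \<le> t \<Longrightarrow> j < n \<Longrightarrow> ((\<lambda>s. mix (w s) (x s) j) has_integral (x t j - x 0 j)) {0..t}"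
  shows "\<exists>y\<in>ker. \<forall>j<n. ((\<lambda>t. x t j) \<longlongrightarrow> y j) at_top"
proof -
  obtain a where a: "covered a (x 0)" by (rule covered_by_norm) (rule that)
  have q_le: "defect (x t) \<le> gain * a * exp (- (rate * t))" if "0 \<le> t" for t
    using covered_decays_along_solution [OF that w meas cont sol a] by blast
  define C where "C = gain * a / rate"
  have close: "\<bar>x t j - x s j\<bar> \<le> C * exp (- (rate * s))" if st: "0 \<le> s" "s \<le> t" and j: "j < n" for s t j
  proof -
    let ?f = "\<lambda>\<tau>. mix (w \<tau>) (x \<tau>) j" and ?g = "\<lambda>\<tau>. gain * a * exp (- (rate * \<tau>))"
    have f: "(?f has_integral (x t j - x s j)) {s..t}"
      by (rule has_integral_increment [where F = "\<lambda>t. x t j"])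
        (rule sol, assumption, rule j, rule st, rule st)
    have g: "(?g has_integral (- C * exp (- (rate * t)) - (- C * exp (- (rate * s))))) {s..t}"
      using rate_pos
      by (intro fundamental_theorem_of_calculus st)
        (auto simp: C_def has_real_derivative_iff_has_vector_derivative [symmetric] intro!: derivative_eq_intros)
    have "norm (integral {s..t} ?f) \<le> integral {s..t} ?g"
    proof (rule integral_norm_bound_integral [OF has_integral_integrable [OF f]])
      show "?g integrable_on {s..t}" using g by (rule has_integral_integrable)
      show "norm (?f \<tau>) \<le> ?g \<tau>" if "\<tau> \<in> {s..t}" for \<tau>
        using abs_le_norm1 [OF j, of "mix (w \<tau>) (x \<tau>)"] norm1_mix_le_defect [OF w, of \<tau> "x \<tau>"] q_le [of \<tau>] that st
        by auto
    qed
    also have "integral {s..t} ?g = - C * exp (- (rate * t)) - (- C * exp (- (rate * s)))"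
      using g by (rule integral_unique)
    also have "\<dots> \<le> C * exp (- (rate * s))"
    proof -
      have "defect (x 0) \<le> gain * a" using q_le [of 0] by simp
      then have "0 \<le> gain * a" using defect_nonneg [of "x 0"] by linarith
      then show ?thesis using rate_pos by (simp add: C_def)
    qed
    finally show ?thesis unfolding integral_unique [OF f] by simp
  qed
  have exp0: "((\<lambda>s. C * exp (- (rate * s))) \<longlongrightarrow> 0) at_top" for C
  proof -
    have "filterlim (\<lambda>s. rate * s) at_top at_top"
      using rate_pos by (intro filterlim_tendsto_pos_mult_at_top [OF tendsto_const]) (auto simp: filterlim_ident)
    then have "((\<lambda>s. exp (- (rate * s))) \<longlongrightarrow> 0) at_top"
      by (intro filterlim_compose [OF exp_at_bot]) (simp add: filterlim_uminus_at_bot)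
    then show ?thesis by (rule tendsto_mult_right_zero)
  qed
  have "\<exists>l. ((\<lambda>t. x t j) \<longlongrightarrow> l) at_top" if j: "j < n" for j
  proof -
    have "Cauchy (\<lambda>k. x (real k) j)"
    proof (rule CauchyI')
      fix e :: real assume "0 < e"
      have "(\<lambda>k. C * exp (- (rate * real k))) \<longlonglongrightarrow> 0"
        using filterlim_compose [OF exp0 filterlim_real_sequentially] .
      then obtain N where N: "\<And>k. N \<le> k \<Longrightarrow> C * exp (- (rate * real k)) < e"
        using order_tendstoD(2) [of _ 0 sequentially e] \<open>0 < e\<close> by (auto simp: eventually_sequentially)
      show "\<exists>N. \<forall>m\<ge>N. \<forall>k>m. dist (x (real m) j) (x (real k) j) < e"
      proof (intro exI allI impI)
        fix m k assume "N \<le> m" "m < k"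
        then show "dist (x (real m) j) (x (real k) j) < e"
          using close [of "real m" "real k" j] N [of m] j by (simp add: dist_real_def abs_minus_commute)
      qed
    qed
    then obtain l where l: "(\<lambda>k. x (real k) j) \<longlonglongrightarrow> l"
      using Cauchy_convergent_iff convergent_def by blast
    have "\<bar>l - x s j\<bar> \<le> C * exp (- (rate * s))" if s: "0 \<le> s" for s
    proof (rule LIMSEQ_le_const2)
      show "(\<lambda>k. \<bar>x (real k) j - x s j\<bar>) \<longlonglongrightarrow> \<bar>l - x s j\<bar>"
        by (intro tendsto_intros l)
      have "\<bar>x (real k) j - x s j\<bar> \<le> C * exp (- (rate * s))" if "nat \<lceil>s\<rceil> \<le> k" for k
        by (rule close) (use that s j in linarith)+
      then show "\<exists>N. \<forall>k\<ge>N. \<bar>x (real k) j - x s j\<bar> \<le> C * exp (- (rate * s))" by blast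
    qed
    then have "\<forall>\<^sub>F s in at_top. norm (x s j - l) \<le> C * exp (- (rate * s))"
      by (intro eventually_mono [OF eventually_ge_at_top [of 0]]) (simp add: abs_minus_commute)
    then have "((\<lambda>s. x s j - l) \<longlongrightarrow> 0) at_top"
      using exp0 by (rule Lim_null_comparison)
    then show ?thesis using Lim_null by blast
  qed
  then have "\<forall>j. \<exists>l. j < n \<longrightarrow> ((\<lambda>t. x t j) \<longlongrightarrow> l) at_top" by blast
  then obtain y where y: "\<forall>j. j < n \<longrightarrow> ((\<lambda>t. x t j) \<longlongrightarrow> y j) at_top"
    by (rule choice [THEN exE])
  have "((\<lambda>t. defect (x t)) \<longlongrightarrow> defect y) at_top"
    by (rule tendsto_defect) (simp add: y)
  moreover have "((\<lambda>t. defect (x t)) \<longlongrightarrow> 0) at_top"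
  proof (rule tendsto_sandwich [of "\<lambda>_. 0"])
    show "((\<lambda>t. gain * a * exp (- (rate * t))) \<longlongrightarrow> 0) at_top" by (rule exp0)
    show "\<forall>\<^sub>F t in at_top. defect (x t) \<le> gain * a * exp (- (rate * t))"
      using q_le by (intro eventually_mono [OF eventually_ge_at_top [of 0]])
  qed auto
  ultimately have "defect y = 0" by (intro tendsto_unique [of at_top]) auto
  then have "y \<in> ker" by (simp add: defect_eq_0_iff)
  then show ?thesis using y by (intro bexI [of _ y]) auto
qed

end

context generators begin

section \<open>Contraction yields a polyhedral certificate\<close>

text \<open>
  The head of the list is applied last, so that prepending a letter to a word is one further step.
\<close>

primrec euler_word :: "real \<Rightarrow> nat list \<Rightarrow> (nat \<Rightarrow> real) \<Rightarrow> nat \<Rightarrow> real" where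
  "euler_word h [] x = x"
| "euler_word h (i # us) x = (\<lambda>j. euler_word h us x j + h * G i (euler_word h us x) j)"

lemma euler_word_eq_euler:
  assumes "set us \<subseteq> {..<M}"
  shows "euler_word h us x = euler h (\<lambda>l i. if i = (rev us @ zs) ! l then 1 else 0) x (length us)"
  using assms
proof (induction us arbitrary: zs)
  case (Cons i us)
  let ?W = "\<lambda>l i'. if i' = (rev (i # us) @ zs) ! l then 1 else 0 :: real"
  have i: "i < M" using Cons.prems by simp
  have "rev (i # us) @ zs = rev us @ i # zs" by simp
  then have IH: "euler_word h us x = euler h ?W x (length us)"
    using Cons.IH [of "i # zs"] Cons.prems by (simp only: list.set insert_subset)
  have "?W (length us) = (\<lambda>i'. if i' = i then 1 else 0)"
    by (simp add: nth_append)
  then have "mix (?W (length us)) y j = G i y j" for y j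
    using mix_vertex [OF i, of y j] by (simp only:)
  then show ?case
    by (simp only: euler_word.simps length_Cons euler.simps IH)
qed simp

lemma contracting_euler_word:
  assumes c: "\<And>w x. (\<And>l. w l \<in> mixtures) \<Longrightarrow> defect (euler h w x N) \<le> \<epsilon> * defect x"
    and us: "set us \<subseteq> {..<M}" "length us = N" and "0 < N"
  shows "defect (euler_word h us x) \<le> \<epsilon> * defect x"
proof -
  define w where "w l = (\<lambda>i. if i = (if l < N then rev us ! l else hd us) then 1 else 0 :: real)" for l
  have w: "w l \<in> mixtures" for l
  proof -
    have "(if l < N then rev us ! l else hd us) \<in> set us"
    proof (cases "l < N")
      case True
      then show ?thesis using nth_mem [of l "rev us"] us(2) by simp
    next
      case False
      have "us \<noteq> []" using us(2) \<open>0 < N\<close> by auto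
      then show ?thesis using False by simp
    qed
    then show ?thesis unfolding w_def using us by (intro vertex_in_mixtures) auto
  qed
  have "defect (euler h w x N) \<le> \<epsilon> * defect x"
    by (rule c [of w]) (rule w)
  moreover have "euler_word h us x = euler h w x N"
  proof -
    have "euler h (\<lambda>l i. if i = (rev us @ []) ! l then 1 else 0) x N = euler h w x N"
      by (rule euler_cong) (simp add: w_def)
    moreover have "euler_word h us x = euler h (\<lambda>l i. if i = (rev us @ []) ! l then 1 else 0) x N"
      unfolding us(2) [symmetric] by (rule euler_word_eq_euler) (rule us(1))
    ultimately show ?thesis by (rule trans [rotated])
  qed
  ultimately show ?thesis by (simp only:)
qed

text \<open>
  Choose \<open>N\<close> such that words of length \<open>N\<close> bring every unit vector \<open>e j\<close>
  within distance 1/4 of the kernel, and \<open>\<gamma>\<close> with \<open>\<gamma>\<close> to the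
  power \<open>N\<close> equal to 1/2. The columns are the images of the unit vectors under all words
  shorter than \<open>N\<close>, divided by \<open>\<gamma>\<close> to the power of the word length. One further
  step turns a column into \<open>\<gamma>\<close> times another column, unless the word reaches length
  \<open>N\<close>; then the result is, modulo the kernel, a combination of unit vectors (the columns of the
  empty word) whose coefficients have absolute sum at most \<open>2 * \<gamma> / 4\<close>.
\<close>

theorem certificate_if_contracting:
  assumes h: "0 < h" and contr: "contracting h"
  obtains r :: nat and c :: "nat \<Rightarrow> nat \<Rightarrow> real" and p :: "nat \<Rightarrow> nat \<Rightarrow> nat \<Rightarrow> real" and \<rho> :: real
  where "0 \<le> \<rho>" "\<rho> < 1"
    "\<And>j. j < n \<Longrightarrow> \<exists>a<r. \<forall>k<n. c a k = (if k = j then 1 else 0)"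
    "\<And>i a. i < M \<Longrightarrow> a < r \<Longrightarrow> (\<lambda>j. G i (c a) j - (\<Sum>b<r. p i b a * c b j)) \<in> ker"
    "\<And>i a. i < M \<Longrightarrow> a < r \<Longrightarrow> norm1 r (\<lambda>b. (if b = a then 1 else 0) + h * p i b a) \<le> \<rho>"
proof -
  obtain K where K: "0 \<le> K" "\<And>x. \<exists>v\<in>ker. norm1 n (\<lambda>k. x k - v k) \<le> K * defect x"
    using distance_to_ker by blast
  define \<epsilon> where "\<epsilon> = 1 / (4 * (K * Lip + 1))"
  have "0 < \<epsilon>" using K(1) by (simp add: \<epsilon>_def add_nonneg_pos)
  have K\<epsilon>: "K * (\<epsilon> * Lip) \<le> 1 / 4"
  proof -
    have "K * (\<epsilon> * Lip) = 1 / 4 * (K * Lip / (K * Lip + 1))" by (simp add: \<epsilon>_def)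
    also have "\<dots> \<le> 1 / 4 * 1"
    proof (intro mult_left_mono)
      have "0 \<le> K * Lip" using K(1) by simp
      then show "K * Lip / (K * Lip + 1) \<le> 1" by (simp del: zero_le_mult_iff)
    qed simp
    finally show ?thesis by simp
  qed
  obtain N where N: "0 < N" and "\<forall>w x. (\<forall>l. w l \<in> mixtures) \<longrightarrow> defect (euler h w x N) \<le> \<epsilon> * defect x"
    using contr \<open>0 < \<epsilon>\<close> unfolding contracting_def by blast
  then have cN: "\<And>w x. (\<And>l. w l \<in> mixtures) \<Longrightarrow> defect (euler h w x N) \<le> \<epsilon> * defect x"
    by simp
  define \<gamma> where "\<gamma> = root N (1/2)"
  have \<gamma>: "0 < \<gamma>" "\<gamma> < 1" "\<gamma> ^ N = 1/2"
    using N by (simp_all add: \<gamma>_def real_root_lt_1_iff)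
  define e :: "nat \<Rightarrow> nat \<Rightarrow> real" where "e j k = (if k = j then 1 else 0)" for j k
  define S where "S = {us. set us \<subseteq> {..<M} \<and> length us < N}"
  have "finite S"
    by (rule finite_subset [OF _ finite_lists_length_le [of "{..<M}" N]]) (auto simp: S_def)
  define J where "J = S \<times> {..<n}"
  have "finite J" using \<open>finite S\<close> by (simp add: J_def)
  define col where "col a k = inverse \<gamma> ^ length (fst a) * euler_word h (fst a) (e (snd a)) k" for a k
  have near_ker: "\<exists>v\<in>ker. norm1 n (\<lambda>k. euler_word h us (e j) k - v k) \<le> 1 / 4"
    if "set us \<subseteq> {..<M}" "length us = N" "j < n" for us j
  proof -
    obtain v where v: "v \<in> ker" "norm1 n (\<lambda>k. euler_word h us (e j) k - v k) \<le> K * defect (euler_word h us (e j))"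
      using K(2) [of "euler_word h us (e j)"] by blast
    have "defect (euler_word h us (e j)) \<le> \<epsilon> * defect (e j)"
      by (rule contracting_euler_word [OF _ that(1,2) N]) (rule cN)
    also have "defect (e j) \<le> Lip"
      using defect_le_norm1 [of "e j"] that(3) by (simp add: norm1_def e_def if_distrib [where f = abs] cong: if_cong)
    finally have "defect (euler_word h us (e j)) \<le> \<epsilon> * Lip"
      using \<open>0 < \<epsilon>\<close> by (simp add: mult_left_mono)
    then have "K * defect (euler_word h us (e j)) \<le> K * (\<epsilon> * Lip)" using K(1) by (rule mult_left_mono)
    then show ?thesis using v K\<epsilon> by (intro bexI [of _ v]) linarith+
  qed
  have "\<forall>a. \<exists>v. set (fst a) \<subseteq> {..<M} \<and> length (fst a) = N \<and> snd a < n \<longrightarrow>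
      v \<in> ker \<and> norm1 n (\<lambda>k. euler_word h (fst a) (e (snd a)) k - v k) \<le> 1 / 4"
  proof
    fix a :: "nat list \<times> nat"
    show "\<exists>v. set (fst a) \<subseteq> {..<M} \<and> length (fst a) = N \<and> snd a < n \<longrightarrow>
      v \<in> ker \<and> norm1 n (\<lambda>k. euler_word h (fst a) (e (snd a)) k - v k) \<le> 1 / 4"
      using near_ker [of "fst a" "snd a"] by blast
  qed
  then obtain v where v: "\<forall>a. set (fst a) \<subseteq> {..<M} \<and> length (fst a) = N \<and> snd a < n \<longrightarrow>
      v a \<in> ker \<and> norm1 n (\<lambda>k. euler_word h (fst a) (e (snd a)) k - v a k) \<le> 1 / 4"
    by (rule choice [THEN exE])
  \<comment> \<open>coordinates of one step, applied to column a, in terms of the columns b\<close>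
  define P where "P i b a =
      (if Suc (length (fst a)) < N then (if b = (i # fst a, snd a) then \<gamma> else 0)
       else if fst b = [] then inverse \<gamma> ^ length (fst a) *
         (euler_word h (i # fst a) (e (snd a)) (snd b) - v (i # fst a, snd a) (snd b)) else 0)" for i b a
  have sum_empty_word: "(\<Sum>b\<in>J. if fst b = [] then f (snd b) else 0) = (\<Sum>l<n. f l)" for f :: "nat \<Rightarrow> real"
  proof -
    have "(\<Sum>b\<in>J. if fst b = [] then f (snd b) else 0) = (\<Sum>us\<in>S. \<Sum>l<n. if us = [] then f l else 0)"
      unfolding J_def sum.cartesian_product by (simp add: case_prod_unfold)
    also have "\<dots> = (\<Sum>us\<in>S. if us = [] then (\<Sum>l<n. f l) else 0)"
      by (intro sum.cong) auto
    also have "\<dots> = (\<Sum>l<n. f l)"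
      using \<open>finite S\<close> N by (simp add: sum.delta S_def)
    finally show ?thesis .
  qed
  define err where "err i a = (\<lambda>k. col a k + h * G i (col a) k - (\<Sum>b\<in>J. P i b a * col b k))" for i a
  have inv: "err i a \<in> ker"
    and colsum: "(\<Sum>b\<in>J. \<bar>P i b a\<bar>) \<le> \<gamma>" if i: "i < M" and a: "a \<in> J" for i a
  proof -
    obtain us j where a_eq: "a = (us, j)" and us: "set us \<subseteq> {..<M}" "length us < N" and j: "j < n"
      using a by (auto simp: J_def S_def)
    have adv: "col a k + h * G i (col a) k = inverse \<gamma> ^ length us * euler_word h (i # us) (e j) k" for k
    proof -
      have "col a = (\<lambda>k. inverse \<gamma> ^ length us * euler_word h us (e j) k)"
        by (simp add: a_eq col_def fun_eq_iff)
      then show ?thesis by (simp add: G_scale distrib_left)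
    qed
    have "err i a \<in> ker \<and> (\<Sum>b\<in>J. \<bar>P i b a\<bar>) \<le> \<gamma>"
    proof (cases "Suc (length us) < N")
      case True
      have mem: "(i # us, j) \<in> J" using True us i j by (auto simp: J_def S_def)
      have P: "P i b a = (if b = (i # us, j) then \<gamma> else 0)" for b
        using True by (simp add: P_def a_eq)
      have "(\<Sum>b\<in>J. P i b a * col b k) = \<gamma> * col (i # us, j) k" for k
        unfolding P using mem \<open>finite J\<close> by (simp add: if_distrib [where f = "\<lambda>c. c * _"] sum.delta cong: if_cong)
      moreover have "\<gamma> * col (i # us, j) k = col a k + h * G i (col a) k" for k
        unfolding adv using \<gamma> by (simp add: col_def)
      ultimately have "err i a = (\<lambda>k. 0)"
        by (auto simp: err_def)
      moreover have "(\<lambda>k. 0) \<in> ker" by (simp add: ker_def G_def)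
      moreover have "(\<Sum>b\<in>J. \<bar>P i b a\<bar>) = \<gamma>"
        unfolding P using mem \<open>finite J\<close> \<gamma> by (simp add: if_distrib [where f = abs] sum.delta cong: if_cong)
      ultimately show ?thesis by simp
    next
      case False
      then have len: "Suc (length us) = N" using us by simp
      let ?y = "euler_word h (i # us) (e j)" and ?v = "v (i # us, j)"
      have vk: "?v \<in> ker" and vn: "norm1 n (\<lambda>k. ?y k - ?v k) \<le> 1 / 4"
        using v [rule_format, of "(i # us, j)"] len us i j by auto
      define f where "f l = inverse \<gamma> ^ length us * (?y l - ?v l)" for l
      have P: "P i b a = (if fst b = [] then f (snd b) else 0)" for b
        using False by (simp add: P_def a_eq f_def)
      have eq: "col a k + h * G i (col a) k - (\<Sum>b\<in>J. P i b a * col b k) = inverse \<gamma> ^ length us * ?v k" if k: "k < n" for k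
      proof -
        have "(\<Sum>b\<in>J. P i b a * col b k) = (\<Sum>b\<in>J. if fst b = [] then f (snd b) * e (snd b) k else 0)"
          unfolding P by (intro sum.cong) (auto simp: col_def)
        also have "\<dots> = (\<Sum>l<n. f l * e l k)" by (rule sum_empty_word)
        also have "\<dots> = f k"
          using k by (simp add: e_def if_distrib [where f = "\<lambda>c. _ * c"] cong: if_cong)
        finally show ?thesis unfolding adv by (simp add: f_def right_diff_distrib)
      qed
      have "err i a \<in> ker"
        unfolding err_def by (rule ker_cong [THEN iffD2, OF _ ker_scale [OF vk]]) (rule eq)
      moreover have "(\<Sum>b\<in>J. \<bar>P i b a\<bar>) = (\<Sum>b\<in>J. if fst b = [] then \<bar>f (snd b)\<bar> else 0)"
        unfolding P by (intro sum.cong) auto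
      then have "(\<Sum>b\<in>J. \<bar>P i b a\<bar>) = norm1 n f"
        unfolding sum_empty_word [of "\<lambda>l. \<bar>f l\<bar>"] norm1_def .
      moreover have "norm1 n f \<le> \<gamma>"
      proof -
        have "norm1 n f = inverse \<gamma> ^ length us * norm1 n (\<lambda>k. ?y k - ?v k)"
          unfolding f_def norm1_scale using \<gamma> by simp
        also have "\<dots> \<le> inverse \<gamma> ^ length us * (1 / 4)"
          using vn \<gamma> by (intro mult_left_mono) auto
        also have "inverse \<gamma> ^ length us = 2 * \<gamma>"
        proof -
          have "\<gamma> ^ length us * \<gamma> = 1 / 2" using \<gamma>(3) len by (metis power_Suc2)
          then show ?thesis using \<gamma>(1) by (simp add: power_inverse field_simps)
        qed
        finally show ?thesis using \<gamma>(1) by simp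
      qed
      ultimately show ?thesis by simp
    qed
    then show "err i a \<in> ker" "(\<Sum>b\<in>J. \<bar>P i b a\<bar>) \<le> \<gamma>"
      by blast+
  qed
  define r where "r = card J"
  obtain f where f: "bij_betw f {..<r} J"
    using ex_bij_betw_nat_finite [OF \<open>finite J\<close>] by (auto simp: r_def atLeast0LessThan)
  have f_mem: "f a \<in> J" if "a < r" for a using f that by (auto simp: bij_betw_def)
  have f_eq: "f b = f a \<longleftrightarrow> b = a" if "a < r" "b < r" for a b
    using f that by (auto simp: bij_betw_def inj_on_def)
  \<comment> \<open>P represents the step I + h * G i, hence p represents G i\<close>
  define p where "p i b a = (P i (f b) (f a) - (if b = a then 1 else 0)) / h" for i b a
  show thesis
  proof (rule that [of \<gamma> r "\<lambda>a. col (f a)" p])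
    show "0 \<le> \<gamma>" "\<gamma> < 1" using \<gamma> by auto
    show "\<exists>a<r. \<forall>k<n. col (f a) k = (if k = j then 1 else 0)" if "j < n" for j
    proof -
      have "([], j) \<in> J" using that N by (simp add: J_def S_def)
      then obtain a where "a < r" "f a = ([], j)" using f by (auto simp: bij_betw_def)
      then show ?thesis by (intro exI [of _ a]) (simp add: col_def e_def)
    qed
    show "(\<lambda>j. G i (col (f a)) j - (\<Sum>b<r. p i b a * col (f b) j)) \<in> ker" if "i < M" "a < r" for i a
    proof -
      have "G i (col (f a)) k - (\<Sum>b<r. p i b a * col (f b) k)
          = 1 / h * err i (f a) k" for k
      proof -
        have "(\<Sum>b<r. p i b a * col (f b) k)
            = (\<Sum>b<r. (P i (f b) (f a) * col (f b) k - (if b = a then col (f a) k else 0)) / h)"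
          by (intro sum.cong) (auto simp: p_def left_diff_distrib)
        also have "\<dots> = ((\<Sum>b<r. P i (f b) (f a) * col (f b) k) - col (f a) k) / h"
          using that by (simp add: sum_divide_distrib [symmetric] sum_subtractf)
        also have "(\<Sum>b<r. P i (f b) (f a) * col (f b) k) = (\<Sum>b\<in>J. P i b (f a) * col b k)"
          by (rule sum.reindex_bij_betw [OF f])
        finally show ?thesis using h by (simp add: err_def field_simps)
      qed
      then show ?thesis using ker_scale [OF inv [OF that(1) f_mem [OF that(2)]], of "1 / h"] by simp
    qed
    show "norm1 r (\<lambda>b. (if b = a then 1 else 0) + h * p i b a) \<le> \<gamma>" if "i < M" "a < r" for i a
    proof -
      have "norm1 r (\<lambda>b. (if b = a then 1 else 0) + h * p i b a) = (\<Sum>b<r. \<bar>P i (f b) (f a)\<bar>)"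
        unfolding norm1_def using h by (intro sum.cong) (auto simp: p_def)
      also have "\<dots> = (\<Sum>b\<in>J. \<bar>P i b (f a)\<bar>)" by (rule sum.reindex_bij_betw [OF f])
      also have "\<dots> \<le> \<gamma>" by (rule colsum [OF that(1) f_mem [OF that(2)]])
      finally show ?thesis .
    qed
  qed
qed

end

section \<open>Row rank, matrix norm and Lozinski measure\<close>

text \<open>
  The rank is the dimension of the column span, and a maximal independent set of columns with
  \<open>n\<close> elements is a basis of the whole space.
\<close>

lemma full_row_rank_iff_surjective:
  assumes X: "X \<in> carrier_mat n nc"
  shows "full_row_rank n X \<longleftrightarrow> (\<forall>y\<in>carrier_vec n. \<exists>z\<in>carrier_vec nc. X *\<^sub>v z = y)"
proof -
  interpret vec_space "TYPE(real)" n .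
  have cols: "set (cols X) \<subseteq> carrier_vec n" using X cols_dim by blast
  have image: "span (set (cols X)) = {y \<in> carrier_vec n. \<exists>z\<in>carrier_vec nc. X *\<^sub>v z = y}"
    using col_space_eq [OF X] X by (simp add: col_space_def)
  have "rank X = n \<longleftrightarrow> span (set (cols X)) = carrier_vec n"
  proof
    assume r: "rank X = n"
    obtain S where S: "maximal S (\<lambda>T. T \<subseteq> set (cols X) \<and> lin_indpt T)"
      using maximal_exists_superset [of "set (cols X)" "\<lambda>T. T \<subseteq> set (cols X) \<and> lin_indpt T" "{}"]
      by (auto simp: lin_dep_def)
    then have S': "S \<subseteq> set (cols X)" "lin_indpt S" by (auto simp: maximal_def)
    have "card S = n" using rank_card_indpt [OF X S] r by simp
    then have "basis S"
      using S' cols dim_is_n by (intro dim_li_is_basis) (auto intro: finite_subset)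
    then have "span S = carrier_vec n" by (simp add: basis_def)
    then show "span (set (cols X)) = carrier_vec n"
      using span_is_monotone [OF S'(1)] span_is_subset2 [of "set (cols X)"] cols by auto
  next
    assume "span (set (cols X)) = carrier_vec n"
    then have "span_vs (set (cols X)) = V" by simp
    then show "rank X = n" unfolding rank_def using dim_is_n by (simp only:)
  qed
  then show ?thesis unfolding full_row_rank_def image by blast
qed

lemma vec_norm1_eq_norm1: "v \<in> carrier_vec n \<Longrightarrow> vec_norm1 v = norm1 n (\<lambda>i. v $ i)"
  by (simp add: vec_norm1_def norm1_def)

lemma vec_norm1_nonneg [simp]: "0 \<le> vec_norm1 v"
  by (simp add: vec_norm1_def sum_nonneg)

lemma vec_norm1_add_le:
  "dim_vec u = dim_vec v \<Longrightarrow> vec_norm1 (u + v) \<le> vec_norm1 u + vec_norm1 v"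
  using norm1_add_le [of "dim_vec v" "($) u" "($) v"] by (simp add: vec_norm1_def norm1_def)

lemma vec_norm1_smult: "vec_norm1 (c \<cdot>\<^sub>v v) = \<bar>c\<bar> * vec_norm1 v"
  by (simp add: vec_norm1_def abs_mult sum_distrib_left)

lemma vec_norm1_mult_le_column_sums:
  assumes P: "P \<in> carrier_mat s r" and v: "v \<in> carrier_vec r"
    and col: "\<And>a. a < r \<Longrightarrow> (\<Sum>b<s. \<bar>P $$ (b, a)\<bar>) \<le> \<rho>"
  shows "vec_norm1 (P *\<^sub>v v) \<le> \<rho> * vec_norm1 v"
proof -
  have "vec_norm1 (P *\<^sub>v v) = (\<Sum>b<s. \<bar>\<Sum>a<r. P $$ (b, a) * v $ a\<bar>)"
    using P v by (simp add: vec_norm1_def scalar_prod_def atLeast0LessThan)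
  also have "\<dots> \<le> (\<Sum>b<s. \<Sum>a<r. \<bar>P $$ (b, a)\<bar> * \<bar>v $ a\<bar>)"
    by (intro sum_mono order.trans [OF sum_abs]) (simp add: abs_mult)
  also have "\<dots> = (\<Sum>a<r. (\<Sum>b<s. \<bar>P $$ (b, a)\<bar>) * \<bar>v $ a\<bar>)"
    unfolding sum_distrib_right by (rule sum.swap)
  also have "\<dots> \<le> (\<Sum>a<r. \<rho> * \<bar>v $ a\<bar>)"
    using col by (intro sum_mono mult_right_mono) auto
  also have "\<dots> = \<rho> * vec_norm1 v"
    using v by (simp add: vec_norm1_def sum_distrib_left)
  finally show ?thesis .
qed

lemma mat_norm1_le_if_column_sums:
  assumes P: "P \<in> carrier_mat s r" and "0 \<le> \<rho>"
    and col: "\<And>a. a < r \<Longrightarrow> (\<Sum>b<s. \<bar>P $$ (b, a)\<bar>) \<le> \<rho>"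
  shows "mat_norm1 P \<le> \<rho>"
  unfolding mat_norm1_def
proof (rule cSUP_least)
  have "0\<^sub>v r \<in> {v \<in> carrier_vec (dim_col P). vec_norm1 v \<le> 1}"
    using P by (simp add: vec_norm1_def)
  then show "{v \<in> carrier_vec (dim_col P). vec_norm1 v \<le> 1} \<noteq> {}" by blast
  fix v assume "v \<in> {v \<in> carrier_vec (dim_col P). vec_norm1 v \<le> 1}"
  then have v: "v \<in> carrier_vec r" "vec_norm1 v \<le> 1" using P by auto
  have "vec_norm1 (P *\<^sub>v v) \<le> \<rho> * vec_norm1 v"
    by (rule vec_norm1_mult_le_column_sums [OF P v(1) col])
  also have "\<dots> \<le> \<rho>" using v \<open>0 \<le> \<rho>\<close> by (simp add: mult_left_le)
  finally show "vec_norm1 (P *\<^sub>v v) \<le> \<rho>" .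
qed

lemma bdd_above_mat_norm1:
  "bdd_above ((\<lambda>v. vec_norm1 (P *\<^sub>v v)) ` {v \<in> carrier_vec (dim_col P). vec_norm1 v \<le> 1})"
proof (rule bdd_aboveI2)
  let ?C = "\<Sum>a<dim_col P. \<Sum>b<dim_row P. \<bar>P $$ (b, a)\<bar>"
  have C: "(\<Sum>b<dim_row P. \<bar>P $$ (b, a)\<bar>) \<le> ?C" if "a < dim_col P" for a
    using that by (intro member_le_sum [of a _ "\<lambda>a. \<Sum>b<dim_row P. \<bar>P $$ (b, a)\<bar>"] sum_nonneg) auto
  fix v assume "v \<in> {v \<in> carrier_vec (dim_col P). vec_norm1 v \<le> 1}"
  then have v: "v \<in> carrier_vec (dim_col P)" "vec_norm1 v \<le> 1" by auto
  have "vec_norm1 (P *\<^sub>v v) \<le> ?C * vec_norm1 v"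
    by (rule vec_norm1_mult_le_column_sums [OF _ v(1) C]) auto
  also have "\<dots> \<le> ?C" using v by (intro mult_left_le sum_nonneg) auto
  finally show "vec_norm1 (P *\<^sub>v v) \<le> ?C" .
qed

lemma vec_norm1_mult_le_mat_norm1:
  assumes "v \<in> carrier_vec (dim_col P)" "vec_norm1 v \<le> 1"
  shows "vec_norm1 (P *\<^sub>v v) \<le> mat_norm1 P"
  unfolding mat_norm1_def using assms by (intro cSUP_upper bdd_above_mat_norm1) auto

lemma mat_norm1_nonneg: "0 \<le> mat_norm1 P"
proof -
  have "vec_norm1 (P *\<^sub>v 0\<^sub>v (dim_col P)) \<le> mat_norm1 P"
    by (rule vec_norm1_mult_le_mat_norm1) (auto simp: vec_norm1_def)
  then show ?thesis using vec_norm1_nonneg [of "P *\<^sub>v 0\<^sub>v (dim_col P)"] by linarith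
qed

lemma vec_norm1_mult_le:
  assumes P: "P \<in> carrier_mat s r" and v: "v \<in> carrier_vec r"
  shows "vec_norm1 (P *\<^sub>v v) \<le> mat_norm1 P * vec_norm1 v"
proof (cases "vec_norm1 v = 0")
  case True
  then have "v = 0\<^sub>v r"
    using v by (intro eq_vecI) (auto simp: vec_norm1_def sum_nonneg_eq_0_iff)
  then have "P *\<^sub>v v = 0\<^sub>v s" using P by (intro eq_vecI) (auto simp: scalar_prod_def)
  then show ?thesis using True by (simp add: vec_norm1_def)
next
  case False
  define u where "u = inverse (vec_norm1 v) \<cdot>\<^sub>v v"
  have pos: "0 < vec_norm1 v" using False vec_norm1_nonneg [of v] by linarith
  have "vec_norm1 (P *\<^sub>v u) \<le> mat_norm1 P"
    using P v pos by (intro vec_norm1_mult_le_mat_norm1) (auto simp: u_def vec_norm1_smult)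
  moreover have "P *\<^sub>v u = inverse (vec_norm1 v) \<cdot>\<^sub>v (P *\<^sub>v v)"
    unfolding u_def by (rule mult_mat_vec [OF P v])
  ultimately show ?thesis using pos by (simp add: vec_norm1_smult field_simps)
qed

text \<open>
  The left matrix is the convex combination of \<open>I\<close> and the right matrix with weight
  \<open>h / k\<close> on the latter.
\<close>

lemma mat_norm1_euler_step_convex:
  assumes P: "P \<in> carrier_mat r r" and hk: "0 < h" "h \<le> k"
  shows "mat_norm1 (1\<^sub>m r + h \<cdot>\<^sub>m P) \<le> (1 - h / k) + h / k * mat_norm1 (1\<^sub>m r + k \<cdot>\<^sub>m P)"
  unfolding mat_norm1_def [of "1\<^sub>m r + h \<cdot>\<^sub>m P"]
proof (rule cSUP_least)
  let ?U = "{v \<in> carrier_vec (dim_col (1\<^sub>m r + h \<cdot>\<^sub>m P)). vec_norm1 v \<le> 1}"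
  have "0\<^sub>v r \<in> ?U" using P by (simp add: vec_norm1_def)
  then show "?U \<noteq> {}" by blast
  fix v assume "v \<in> ?U"
  then have v: "v \<in> carrier_vec r" "vec_norm1 v \<le> 1" using P by auto
  have s: "0 \<le> h / k" "0 \<le> 1 - h / k" using hk by auto
  have "(1\<^sub>m r + h \<cdot>\<^sub>m P) *\<^sub>v v = (1 - h / k) \<cdot>\<^sub>v v + (h / k) \<cdot>\<^sub>v ((1\<^sub>m r + k \<cdot>\<^sub>m P) *\<^sub>v v)"
  proof -
    have e: "(1\<^sub>m r + c \<cdot>\<^sub>m P) *\<^sub>v v = v + c \<cdot>\<^sub>v (P *\<^sub>v v)" for c
    proof -
      have "(1\<^sub>m r + c \<cdot>\<^sub>m P) *\<^sub>v v = 1\<^sub>m r *\<^sub>v v + (c \<cdot>\<^sub>m P) *\<^sub>v v"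
        using P v(1) by (intro add_mult_distrib_mat_vec) auto
      moreover have "(c \<cdot>\<^sub>m P) *\<^sub>v v = c \<cdot>\<^sub>v (P *\<^sub>v v)"
        using P v(1) by (intro eq_vecI) (auto simp: scalar_prod_def sum_distrib_left mult.assoc)
      ultimately show ?thesis using v(1) by simp
    qed
    show ?thesis
      unfolding e using hk P v(1) by (intro eq_vecI) (auto simp: field_simps)
  qed
  then have "vec_norm1 ((1\<^sub>m r + h \<cdot>\<^sub>m P) *\<^sub>v v)
      \<le> (1 - h / k) * vec_norm1 v + h / k * vec_norm1 ((1\<^sub>m r + k \<cdot>\<^sub>m P) *\<^sub>v v)"
    using vec_norm1_add_le [of "(1 - h / k) \<cdot>\<^sub>v v" "(h / k) \<cdot>\<^sub>v ((1\<^sub>m r + k \<cdot>\<^sub>m P) *\<^sub>v v)"] s v(1) P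
    by (simp only: vec_norm1_smult abs_of_nonneg) simp
  also have "\<dots> \<le> (1 - h / k) * 1 + h / k * mat_norm1 (1\<^sub>m r + k \<cdot>\<^sub>m P)"
    using s v P by (intro add_mono mult_left_mono vec_norm1_mult_le_mat_norm1) auto
  finally show "vec_norm1 ((1\<^sub>m r + h \<cdot>\<^sub>m P) *\<^sub>v v) \<le> (1 - h / k) + h / k * mat_norm1 (1\<^sub>m r + k \<cdot>\<^sub>m P)"
    by simp
qed

text \<open>
  By convexity the difference quotient is nondecreasing in \<open>h\<close>, so its limit at zero is its
  infimum over all positive \<open>h\<close>. The infimum is taken in the extended reals, which covers the
  empty matrix.
\<close>

lemma lozinski1_neg_iff:
  assumes P: "P \<in> carrier_mat r r"
  shows "lozinski1 P < 0 \<longleftrightarrow> (\<exists>h>0. mat_norm1 (1\<^sub>m r + h \<cdot>\<^sub>m P) < 1)"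
proof -
  define f where "f h = (mat_norm1 (1\<^sub>m r + h \<cdot>\<^sub>m P) - 1) / h" for h
  have mono: "f h \<le> f k" if "0 < h" "h \<le> k" for h k
  proof -
    have "mat_norm1 (1\<^sub>m r + h \<cdot>\<^sub>m P) - 1 \<le> f k * h"
    proof -
      have "f k * h = h / k * mat_norm1 (1\<^sub>m r + k \<cdot>\<^sub>m P) - h / k"
        by (simp add: f_def diff_divide_distrib right_diff_distrib mult.commute)
      then show ?thesis using mat_norm1_euler_step_convex [OF P that] by linarith
    qed
    then show ?thesis unfolding f_def [of h] using that(1) by (simp add: pos_divide_le_eq)
  qed
  define I where "I = (INF h\<in>{0<..}. ereal (f h))"
  have "((\<lambda>h. ereal (f h)) \<longlongrightarrow> I) (at_right 0)"
  proof (rule order_tendstoI)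
    fix a assume "a < I"
    moreover have "I \<le> ereal (f h)" if "0 < h" for h
      unfolding I_def using that by (intro INF_lower) simp
    ultimately have "a < ereal (f h)" if "0 < h" for h
      using that less_le_trans by blast
    then show "\<forall>\<^sub>F h in at_right 0. a < ereal (f h)"
      unfolding eventually_at_right_field by (intro exI [of _ 1]) auto
  next
    fix a assume "I < a"
    then obtain k where k: "0 < k" "ereal (f k) < a"
      unfolding I_def INF_less_iff by auto
    have "ereal (f h) < a" if "0 < h" "h < k" for h
    proof -
      have "ereal (f h) \<le> ereal (f k)" using mono [of h k] that by simp
      then show ?thesis using k(2) by (rule le_less_trans)
    qed
    then show "\<forall>\<^sub>F h in at_right 0. ereal (f h) < a"
      unfolding eventually_at_right_field using k by (intro exI [of _ k]) auto
  qed
  then have "lozinski1 P = I"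
    unfolding lozinski1_def using P by (intro tendsto_Lim) (auto simp: f_def)
  then have "lozinski1 P < 0 \<longleftrightarrow> (\<exists>h>0. f h < 0)"
    unfolding I_def by (auto simp: INF_less_iff)
  then show ?thesis by (simp add: f_def divide_less_0_iff cong: conj_cong)
qed

section \<open>Certificates as matrices\<close>

lemma vec_eq_0_iff: "u \<in> carrier_vec n \<Longrightarrow> u = 0\<^sub>v n \<longleftrightarrow> (\<forall>j<n. u $ j = 0)"
  by (auto intro!: eq_vecI)

lemma sum_lessThan_add: "(\<Sum>b<r + m. f b) = (\<Sum>b<r. f b) + (\<Sum>b<m. f (r + b))"
  for f :: "nat \<Rightarrow> 'a::comm_monoid_add"
  by (induction m) (auto simp: add.assoc)

abbreviation entries :: "(nat \<Rightarrow> real mat) \<Rightarrow> nat \<Rightarrow> nat \<Rightarrow> nat \<Rightarrow> real" where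
  "entries A i j k \<equiv> A i $$ (j, k)"

lemma G_entries:
  assumes "A i \<in> carrier_mat n n" "v \<in> carrier_vec n" "j < n"
  shows "generators.G n (entries A) i (($) v) j = (A i *\<^sub>v v) $ j"
  using assms by (simp add: generators.G_def scalar_prod_def atLeast0LessThan)

lemma mem_ker_entries_iff:
  assumes A: "\<And>i. i < M \<Longrightarrow> A i \<in> carrier_mat n n" and M: "0 < M" and v: "v \<in> carrier_vec n"
  shows "($) v \<in> generators.ker n M (entries A) \<longleftrightarrow> v \<in> (\<Inter>i<M. mat_kernel (A i))"
proof -
  have "v \<in> mat_kernel (A i) \<longleftrightarrow> (\<forall>j<n. generators.G n (entries A) i (($) v) j = 0)" if "i < M" for i
  proof -
    have "A i *\<^sub>v v \<in> carrier_vec n" by (rule mult_mat_vec_carrier [OF A [OF that] v])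
    then show ?thesis using v
      by (simp add: mat_kernel [OF A [OF that]] G_entries [of A i n v, OF A [OF that] v] vec_eq_0_iff del: index_mult_mat_vec)
  qed
  then show ?thesis by (auto simp: generators.ker_def)
qed

text \<open>
  Stacking the matrices turns the intersection of the kernels into the kernel of a single matrix.
\<close>

lemma common_kernel_basis:
  fixes A :: "nat \<Rightarrow> real mat" and M n :: nat
  assumes A: "\<And>i. i < M \<Longrightarrow> A i \<in> carrier_mat n n" and M: "0 < M"
  obtains d where "\<And>b. b < subspace_dim n (\<Inter>i<M. mat_kernel (A i)) \<Longrightarrow> d b \<in> (\<Inter>i<M. mat_kernel (A i))"
    and "\<And>v. v \<in> (\<Inter>i<M. mat_kernel (A i)) \<Longrightarrow>
      \<exists>s. \<forall>j<n. v $ j = (\<Sum>b<subspace_dim n (\<Inter>i<M. mat_kernel (A i)). s b * d b $ j)"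
proof -
  define S where "S = mat (M * n) n (\<lambda>(a, k). A (a div n) $$ (a mod n, k))"
  have S: "S \<in> carrier_mat (M * n) n" by (simp add: S_def)
  have kernel_eq: "mat_kernel S = (\<Inter>i<M. mat_kernel (A i))"
  proof (rule Set.set_eqI)
    fix v
    show "v \<in> mat_kernel S \<longleftrightarrow> v \<in> (\<Inter>i<M. mat_kernel (A i))"
    proof (cases "v \<in> carrier_vec n")
      case v: True
      have idx: "i * n + j < M * n" if "i < M" "j < n" for i j
      proof -
        have "Suc i * n \<le> M * n" using that(1) by (intro mult_right_mono) auto
        then show ?thesis using that(2) by simp
      qed
      have row: "(S *\<^sub>v v) $ (i * n + j) = (A i *\<^sub>v v) $ j" if "i < M" "j < n" for i j
        using idx [OF that] that v A [OF that(1)] by (simp add: S_def scalar_prod_def)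
      have "S *\<^sub>v v = 0\<^sub>v (M * n) \<longleftrightarrow> (\<forall>i<M. \<forall>j<n. (S *\<^sub>v v) $ (i * n + j) = 0)"
      proof
        assume z: "S *\<^sub>v v = 0\<^sub>v (M * n)"
        show "\<forall>i<M. \<forall>j<n. (S *\<^sub>v v) $ (i * n + j) = 0"
          unfolding z using idx by simp
      next
        assume z: "\<forall>i<M. \<forall>j<n. (S *\<^sub>v v) $ (i * n + j) = 0"
        show "S *\<^sub>v v = 0\<^sub>v (M * n)"
        proof (rule eq_vecI)
          fix a assume "a < dim_vec (0\<^sub>v (M * n) :: real vec)"
          then have a: "a < M * n" by simp
          then have "0 < n" by (cases n) auto
          then have "a div n < M" "a mod n < n" using a by (simp_all add: less_mult_imp_div_less)
          then have "(S *\<^sub>v v) $ (a div n * n + a mod n) = 0" using z by blast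
          then show "(S *\<^sub>v v) $ a = 0\<^sub>v (M * n) $ a" using a by simp
        qed (simp add: S_def)
      qed
      also have "\<dots> \<longleftrightarrow> (\<forall>i<M. A i *\<^sub>v v = 0\<^sub>v n)"
      proof -
        have "A i *\<^sub>v v = 0\<^sub>v n \<longleftrightarrow> (\<forall>j<n. (S *\<^sub>v v) $ (i * n + j) = 0)" if "i < M" for i
          using vec_eq_0_iff [OF mult_mat_vec_carrier [OF A [OF that] v]] row [OF that] by simp
        then show ?thesis by blast
      qed
      finally have "S *\<^sub>v v = 0\<^sub>v (M * n) \<longleftrightarrow> (\<forall>i<M. A i *\<^sub>v v = 0\<^sub>v n)" .
      moreover have "v \<in> mat_kernel (A i) \<longleftrightarrow> A i *\<^sub>v v = 0\<^sub>v n" if "i < M" for i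
        using v mat_kernel [OF A [OF that]] by blast
      ultimately show ?thesis using v mat_kernel [OF S] by auto
    next
      case False
      then have "v \<notin> mat_kernel (A 0)" using mat_kernel [OF A [OF M]] by blast
      then show ?thesis using False M mat_kernel [OF S] by blast
    qed
  qed
  interpret kernel "M * n" n S by unfold_locales (rule S)
  obtain B where B: "finite B" "basis B"
    using kernel_basis_exists [OF S] by blast
  have dim: "subspace_dim n (mat_kernel S) = card B"
    using Ker.dim_basis [OF B] by (simp add: subspace_dim_def)
  have BV: "B \<subseteq> mat_kernel S" and span: "span B = mat_kernel S"
    using B(2) by (auto simp: Ker.basis_def)
  obtain f where f: "bij_betw f {..<card B} B"
    using ex_bij_betw_nat_finite [OF B(1)] by (auto simp: atLeast0LessThan)
  have f_mem: "f b \<in> mat_kernel S" if "b < card B" for b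
    using bij_betwE [OF f] BV that by blast
  have f_span: "\<exists>s. \<forall>j<n. v $ j = (\<Sum>b<card B. s b * f b $ j)" if v: "v \<in> mat_kernel S" for v
  proof -
    have "v \<in> span B" using v span by simp
    then have "\<exists>a. v = lincomb a B"
      unfolding Ker.finite_span [OF B(1) BV] by (rule CollectE) (elim exE conjE, rule exI)
    then obtain a where a: "v = lincomb a B" by (rule exE)
    have "v $ j = (\<Sum>b<card B. a (f b) * f b $ j)" if "j < n" for j
      using lincomb_index [OF that BV, of a] sum.reindex_bij_betw [OF f, of "\<lambda>x. a x * x $ j"]
      by (simp only: a)
    then show ?thesis by (intro exI [of _ "\<lambda>b. a (f b)"]) simp
  qed
  show thesis
    by (rule that [of f, folded kernel_eq, unfolded dim]) (erule f_mem, erule f_span)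
qed

text \<open>
  The common form of both certificates. In discrete time \<open>h\<close> is one, the generators are
  \<open>A i - I\<close>, and \<open>I + Q i\<close> is the asymptotically stable block; in continuous time the
  generators are \<open>A i\<close>, and the size of \<open>h\<close> is free.
\<close>

definition matrix_certificate :: "nat \<Rightarrow> nat \<Rightarrow> nat \<Rightarrow> (nat \<Rightarrow> real mat) \<Rightarrow> real \<Rightarrow> bool" where
  "matrix_certificate n M m A h \<longleftrightarrow>
     (\<exists>r X Q R. X \<in> carrier_mat n (r + m) \<and> full_row_rank n X \<and>
        (\<forall>i<M. Q i \<in> carrier_mat r r \<and> R i \<in> carrier_mat m r \<and>
           mat_norm1 (1\<^sub>m r + h \<cdot>\<^sub>m Q i) < 1 \<and>
           A i * X = X * four_block_mat (Q i) (0\<^sub>m r m) (R i) (0\<^sub>m m m)))"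

lemma index_mult_lower_block:
  fixes X Q R :: "real mat"
  assumes X: "X \<in> carrier_mat n (r + m)" and Q: "Q \<in> carrier_mat r r" and R: "R \<in> carrier_mat m r"
    and "j < n" "a < r + m"
  shows "(X * four_block_mat Q (0\<^sub>m r m) R (0\<^sub>m m m)) $$ (j, a)
    = (if a < r then (\<Sum>b<r. Q $$ (b, a) * X $$ (j, b)) + (\<Sum>b<m. R $$ (b, a) * X $$ (j, r + b)) else 0)"
proof -
  let ?F = "four_block_mat Q (0\<^sub>m r m) R (0\<^sub>m m m)"
  have "(X * ?F) $$ (j, a) = (\<Sum>b<r + m. X $$ (j, b) * ?F $$ (b, a))"
    using assms by (simp add: scalar_prod_def atLeast0LessThan)
  also have "\<dots> = (\<Sum>b<r. X $$ (j, b) * ?F $$ (b, a)) + (\<Sum>b<m. X $$ (j, r + b) * ?F $$ (r + b, a))"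
    by (simp add: sum_lessThan_add)
  also have "\<dots> = (if a < r then (\<Sum>b<r. Q $$ (b, a) * X $$ (j, b)) + (\<Sum>b<m. R $$ (b, a) * X $$ (j, r + b)) else 0)"
  proof (cases "a < r")
    case True
    then show ?thesis
      using assms by (simp, intro arg_cong2 [where f = "(+)"] sum.cong refl) (simp_all add: mult.commute)
  next
    case False
    then show ?thesis using assms by simp
  qed
  finally show ?thesis .
qed

text \<open>
  The last \<open>m\<close> columns of the block matrix vanish, so the last \<open>m\<close> columns of
  \<open>X\<close> lie in the kernel. Since \<open>X\<close> is surjective, its first \<open>r\<close> columns span
  the space modulo the kernel.
\<close>

theorem polyhedral_certificate_if_matrix_certificate:
  assumes A: "\<And>i. i < M \<Longrightarrow> A i \<in> carrier_mat n n" and M: "0 < M" and h: "0 < h"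
    and cert: "matrix_certificate n M m A h"
  obtains \<rho> r c p where "polyhedral_certificate n M (entries A) h \<rho> r c p"
proof -
  interpret generators n M "entries A" .
  obtain r X Q R where X: "X \<in> carrier_mat n (r + m)" "full_row_rank n X"
    and Q: "\<And>i. i < M \<Longrightarrow> Q i \<in> carrier_mat r r" and R: "\<And>i. i < M \<Longrightarrow> R i \<in> carrier_mat m r"
    and norm: "\<And>i. i < M \<Longrightarrow> mat_norm1 (1\<^sub>m r + h \<cdot>\<^sub>m Q i) < 1"
    and AX: "\<And>i. i < M \<Longrightarrow> A i * X = X * four_block_mat (Q i) (0\<^sub>m r m) (R i) (0\<^sub>m m m)"
    using cert unfolding matrix_certificate_def by blast
  define c where "c a j = X $$ (j, a)" for a j
  have Gc: "G i (c a) j = (if a < r then (\<Sum>b<r. Q i $$ (b, a) * c b j) + (\<Sum>b<m. R i $$ (b, a) * c (r + b) j) else 0)"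
    if "i < M" "a < r + m" "j < n" for i a j
  proof -
    have "G i (c a) j = (A i * X) $$ (j, a)"
      using A [OF that(1)] X(1) that by (simp add: G_def c_def scalar_prod_def atLeast0LessThan)
    then show ?thesis
      unfolding AX [OF that(1)] index_mult_lower_block [OF X(1) Q [OF that(1)] R [OF that(1)] that(3,2)]
      by (simp add: c_def)
  qed
  have c_ker: "c (r + b) \<in> ker" if "b < m" for b
    using that Gc by (auto simp: ker_def)
  define \<rho> where "\<rho> = Max ((\<lambda>i. mat_norm1 (1\<^sub>m r + h \<cdot>\<^sub>m Q i)) ` {..<M})"
  have \<rho>_ge: "mat_norm1 (1\<^sub>m r + h \<cdot>\<^sub>m Q i) \<le> \<rho>" if "i < M" for i
    unfolding \<rho>_def using that by (intro Max_ge) auto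
  have "polyhedral_certificate n M (entries A) h \<rho> r c (\<lambda>i b a. Q i $$ (b, a))"
  proof
    show "0 < h" by (fact h)
    show "0 \<le> \<rho>" using \<rho>_ge [OF M] mat_norm1_nonneg by (rule order.trans [rotated])
    show "\<rho> < 1" unfolding \<rho>_def using M norm by (subst Max_less_iff) auto
    show "\<exists>u. (\<lambda>j. x j - (\<Sum>a<r. u a * c a j)) \<in> ker" for x
    proof -
      obtain z where z: "z \<in> carrier_vec (r + m)" "X *\<^sub>v z = vec n x"
        using full_row_rank_iff_surjective [OF X(1), THEN iffD1, OF X(2), THEN bspec, of "vec n x"] by auto
      have "x j - (\<Sum>a<r. z $ a * c a j) = (\<Sum>b<m. z $ (r + b) * c (r + b) j)" if "j < n" for j
      proof -
        have "x j = (X *\<^sub>v z) $ j" using that by (simp add: z(2))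
        also have "\<dots> = (\<Sum>a<r + m. X $$ (j, a) * z $ a)"
          using X(1) z(1) that by (simp add: scalar_prod_def atLeast0LessThan)
        also have "\<dots> = (\<Sum>a<r. z $ a * c a j) + (\<Sum>b<m. z $ (r + b) * c (r + b) j)"
          by (simp add: sum_lessThan_add c_def mult.commute)
        finally show ?thesis by simp
      qed
      moreover have "(\<lambda>j. \<Sum>b<m. z $ (r + b) * c (r + b) j) \<in> ker"
        by (rule ker_sum) (rule ker_scale, rule c_ker, simp)
      ultimately have "(\<lambda>j. x j - (\<Sum>a<r. z $ a * c a j)) \<in> ker"
        by (rule ker_cong [THEN iffD2])
      then show ?thesis by (intro exI [of _ "($) z"])
    qed
    show "(\<lambda>j. G i (c a) j - (\<Sum>b<r. Q i $$ (b, a) * c b j)) \<in> ker" if "i < M" "a < r" for i a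
    proof (rule ker_cong [THEN iffD2])
      show "G i (c a) j - (\<Sum>b<r. Q i $$ (b, a) * c b j) = (\<Sum>b<m. R i $$ (b, a) * c (r + b) j)" if "j < n" for j
        using Gc [of i a j] \<open>i < M\<close> \<open>a < r\<close> that by simp
      show "(\<lambda>j. \<Sum>b<m. R i $$ (b, a) * c (r + b) j) \<in> ker"
        by (rule ker_sum) (rule ker_scale, rule c_ker, simp)
    qed
    show "norm1 r (\<lambda>b. u b + h * (\<Sum>a<r. Q i $$ (b, a) * u a)) \<le> \<rho> * norm1 r u" if i: "i < M" for i u
    proof -
      let ?P = "1\<^sub>m r + h \<cdot>\<^sub>m Q i"
      have P: "?P \<in> carrier_mat r r" using Q [OF i] by simp
      have "(?P *\<^sub>v vec r u) $ b = u b + h * (\<Sum>a<r. Q i $$ (b, a) * u a)" if "b < r" for b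
      proof -
        have "(?P *\<^sub>v vec r u) $ b = (\<Sum>a<r. ((if b = a then 1 else 0) + h * Q i $$ (b, a)) * u a)"
          using that Q [OF i] by (auto simp: scalar_prod_def atLeast0LessThan intro!: sum.cong)
        also have "\<dots> = u b + h * (\<Sum>a<r. Q i $$ (b, a) * u a)"
          using that by (simp add: distrib_right sum.distrib sum_distrib_left mult.assoc
              if_distrib [where f = "\<lambda>c. c * _"] cong: if_cong)
        finally show ?thesis .
      qed
      then have "norm1 r (\<lambda>b. u b + h * (\<Sum>a<r. Q i $$ (b, a) * u a)) = vec_norm1 (?P *\<^sub>v vec r u)"
        using P by (subst vec_norm1_eq_norm1 [of _ r]) (auto intro!: norm1_cong)
      also have "\<dots> \<le> mat_norm1 ?P * vec_norm1 (vec r u)"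
        by (rule vec_norm1_mult_le [OF P]) simp
      also have "\<dots> \<le> \<rho> * vec_norm1 (vec r u)"
        using \<rho>_ge [OF i] by (intro mult_right_mono) auto
      also have "vec_norm1 (vec r u) = norm1 r u"
        by (simp add: vec_norm1_def norm1_def)
      finally show ?thesis .
    qed
  qed
  then show thesis by (rule that)
qed

text \<open>
  The columns obtained from contraction are invariant only modulo the kernel. A basis of the kernel,
  appended as the last columns, turns the kernel parts into the lower left block.
\<close>

theorem matrix_certificate_if_contracting:
  assumes A: "\<And>i. i < M \<Longrightarrow> A i \<in> carrier_mat n n" and M: "0 < M" and h: "0 < h"
    and contr: "generators.contracting n M (entries A) h"
  shows "matrix_certificate n M (subspace_dim n (\<Inter>i<M. mat_kernel (A i))) A h"
proof -
  interpret generators n M "entries A" .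
  define m where "m = subspace_dim n (\<Inter>i<M. mat_kernel (A i))"
  obtain d where d: "\<And>b. b < m \<Longrightarrow> d b \<in> (\<Inter>i<M. mat_kernel (A i))"
    and d_span: "\<And>v. v \<in> (\<Inter>i<M. mat_kernel (A i)) \<Longrightarrow> \<exists>s. \<forall>j<n. v $ j = (\<Sum>b<m. s b * d b $ j)"
    by (rule common_kernel_basis [of M A n, folded m_def]) (rule A, assumption, rule M, rule that)
  have d_carrier: "d b \<in> carrier_vec n" if "b < m" for b
  proof -
    have "d b \<in> mat_kernel (A 0)" using d [OF that] M by blast
    then show ?thesis using mat_kernel [OF A [OF M]] by blast
  qed
  obtain r c p \<rho> where \<rho>: "0 \<le> \<rho>" "\<rho> < 1"
    and units: "\<And>j. j < n \<Longrightarrow> \<exists>a<r. \<forall>k<n. c a k = (if k = j then 1 else 0)"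
    and inv: "\<And>i a. i < M \<Longrightarrow> a < r \<Longrightarrow> (\<lambda>j. G i (c a) j - (\<Sum>b<r. p i b a * c b j)) \<in> ker"
    and colsum: "\<And>i a. i < M \<Longrightarrow> a < r \<Longrightarrow> norm1 r (\<lambda>b. (if b = a then 1 else 0) + h * p i b a) \<le> \<rho>"
    by (rule certificate_if_contracting [OF h contr]) (rule that)
  have "\<exists>s. \<forall>j<n. G i (c a) j - (\<Sum>b<r. p i b a * c b j) = (\<Sum>b<m. s b * d b $ j)" if "i < M" "a < r" for i a
  proof -
    let ?v = "vec n (\<lambda>j. G i (c a) j - (\<Sum>b<r. p i b a * c b j))"
    have "($) ?v \<in> ker" by (rule ker_cong [THEN iffD2, OF _ inv [OF that]]) simp
    then have "?v \<in> (\<Inter>i<M. mat_kernel (A i))"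
      by (subst (asm) mem_ker_entries_iff) (use A M in auto)
    then show ?thesis using d_span [of ?v] by auto
  qed
  then have "\<forall>ia. \<exists>s. fst ia < M \<and> snd ia < r \<longrightarrow>
      (\<forall>j<n. G (fst ia) (c (snd ia)) j - (\<Sum>b<r. p (fst ia) b (snd ia) * c b j) = (\<Sum>b<m. s b * d b $ j))"
    by simp
  then obtain s where "\<forall>ia. fst ia < M \<and> snd ia < r \<longrightarrow>
      (\<forall>j<n. G (fst ia) (c (snd ia)) j - (\<Sum>b<r. p (fst ia) b (snd ia) * c b j) = (\<Sum>b<m. s ia b * d b $ j))"
    by (rule choice [THEN exE])
  then have s: "G i (c a) j = (\<Sum>b<r. p i b a * c b j) + (\<Sum>b<m. s (i, a) b * d b $ j)"
    if "i < M" "a < r" "j < n" for i a j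
    using that by (auto dest!: spec [of _ "(i, a)"] simp: algebra_simps)
  define X where "X = mat n (r + m) (\<lambda>(j, a). if a < r then c a j else d (a - r) $ j)"
  define Q where "Q i = mat r r (\<lambda>(b, a). p i b a)" for i
  define R where "R i = mat m r (\<lambda>(b, a). s (i, a) b)" for i
  have X: "X \<in> carrier_mat n (r + m)" and Q: "Q i \<in> carrier_mat r r" and R: "R i \<in> carrier_mat m r" for i
    by (simp_all add: X_def Q_def R_def)
  have "full_row_rank n X"
    unfolding full_row_rank_iff_surjective [OF X]
  proof
    fix y :: "real vec" assume y: "y \<in> carrier_vec n"
    have "\<forall>j. \<exists>a. j < n \<longrightarrow> a < r \<and> (\<forall>k<n. c a k = (if k = j then 1 else 0))"
      using units by blast
    then obtain e where "\<forall>j. j < n \<longrightarrow> e j < r \<and> (\<forall>k<n. c (e j) k = (if k = j then 1 else 0))"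
      by (rule choice [THEN exE])
    then have e: "\<And>j. j < n \<Longrightarrow> e j < r" "\<And>j k. j < n \<Longrightarrow> k < n \<Longrightarrow> c (e j) k = (if k = j then 1 else 0)"
      by auto
    define z where "z = vec (r + m) (\<lambda>a. \<Sum>j<n. if e j = a then y $ j else 0)"
    have "(X *\<^sub>v z) $ k = y $ k" if k: "k < n" for k
    proof -
      have "(X *\<^sub>v z) $ k = (\<Sum>a<r + m. X $$ (k, a) * (\<Sum>j<n. if e j = a then y $ j else 0))"
        using X k by (simp add: z_def scalar_prod_def atLeast0LessThan)
      also have "\<dots> = (\<Sum>j<n. \<Sum>a<r + m. if e j = a then X $$ (k, a) * y $ j else 0)"
        unfolding sum_distrib_left by (subst sum.swap) (intro sum.cong, auto)
      also have "\<dots> = (\<Sum>j<n. X $$ (k, e j) * y $ j)"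
        using e(1) by (intro sum.cong) (auto simp: sum.delta trans_less_add1)
      also have "\<dots> = (\<Sum>j<n. (if k = j then 1 else 0) * y $ j)"
        using e k by (intro sum.cong) (auto simp: X_def trans_less_add1)
      also have "\<dots> = y $ k"
        using k by (simp add: if_distrib [where f = "\<lambda>c. c * _"] cong: if_cong)
      finally show ?thesis .
    qed
    then have "X *\<^sub>v z = y" using X y by (intro eq_vecI) auto
    moreover have "z \<in> carrier_vec (r + m)" by (simp add: z_def)
    ultimately show "\<exists>z\<in>carrier_vec (r + m). X *\<^sub>v z = y" by blast
  qed
  moreover have "mat_norm1 (1\<^sub>m r + h \<cdot>\<^sub>m Q i) < 1" if "i < M" for i
  proof -
    have "mat_norm1 (1\<^sub>m r + h \<cdot>\<^sub>m Q i) \<le> \<rho>"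
    proof (rule mat_norm1_le_if_column_sums)
      show "1\<^sub>m r + h \<cdot>\<^sub>m Q i \<in> carrier_mat r r" using Q by simp
      show "(\<Sum>b<r. \<bar>(1\<^sub>m r + h \<cdot>\<^sub>m Q i) $$ (b, a)\<bar>) \<le> \<rho>" if "a < r" for a
        using colsum [OF \<open>i < M\<close> that] that by (simp add: norm1_def Q_def)
    qed (fact \<rho>)
    then show ?thesis using \<rho>(2) by simp
  qed
  moreover have "A i * X = X * four_block_mat (Q i) (0\<^sub>m r m) (R i) (0\<^sub>m m m)" if i: "i < M" for i
  proof (rule eq_matI)
    fix j a assume "j < dim_row (X * four_block_mat (Q i) (0\<^sub>m r m) (R i) (0\<^sub>m m m))"
      "a < dim_col (X * four_block_mat (Q i) (0\<^sub>m r m) (R i) (0\<^sub>m m m))"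
    then have j: "j < n" and a: "a < r + m" using X Q [of i] R [of i] by auto
    have AX: "(A i * X) $$ (j, a) = (\<Sum>k<n. A i $$ (j, k) * X $$ (k, a))"
      using A [OF i] X j a by (simp add: scalar_prod_def atLeast0LessThan)
    show "(A i * X) $$ (j, a) = (X * four_block_mat (Q i) (0\<^sub>m r m) (R i) (0\<^sub>m m m)) $$ (j, a)"
    proof (cases "a < r")
      case True
      have "(A i * X) $$ (j, a) = G i (c a) j"
        unfolding AX using True by (simp add: G_def X_def)
      then show ?thesis
        unfolding index_mult_lower_block [OF X Q R j a] s [OF i True j]
        using True j by (simp add: Q_def R_def X_def)
    next
      case False
      then have b: "a - r < m" using a by linarith
      have "(A i * X) $$ (j, a) = (A i *\<^sub>v d (a - r)) $ j"
        unfolding AX using False a j A [OF i] d_carrier [OF b]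
        by (simp add: X_def scalar_prod_def atLeast0LessThan)
      also have "A i *\<^sub>v d (a - r) = 0\<^sub>v n"
        using d [OF b] i mat_kernel [OF A [OF i]] by blast
      finally show ?thesis
        unfolding index_mult_lower_block [OF X Q R j a] using False j by simp
    qed
  qed (use A [OF i] X Q [of i] R [of i] in auto)
  ultimately show ?thesis
    unfolding matrix_certificate_def m_def [symmetric]
    by (intro exI [of _ r] exI [of _ X] exI [of _ Q] exI [of _ R]) (simp add: X Q R)
qed

section \<open>Strong convergence and certificates\<close>

lemma weights_in_mixtures: "w \<in> weights M \<Longrightarrow> ($) w \<in> generators.mixtures M"
  by (simp add: weights_def generators.mixtures_def)

lemma vec_in_weights: "w \<in> generators.mixtures M \<Longrightarrow> vec M w \<in> weights M"
  by (simp add: weights_def generators.mixtures_def)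

lemma convex_mat_mult_eq_mix:
  assumes "\<And>i. i < M \<Longrightarrow> A i \<in> carrier_mat n n" "x \<in> carrier_vec n" "j < n"
  shows "(convex_mat n M A w *\<^sub>v x) $ j = generators.mix n M (entries A) (($) w) (($) x) j"
proof -
  have "(convex_mat n M A w *\<^sub>v x) $ j = (\<Sum>k<n. \<Sum>i<M. w $ i * A i $$ (j, k) * x $ k)"
    using assms by (simp add: convex_mat_def scalar_prod_def atLeast0LessThan sum_distrib_right)
  also have "\<dots> = generators.mix n M (entries A) (($) w) (($) x) j"
    unfolding generators.mix_def generators.G_def sum_distrib_left
    by (subst sum.swap) (simp add: mult.assoc)
  finally show ?thesis .
qed

text \<open>
  Since the weights add up to one, the identity can be moved out of the convex combination: a step of the
  difference inclusion is an Euler step of length one.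
\<close>

lemma convex_mat_mult_eq_euler_step:
  assumes A: "\<And>i. i < M \<Longrightarrow> A i \<in> carrier_mat n n" and x: "x \<in> carrier_vec n" and j: "j < n"
    and w: "(\<Sum>i<M. w $ i) = 1"
  shows "(convex_mat n M A w *\<^sub>v x) $ j
    = x $ j + generators.mix n M (entries (\<lambda>i. A i - 1\<^sub>m n)) (($) w) (($) x) j"
proof -
  interpret A: generators n M "entries A" .
  interpret B: generators n M "entries (\<lambda>i. A i - 1\<^sub>m n)" .
  have "B.G i (($) x) j = A.G i (($) x) j - x $ j" if "i < M" for i
  proof -
    have "B.G i (($) x) j = (\<Sum>k<n. A i $$ (j, k) * x $ k - (if j = k then x $ k else 0))"
      unfolding B.G_def using A [OF that] j by (intro sum.cong) (auto simp: left_diff_distrib)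
    then show ?thesis using j by (simp add: A.G_def sum_subtractf)
  qed
  then have "B.mix (($) w) (($) x) j = (\<Sum>i<M. w $ i * (A.G i (($) x) j - x $ j))"
    unfolding B.mix_def by (intro sum.cong) auto
  also have "\<dots> = A.mix (($) w) (($) x) j - x $ j"
    using w by (simp add: A.mix_def right_diff_distrib sum_subtractf sum_distrib_right [symmetric])
  finally show ?thesis using convex_mat_mult_eq_mix [of M A n x j w, OF A x j] by simp
qed

theorem strongly_convergent_dt_iff_certificate:
  assumes M: "0 < M" and A: "\<And>i. i < M \<Longrightarrow> A i \<in> carrier_mat n n"
  shows "strongly_convergent_dt n M A \<longleftrightarrow>
    matrix_certificate n M (subspace_dim n (equilibria_dt n M A)) (\<lambda>i. A i - 1\<^sub>m n) 1"
proof -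
  let ?B = "\<lambda>i. A i - 1\<^sub>m n"
  have B: "?B i \<in> carrier_mat n n" for i by (rule minus_carrier_mat) simp
  interpret generators n M "entries ?B" .
  have eq: "equilibria_dt n M A = (\<Inter>i<M. mat_kernel (?B i))" by (simp add: equilibria_dt_def)
  have ker_iff: "($) v \<in> ker \<longleftrightarrow> v \<in> equilibria_dt n M A" if "v \<in> carrier_vec n" for v
    unfolding eq by (rule mem_ker_entries_iff) (use B M that in auto)
  have eq_carrier: "v \<in> carrier_vec n" if "v \<in> equilibria_dt n M A" for v
    using that mat_kernel [OF B] M unfolding eq by blast
  show ?thesis
  proof
    assume sc: "strongly_convergent_dt n M A"
    have "contracting 1"
    proof (rule contracting_if_all_trajectories_converge)
      fix w :: "nat \<Rightarrow> nat \<Rightarrow> real" and x :: "nat \<Rightarrow> real"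
      assume w: "\<And>l. w l \<in> mixtures"
      define W where "W l = vec M (w l)" for l
      define X where "X l = vec n (euler 1 w x l)" for l
      have W: "W l \<in> weights M" for l unfolding W_def by (rule vec_in_weights) (rule w)
      have "solution_dt n M A W X"
        unfolding solution_dt_def
      proof (intro conjI allI)
        show "X 0 \<in> carrier_vec n" by (simp add: X_def)
        fix k
        show "X (Suc k) = convex_mat n M A (W k) *\<^sub>v X k"
        proof (rule eq_vecI)
          fix j assume "j < dim_vec (convex_mat n M A (W k) *\<^sub>v X k)"
          then have j: "j < n" by (simp add: convex_mat_def)
          have "(convex_mat n M A (W k) *\<^sub>v X k) $ j = X k $ j + mix (($) (W k)) (($) (X k)) j"
            using W [of k] by (intro convex_mat_mult_eq_euler_step A j) (auto simp: X_def weights_def)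
          also have "mix (($) (W k)) (($) (X k)) j = mix (w k) (euler 1 w x k) j"
            unfolding mix_def by (intro sum.cong arg_cong2 [where f = "(*)"] G_cong) (auto simp: W_def X_def)
          finally show "X (Suc k) $ j = (convex_mat n M A (W k) *\<^sub>v X k) $ j"
            using j by (simp add: X_def)
        qed (simp add: X_def convex_mat_def)
      qed
      with sc [unfolded strongly_convergent_dt_def, rule_format, of W X] W
      have "\<exists>v\<in>equilibria_dt n M A. vec_tendsto n X v sequentially" by simp
      then obtain v where v: "v \<in> equilibria_dt n M A" "vec_tendsto n X v sequentially"
        by (rule bexE)
      have "(\<lambda>l. defect (($) (X l))) \<longlonglongrightarrow> defect (($) v)"
        by (rule tendsto_defect) (use v(2) in \<open>simp add: vec_tendsto_def\<close>)
      moreover have "defect (($) v) = 0"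
        unfolding defect_eq_0_iff using ker_iff [OF eq_carrier [OF v(1)]] v(1) by simp
      moreover have "defect (($) (X l)) = defect (euler 1 w x l)" for l
        by (rule defect_cong) (simp add: X_def)
      ultimately show "(\<lambda>l. defect (euler 1 w x l)) \<longlonglongrightarrow> 0" by simp
    qed simp
    then show "matrix_certificate n M (subspace_dim n (equilibria_dt n M A)) ?B 1"
      unfolding eq using B M by (intro matrix_certificate_if_contracting) auto
  next
    assume cert: "matrix_certificate n M (subspace_dim n (equilibria_dt n M A)) ?B 1"
    obtain \<rho> r c p where "polyhedral_certificate n M (entries ?B) 1 \<rho> r c p"
      by (rule polyhedral_certificate_if_matrix_certificate [of M ?B n 1])
        (rule B, rule M, simp, rule cert, rule that)
    then interpret polyhedral_certificate n M "entries ?B" 1 \<rho> r c p .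
    show "strongly_convergent_dt n M A"
      unfolding strongly_convergent_dt_def
    proof (intro allI impI)
      fix w x assume w: "\<forall>k. w k \<in> weights M" and sol: "solution_dt n M A w x"
      have x0: "x 0 \<in> carrier_vec n"
        using sol unfolding solution_dt_def by (rule conjunct1)
      have step: "x (Suc k) = convex_mat n M A (w k) *\<^sub>v x k" for k
        using sol unfolding solution_dt_def by (elim conjE allE)
      have "dim_vec (convex_mat n M A (w k) *\<^sub>v x k) = n" for k
        by (simp add: convex_mat_def)
      then have x_carrier: "x k \<in> carrier_vec n" for k
        by (cases k) (simp_all only: x0 step carrier_vecI)
      have "\<exists>y\<in>ker. \<forall>j<n. (\<lambda>k. x k $ j) \<longlonglongrightarrow> y j"
      proof (rule discrete_trajectories_converge [of "\<lambda>k. ($) (w k)"])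
        show "($) (w k) \<in> mixtures" for k using w by (intro weights_in_mixtures) auto
        show "x (Suc k) $ j = x k $ j + mix (($) (w k)) (($) (x k)) j" if "j < n" for k j
        proof -
          have "(convex_mat n M A (w k) *\<^sub>v x k) $ j = x k $ j + mix (($) (w k)) (($) (x k)) j"
            using w by (intro convex_mat_mult_eq_euler_step A that x_carrier) (auto simp: weights_def)
          then show ?thesis unfolding step .
        qed
      qed simp
      then obtain y where y: "y \<in> ker" "\<forall>j<n. (\<lambda>k. x k $ j) \<longlonglongrightarrow> y j" by (rule bexE)
      have "($) (vec n y) \<in> ker" by (rule ker_cong [THEN iffD2, OF _ y(1)]) simp
      then have "vec n y \<in> equilibria_dt n M A" using ker_iff [of "vec n y"] by simp
      moreover have "vec_tendsto n x (vec n y) sequentially"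
        using y(2) by (simp add: vec_tendsto_def)
      ultimately show "\<exists>xbar\<in>equilibria_dt n M A. vec_tendsto n x xbar sequentially"
        by (intro bexI [of _ "vec n y"])
    qed
  qed
qed

text \<open>
  If no step size were contracting, the persistent solution would have a limit of defect at least one
  half, whereas equilibria have defect zero.
\<close>

theorem strongly_convergent_ct_iff_certificate:
  assumes M: "0 < M" and A: "\<And>i. i < M \<Longrightarrow> A i \<in> carrier_mat n n"
  shows "strongly_convergent_ct n M A \<longleftrightarrow>
    (\<exists>h>0. matrix_certificate n M (subspace_dim n (equilibria_ct M A)) A h)"
proof -
  interpret generators n M "entries A" .
  have eq: "equilibria_ct M A = (\<Inter>i<M. mat_kernel (A i))" by (simp add: equilibria_ct_def)
  have ker_iff: "($) v \<in> ker \<longleftrightarrow> v \<in> equilibria_ct M A" if "v \<in> carrier_vec n" for v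
    unfolding eq by (rule mem_ker_entries_iff) (use A M that in auto)
  have eq_carrier: "v \<in> carrier_vec n" if "v \<in> equilibria_ct M A" for v
    using that mat_kernel [OF A [OF M]] M unfolding eq by blast
  show ?thesis
  proof
    assume sc: "strongly_convergent_ct n M A"
    have "\<exists>h>0. contracting h"
    proof (rule ccontr)
      assume "\<not> (\<exists>h>0. contracting h)"
      then have nc: "\<And>h. 0 < h \<Longrightarrow> \<not> contracting h" by blast
      obtain w x where w_meas: "\<And>i. i < M \<Longrightarrow> (\<lambda>t. w t i) \<in> borel_measurable borel"
        and w: "\<And>t. w t \<in> mixtures" and x_cont: "\<And>j. j < n \<Longrightarrow> continuous_on {0..} (\<lambda>t. x t j)"
        and x_sol: "\<And>(t::real) j. 0 \<le> t \<Longrightarrow> j < n \<Longrightarrow> ((\<lambda>s. mix (w s) (x s) j) has_integral (x t j - x 0 j)) {0..t}"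
        and x_q: "\<And>t. 0 \<le> t \<Longrightarrow> 1/2 \<le> defect (x t)"
        by (rule persistent_solution_if_no_step_contracts [OF M nc]) (assumption, rule that)
      define W where "W t = vec M (w t)" for t
      define X where "X t = vec n (x t)" for t
      have "measurable_weights M W"
        unfolding measurable_weights_def
      proof (intro conjI allI impI)
        show "W t \<in> weights M" for t unfolding W_def by (rule vec_in_weights) (rule w)
        show "(\<lambda>t. W t $ i) \<in> borel_measurable (lebesgue_on {0..})" if "i < M" for i
          using w_meas [OF that] that unfolding W_def
          by (simp, intro measurable_restrict_space1 measurable_completion) simp
      qed
      moreover have "solution_ct n M A W X"
        unfolding solution_ct_def
      proof (intro conjI allI impI)
        show "X t \<in> carrier_vec n" for t by (simp add: X_def)
        show "continuous_on {0..} (\<lambda>t. X t $ j)" if "j < n" for j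
          using x_cont [OF that] that by (simp add: X_def)
        show "((\<lambda>s. (convex_mat n M A (W s) *\<^sub>v X s) $ j) has_integral X t $ j - X 0 $ j) {0..t}"
          if t: "0 \<le> t" and j: "j < n" for t j
        proof -
          have "(convex_mat n M A (W s) *\<^sub>v X s) $ j = mix (w s) (x s) j" for s
          proof -
            have "(convex_mat n M A (W s) *\<^sub>v X s) $ j = mix (($) (W s)) (($) (X s)) j"
              by (intro convex_mat_mult_eq_mix A j) (auto simp: X_def)
            also have "\<dots> = mix (w s) (x s) j"
              unfolding mix_def by (intro sum.cong arg_cong2 [where f = "(*)"] G_cong) (auto simp: W_def X_def)
            finally show ?thesis .
          qed
          then show ?thesis using x_sol [OF t j] j by (simp add: X_def)
        qed
      qed
      ultimately have "\<exists>v\<in>equilibria_ct M A. vec_tendsto n X v at_top"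
        by (rule sc [unfolded strongly_convergent_ct_def, rule_format])
      then obtain v where v: "v \<in> equilibria_ct M A" "vec_tendsto n X v at_top"
        by (rule bexE)
      have "((\<lambda>t. defect (($) (X t))) \<longlongrightarrow> defect (($) v)) at_top"
        by (rule tendsto_defect) (use v(2) in \<open>simp add: vec_tendsto_def\<close>)
      moreover have "\<forall>\<^sub>F t in at_top. 1/2 \<le> defect (($) (X t))"
      proof (rule eventually_mono [OF eventually_ge_at_top [of 0]])
        fix t :: real assume "0 \<le> t"
        moreover have "defect (($) (X t)) = defect (x t)" by (rule defect_cong) (simp add: X_def)
        ultimately show "1/2 \<le> defect (($) (X t))" using x_q by simp
      qed
      ultimately have "1/2 \<le> defect (($) v)"
        by (rule tendsto_lowerbound) simp
      moreover have "defect (($) v) = 0"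
        unfolding defect_eq_0_iff using ker_iff [OF eq_carrier [OF v(1)]] v(1) by simp
      ultimately show False by simp
    qed
    then obtain h where h: "0 < h" "contracting h" by blast
    then have "matrix_certificate n M (subspace_dim n (equilibria_ct M A)) A h"
      unfolding eq using A M by (intro matrix_certificate_if_contracting) auto
    then show "\<exists>h>0. matrix_certificate n M (subspace_dim n (equilibria_ct M A)) A h"
      using h by blast
  next
    assume "\<exists>h>0. matrix_certificate n M (subspace_dim n (equilibria_ct M A)) A h"
    then obtain h where h: "0 < h" "matrix_certificate n M (subspace_dim n (equilibria_ct M A)) A h" by blast
    obtain \<rho> r c p where "polyhedral_certificate n M (entries A) h \<rho> r c p"
      by (rule polyhedral_certificate_if_matrix_certificate [of M A n h])
        (rule A, assumption, rule M, rule h, rule h, rule that)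
    then interpret polyhedral_certificate n M "entries A" h \<rho> r c p .
    show "strongly_convergent_ct n M A"
      unfolding strongly_convergent_ct_def
    proof (intro allI impI)
      fix w x assume w: "measurable_weights M w" and sol: "solution_ct n M A w x"
      have "\<exists>y\<in>ker. \<forall>j<n. ((\<lambda>t. x t $ j) \<longlongrightarrow> y j) at_top"
      proof (rule continuous_solutions_converge [of "\<lambda>t. ($) (w t)"])
        show "($) (w t) \<in> mixtures" if "0 \<le> t" for t
          using w that by (intro weights_in_mixtures) (auto simp: measurable_weights_def)
        show "(\<lambda>t. w t $ i) \<in> borel_measurable (lebesgue_on {0..})" if "i < M" for i
          using w that by (auto simp: measurable_weights_def)
        show "continuous_on {0..} (\<lambda>t. x t $ j)" if "j < n" for j
          using sol that by (auto simp: solution_ct_def)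
        show "((\<lambda>s. mix (($) (w s)) (($) (x s)) j) has_integral x t $ j - x 0 $ j) {0..t}"
          if t: "0 \<le> t" and j: "j < n" for t j
        proof (rule has_integral_eq [rotated])
          show "((\<lambda>s. (convex_mat n M A (w s) *\<^sub>v x s) $ j) has_integral x t $ j - x 0 $ j) {0..t}"
            using sol t j by (simp add: solution_ct_def)
          show "(convex_mat n M A (w s) *\<^sub>v x s) $ j = mix (($) (w s)) (($) (x s)) j" if "s \<in> {0..t}" for s
            using sol that by (intro convex_mat_mult_eq_mix A j) (auto simp: solution_ct_def)
        qed
      qed
      then obtain y where y: "y \<in> ker" "\<forall>j<n. ((\<lambda>t. x t $ j) \<longlongrightarrow> y j) at_top" by (rule bexE)
      have "($) (vec n y) \<in> ker" by (rule ker_cong [THEN iffD2, OF _ y(1)]) simp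
      then have "vec n y \<in> equilibria_ct M A" using ker_iff [of "vec n y"] by simp
      moreover have "vec_tendsto n x (vec n y) at_top"
        using y(2) by (simp add: vec_tendsto_def)
      ultimately show "\<exists>xbar\<in>equilibria_ct M A. vec_tendsto n x xbar at_top"
        by (intro bexI [of _ "vec n y"])
    qed
  qed
qed

section \<open>The two block forms of the certificate\<close>

lemma four_block_add_one:
  fixes Q R :: "real mat"
  assumes "Q \<in> carrier_mat r r" "R \<in> carrier_mat m r"
  shows "four_block_mat (1\<^sub>m r + Q) (0\<^sub>m r m) R (1\<^sub>m m)
    = 1\<^sub>m (r + m) + four_block_mat Q (0\<^sub>m r m) R (0\<^sub>m m m)"
  using assms by (intro eq_matI) auto

lemma intertwining_shift_identity:
  fixes A X F :: "real mat"
  assumes A: "A \<in> carrier_mat n n" and X: "X \<in> carrier_mat n s" and F: "F \<in> carrier_mat s s"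
  shows "(A - 1\<^sub>m n) * X = X * F \<longleftrightarrow> A * X = X * (1\<^sub>m s + F)"
proof -
  have "(A - 1\<^sub>m n) * X = A * X - X"
    using minus_mult_distrib_mat [OF A one_carrier_mat X] X by simp
  moreover have "X * (1\<^sub>m s + F) = X + X * F"
    using mult_add_distrib_mat [OF X one_carrier_mat F] X by simp
  moreover have "A * X - X = X * F \<longleftrightarrow> A * X = X + X * F"
  proof
    assume eq: "A * X - X = X * F"
    show "A * X = X + X * F"
      unfolding eq [symmetric] using A X by (intro eq_matI) auto
  next
    assume eq: "A * X = X + X * F"
    show "A * X - X = X * F"
      unfolding eq using A X F by (intro eq_matI) auto
  qed
  ultimately show ?thesis by simp
qed

lemma one_smult_mat: "1 \<cdot>\<^sub>m Q = Q" for Q :: "real mat"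
  by (intro eq_matI) auto

lemma discrete_form_of_certificate:
  assumes A: "\<And>i. i < M \<Longrightarrow> A i \<in> carrier_mat n n"
  shows "matrix_certificate n M m (\<lambda>i. A i - 1\<^sub>m n) 1 \<longleftrightarrow>
    (\<exists>r X Pas Pr P. X \<in> carrier_mat n (r + m) \<and> full_row_rank n X \<and>
       (\<forall>i<M. Pas i \<in> carrier_mat r r \<and> Pr i \<in> carrier_mat m r \<and>
          P i = four_block_mat (Pas i) (0\<^sub>m r m) (Pr i) (1\<^sub>m m) \<and>
          mat_norm1 (Pas i) < 1 \<and> A i * X = X * P i))" (is "_ \<longleftrightarrow> ?R")
proof
  assume "matrix_certificate n M m (\<lambda>i. A i - 1\<^sub>m n) 1"
  then obtain r X Q R where X: "X \<in> carrier_mat n (r + m)" "full_row_rank n X"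
    and c: "\<forall>i<M. Q i \<in> carrier_mat r r \<and> R i \<in> carrier_mat m r \<and>
      mat_norm1 (1\<^sub>m r + 1 \<cdot>\<^sub>m Q i) < 1 \<and>
      (A i - 1\<^sub>m n) * X = X * four_block_mat (Q i) (0\<^sub>m r m) (R i) (0\<^sub>m m m)"
    unfolding matrix_certificate_def by blast
  show ?R
  proof (intro exI conjI allI impI)
    show "X \<in> carrier_mat n (r + m)" "full_row_rank n X" by (fact X)+
    fix i assume i: "i < M"
    have Q: "Q i \<in> carrier_mat r r" and R: "R i \<in> carrier_mat m r"
      and norm1: "mat_norm1 (1\<^sub>m r + 1 \<cdot>\<^sub>m Q i) < 1"
      and AX: "(A i - 1\<^sub>m n) * X = X * four_block_mat (Q i) (0\<^sub>m r m) (R i) (0\<^sub>m m m)"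
      using c i by auto
    show "1\<^sub>m r + Q i \<in> carrier_mat r r" "R i \<in> carrier_mat m r" using Q R by auto
    show "mat_norm1 (1\<^sub>m r + Q i) < 1" using norm1 unfolding one_smult_mat .
    show "four_block_mat (1\<^sub>m r + Q i) (0\<^sub>m r m) (R i) (1\<^sub>m m) = four_block_mat (1\<^sub>m r + Q i) (0\<^sub>m r m) (R i) (1\<^sub>m m)" ..
    show "A i * X = X * four_block_mat (1\<^sub>m r + Q i) (0\<^sub>m r m) (R i) (1\<^sub>m m)"
      unfolding four_block_add_one [OF Q R]
      using AX by (subst (asm) intertwining_shift_identity [OF A [OF i] X(1)]) (use Q R in auto)
  qed
next
  assume ?R
  then obtain r X Pas Pr P where X: "X \<in> carrier_mat n (r + m)" "full_row_rank n X"
    and c: "\<forall>i<M. Pas i \<in> carrier_mat r r \<and> Pr i \<in> carrier_mat m r \<and>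
          P i = four_block_mat (Pas i) (0\<^sub>m r m) (Pr i) (1\<^sub>m m) \<and>
          mat_norm1 (Pas i) < 1 \<and> A i * X = X * P i"
    by blast
  show "matrix_certificate n M m (\<lambda>i. A i - 1\<^sub>m n) 1"
    unfolding matrix_certificate_def
  proof (intro exI conjI allI impI)
    show "X \<in> carrier_mat n (r + m)" "full_row_rank n X" by (fact X)+
    fix i assume i: "i < M"
    define Q where "Q = Pas i - 1\<^sub>m r"
    have P: "Pas i \<in> carrier_mat r r" and R: "Pr i \<in> carrier_mat m r" and norm1: "mat_norm1 (Pas i) < 1"
      and AX: "A i * X = X * four_block_mat (Pas i) (0\<^sub>m r m) (Pr i) (1\<^sub>m m)"
      using c i by auto
    have Q: "Q \<in> carrier_mat r r" unfolding Q_def by (rule minus_carrier_mat) simp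
    have PQ: "Pas i = 1\<^sub>m r + Q" unfolding Q_def using P by (intro eq_matI) auto
    show "Pas i - 1\<^sub>m r \<in> carrier_mat r r" "Pr i \<in> carrier_mat m r"
      using Q R by (auto simp: Q_def)
    show "mat_norm1 (1\<^sub>m r + 1 \<cdot>\<^sub>m (Pas i - 1\<^sub>m r)) < 1"
      unfolding one_smult_mat Q_def [symmetric] using norm1 unfolding PQ .
    show "(A i - 1\<^sub>m n) * X = X * four_block_mat (Pas i - 1\<^sub>m r) (0\<^sub>m r m) (Pr i) (0\<^sub>m m m)"
      unfolding Q_def [symmetric]
      using AX Q R unfolding PQ four_block_add_one [OF Q R]
      by (subst intertwining_shift_identity [OF A [OF i] X(1)]) auto
  qed
qed

text \<open>
  Each Lozinski measure yields its own step size. The smallest of these finitely many step sizes works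
  for all generators, because shorter steps keep the norm below one.
\<close>

lemma lozinski_form_of_certificate:
  assumes M: "0 < M"
  shows "(\<exists>h>0. matrix_certificate n M m A h) \<longleftrightarrow>
    (\<exists>r X Pas Pr P. X \<in> carrier_mat n (r + m) \<and> full_row_rank n X \<and>
       (\<forall>i<M. Pas i \<in> carrier_mat r r \<and> Pr i \<in> carrier_mat m r \<and>
          P i = four_block_mat (Pas i) (0\<^sub>m r m) (Pr i) (0\<^sub>m m m) \<and>
          lozinski1 (Pas i) < 0 \<and> A i * X = X * P i))" (is "_ \<longleftrightarrow> ?R")
proof
  assume "\<exists>h>0. matrix_certificate n M m A h"
  then obtain h r X Q R where h: "0 < h" and X: "X \<in> carrier_mat n (r + m)" "full_row_rank n X"
    and c: "\<forall>i<M. Q i \<in> carrier_mat r r \<and> R i \<in> carrier_mat m r \<and>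
      mat_norm1 (1\<^sub>m r + h \<cdot>\<^sub>m Q i) < 1 \<and>
      A i * X = X * four_block_mat (Q i) (0\<^sub>m r m) (R i) (0\<^sub>m m m)"
    unfolding matrix_certificate_def by blast
  show ?R
  proof (intro exI conjI allI impI)
    show "X \<in> carrier_mat n (r + m)" "full_row_rank n X" by (fact X)+
    fix i assume i: "i < M"
    then show Q: "Q i \<in> carrier_mat r r" and "R i \<in> carrier_mat m r"
      and "A i * X = X * four_block_mat (Q i) (0\<^sub>m r m) (R i) (0\<^sub>m m m)"
      using c by auto
    show "lozinski1 (Q i) < 0"
      unfolding lozinski1_neg_iff [OF Q] using h c i by blast
  qed (rule refl)
next
  assume ?R
  then obtain r X Q R where X: "X \<in> carrier_mat n (r + m)" "full_row_rank n X"
    and c: "\<forall>i<M. Q i \<in> carrier_mat r r \<and> R i \<in> carrier_mat m r \<and> lozinski1 (Q i) < 0 \<and>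
      A i * X = X * four_block_mat (Q i) (0\<^sub>m r m) (R i) (0\<^sub>m m m)"
    by (metis (no_types, lifting))
  have "\<forall>i. \<exists>h. i < M \<longrightarrow> 0 < h \<and> mat_norm1 (1\<^sub>m r + h \<cdot>\<^sub>m Q i) < 1"
  proof
    fix i
    show "\<exists>h. i < M \<longrightarrow> 0 < h \<and> mat_norm1 (1\<^sub>m r + h \<cdot>\<^sub>m Q i) < 1"
      using lozinski1_neg_iff [of "Q i" r] c by auto
  qed
  then obtain k where "\<forall>i. i < M \<longrightarrow> 0 < k i \<and> mat_norm1 (1\<^sub>m r + k i \<cdot>\<^sub>m Q i) < 1"
    by (rule choice [THEN exE])
  then have k: "0 < k i" "mat_norm1 (1\<^sub>m r + k i \<cdot>\<^sub>m Q i) < 1" if "i < M" for i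
    using that by auto
  define h where "h = Min (k ` {..<M})"
  have h: "0 < h" unfolding h_def using M k(1) by (subst Min_gr_iff) auto
  have "matrix_certificate n M m A h"
    unfolding matrix_certificate_def
  proof (intro exI conjI allI impI)
    show "X \<in> carrier_mat n (r + m)" "full_row_rank n X" by (fact X)+
    fix i assume i: "i < M"
    then show Q: "Q i \<in> carrier_mat r r" and "R i \<in> carrier_mat m r"
      and "A i * X = X * four_block_mat (Q i) (0\<^sub>m r m) (R i) (0\<^sub>m m m)"
      using c by auto
    have hk: "h \<le> k i" unfolding h_def using i by (intro Min_le) auto
    have "mat_norm1 (1\<^sub>m r + h \<cdot>\<^sub>m Q i) \<le> (1 - h / k i) + h / k i * mat_norm1 (1\<^sub>m r + k i \<cdot>\<^sub>m Q i)"
      by (rule mat_norm1_euler_step_convex [OF Q h hk])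
    also have "\<dots> < (1 - h / k i) + h / k i * 1"
      using h k [OF i] by (intro add_strict_left_mono mult_strict_left_mono) auto
    finally show "mat_norm1 (1\<^sub>m r + h \<cdot>\<^sub>m Q i) < 1" by simp
  qed
  then show "\<exists>h>0. matrix_certificate n M m A h" using h by blast
qed

theorem corollary1:
  fixes n M :: nat and A :: "nat \<Rightarrow> real mat"
  assumes "0 < M" and "\<And>i. i < M \<Longrightarrow> A i \<in> carrier_mat n n"
  shows
    "(let m = subspace_dim n (equilibria_dt n M A) in
        strongly_convergent_dt n M A \<longleftrightarrow>
        (\<exists>r X Pas Pr P. X \<in> carrier_mat n (r + m) \<and> full_row_rank n X \<and>
           (\<forall>i<M. Pas i \<in> carrier_mat r r \<and> Pr i \<in> carrier_mat m r \<and>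
              P i = four_block_mat (Pas i) (0\<^sub>m r m) (Pr i) (1\<^sub>m m) \<and>
              mat_norm1 (Pas i) < 1 \<and> A i * X = X * P i)))
     \<and>
     (let m = subspace_dim n (equilibria_ct M A) in
        strongly_convergent_ct n M A \<longleftrightarrow>
        (\<exists>r X Pas Pr P. X \<in> carrier_mat n (r + m) \<and> full_row_rank n X \<and>
           (\<forall>i<M. Pas i \<in> carrier_mat r r \<and> Pr i \<in> carrier_mat m r \<and>
              P i = four_block_mat (Pas i) (0\<^sub>m r m) (Pr i) (0\<^sub>m m m) \<and>
              lozinski1 (Pas i) < 0 \<and> A i * X = X * P i)))"
  unfolding Let_def
  by (intro conjI
      trans [OF strongly_convergent_dt_iff_certificate discrete_form_of_certificate]
      trans [OF strongly_convergent_ct_iff_certificate lozinski_form_of_certificate] assms)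

end
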